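(* Let $M$ be a semi-invariant $\xi^{\bot}$-submanifold of a generalized Quasi-Sasakian (G.Q.S.) manifold $\widetilde{M}$. Then the distribution $\mathcal{D}^{\bot}$ is integrable.
   Context: All manifolds and maps are smooth; $\Gamma(E)$ denotes the sections of a vector bundle $E$. An almost contact metric structure on a real $(2n+1)$-dimensional manifold $\widetilde{M}$ is $(\phi,\xi,\eta,\tilde g)$, where $\phi$ is a $(1,1)$-tensor field, $\xi$ a vector field, $\eta$ a 1-form and $\tilde g$ a Riemannian metric with $\phi^2=-I+\eta\otimes\xi$, $\eta(\xi)=1$, $\eta\circ\phi=0$, $\phi\xi=0$, $\eta(X)=\tilde g(X,\xi)$, $\tilde g(\phi X,Y)+\tilde g(X,\phi Y)=0$ for all vector fields $X,Y$. Let $\widetilde\nabla$ be the Levi-Civita connection of $\tilde g$. $\widetilde M$ is a generalized Quasi-Sasakian (G.Q.S.) manifold if $(\widetilde\nabla_X\phi)Y=\tilde g(\widetilde\nabla_{\phi X}\xi,Y)\xi-\eta(Y)\widetilde\nabla_{\phi X}\xi$ for all vector fields $X,Y$ on $\widetilde M$. A semi-invariant $\xi^{\bot}$-submanifold of $\widetilde M$ is an isometrically immersed submanifold $M$ such that $\xi$ is orthogonal to $M$ and there exist two orthogonal distributions $\mathcal{D},\mathcal{D}^{\bot}$ in $TM$ with $TM=\mathcal{D}\oplus\mathcal{D}^{\bot}$ (orthogonal sum), $\phi\mathcal{D}=\mathcal{D}$ and $\phi\mathcal{D}^{\bot}\subseteq TM^{\bot}$, where $TM^{\bot}$ is the normal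 bundle. *)

theory Defs
  imports "HOL-Analysis.Analysis"
begin

section \<open>Smooth maps on open subsets of Euclidean spaces\<close>

(* Meaningful for open S only; all derivatives below are taken at interior points. *)
primrec C_k_on :: "nat \<Rightarrow> ('a::euclidean_space \<Rightarrow> 'b::real_normed_vector) \<Rightarrow> 'a set \<Rightarrow> bool" where
  "C_k_on 0 f S \<longleftrightarrow> continuous_on S f"
| "C_k_on (Suc k) f S \<longleftrightarrow>
     (\<forall>x\<in>S. f differentiable (at x)) \<and>
     (\<forall>v. C_k_on k (\<lambda>x. frechet_derivative f (at x) v) S)"

definition smooth_on :: "'a::euclidean_space set \<Rightarrow> ('a \<Rightarrow> 'b::real_normed_vector) \<Rightarrow> bool" where
  "smooth_on S f \<longleftrightarrow> (\<forall>k. C_k_on k f S)"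


section \<open>Smooth manifolds\<close>

(* A chart is a domain together with a coordinate map; the values of the coordinate map outside
   the domain are irrelevant. *)
type_synonym ('m, 'e) chart = "'m set \<times> ('m \<Rightarrow> 'e)"

abbreviation cdom :: "('m, 'e) chart \<Rightarrow> 'm set" where
  "cdom c \<equiv> fst c"

abbreviation cmap :: "('m, 'e) chart \<Rightarrow> 'm \<Rightarrow> 'e" where
  "cmap c \<equiv> snd c"

definition cinv :: "('m, 'e) chart \<Rightarrow> 'e \<Rightarrow> 'm" where
  "cinv c = inv_into (cdom c) (cmap c)"

record ('m, 'e) mfd =
  mtop :: "'m topology"
  atlas :: "('m, 'e) chart set"

abbreviation points :: "('m, 'e) mfd \<Rightarrow> 'm set" where
  "points M \<equiv> topspace (mtop M)"

definition is_chart :: "'m topology \<Rightarrow> ('m, 'e::euclidean_space) chart \<Rightarrow> bool" where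
  "is_chart T c \<longleftrightarrow>
     openin T (cdom c) \<and> open (cmap c ` cdom c) \<and>
     homeomorphic_map (subtopology T (cdom c)) (top_of_set (cmap c ` cdom c)) (cmap c)"

definition smooth_compat ::
  "('m, 'e::euclidean_space) chart \<Rightarrow> ('m, 'e) chart \<Rightarrow> bool" where
  "smooth_compat c d \<longleftrightarrow>
     smooth_on (cmap c ` (cdom c \<inter> cdom d)) (cmap d \<circ> cinv c) \<and>
     smooth_on (cmap d ` (cdom c \<inter> cdom d)) (cmap c \<circ> cinv d)"

definition second_countable_space :: "'m topology \<Rightarrow> bool" where
  "second_countable_space T \<longleftrightarrow>
     (\<exists>\<B>. countable \<B> \<and> (\<forall>V\<in>\<B>. openin T V) \<and>
          (\<forall>U x. openin T U \<and> x \<in> U \<longrightarrow> (\<exists>V\<in>\<B>. x \<in> V \<and> V \<subseteq> U)))"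

definition smooth_manifold :: "('m, 'e::euclidean_space) mfd \<Rightarrow> bool" where
  "smooth_manifold M \<longleftrightarrow>
     Hausdorff_space (mtop M) \<and> second_countable_space (mtop M) \<and>
     (\<forall>c\<in>atlas M. is_chart (mtop M) c) \<and>
     (\<forall>c\<in>atlas M. \<forall>d\<in>atlas M. smooth_compat c d) \<and>
     (\<Union>c\<in>atlas M. cdom c) = points M"

(* The charts of the maximal atlas. *)
definition admissible_chart :: "('m, 'e::euclidean_space) mfd \<Rightarrow> ('m, 'e) chart \<Rightarrow> bool" where
  "admissible_chart M c \<longleftrightarrow> is_chart (mtop M) c \<and> (\<forall>d\<in>atlas M. smooth_compat c d)"


section \<open>Tangent vectors, vector fields and tensor fields\<close>

(* The tangent space at p is modelled on the whole of 'e: a vector v :: 'e stands for the tangent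
   vector at p whose coordinates in the preferred chart chart_at M p are v.  A vector field is
   thus a function 'm => 'e, a (1,1)-tensor field a function 'm => 'e => 'e, and so on.  Since
   chart_at M p jumps with p, smoothness is always tested after passing to a fixed chart. *)
definition chart_at :: "('m, 'e) mfd \<Rightarrow> 'm \<Rightarrow> ('m, 'e) chart" where
  "chart_at M p = (SOME c. c \<in> atlas M \<and> p \<in> cdom c)"

(* Coordinates in the chart c of the tangent vector v at p. *)
definition tcoord ::
  "('m, 'e::euclidean_space) mfd \<Rightarrow> ('m, 'e) chart \<Rightarrow> 'm \<Rightarrow> 'e \<Rightarrow> 'e" where
  "tcoord M c p v =
     frechet_derivative (cmap c \<circ> cinv (chart_at M p)) (at (cmap (chart_at M p) p)) v"

(* The tangent vector at p whose coordinates in the chart c are e. *)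
definition tvec ::
  "('m, 'e::euclidean_space) mfd \<Rightarrow> ('m, 'e) chart \<Rightarrow> 'm \<Rightarrow> 'e \<Rightarrow> 'e" where
  "tvec M c p e = frechet_derivative (cmap (chart_at M p) \<circ> cinv c) (at (cmap c p)) e"

(* The coordinate expression of the vector field X in the chart c. *)
definition local_rep ::
  "('m, 'e::euclidean_space) mfd \<Rightarrow> ('m, 'e) chart \<Rightarrow> ('m \<Rightarrow> 'e) \<Rightarrow> 'e \<Rightarrow> 'e" where
  "local_rep M c X x = tcoord M c (cinv c x) (X (cinv c x))"

definition smooth_vector_field_on ::
  "('m, 'e::euclidean_space) mfd \<Rightarrow> 'm set \<Rightarrow> ('m \<Rightarrow> 'e) \<Rightarrow> bool" where
  "smooth_vector_field_on M U X \<longleftrightarrow>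
     (\<forall>c\<in>atlas M. smooth_on (cmap c ` (cdom c \<inter> U)) (local_rep M c X))"

abbreviation vector_field :: "('m, 'e::euclidean_space) mfd \<Rightarrow> ('m \<Rightarrow> 'e) \<Rightarrow> bool" where
  "vector_field M X \<equiv> smooth_vector_field_on M (points M) X"

definition smooth_fun :: "('m, 'e::euclidean_space) mfd \<Rightarrow> ('m \<Rightarrow> real) \<Rightarrow> bool" where
  "smooth_fun M f \<longleftrightarrow> (\<forall>c\<in>atlas M. smooth_on (cmap c ` cdom c) (f \<circ> cinv c))"

definition one_form ::
  "('m, 'e::euclidean_space) mfd \<Rightarrow> ('m \<Rightarrow> 'e \<Rightarrow> real) \<Rightarrow> bool" where
  "one_form M \<eta> \<longleftrightarrow>
     (\<forall>p\<in>points M. linear (\<eta> p)) \<and>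
     (\<forall>c\<in>atlas M. \<forall>u. smooth_on (cmap c ` cdom c) (\<lambda>x. \<eta> (cinv c x) (tvec M c (cinv c x) u)))"

definition tensor_field_11 ::
  "('m, 'e::euclidean_space) mfd \<Rightarrow> ('m \<Rightarrow> 'e \<Rightarrow> 'e) \<Rightarrow> bool" where
  "tensor_field_11 M \<phi> \<longleftrightarrow>
     (\<forall>p\<in>points M. linear (\<phi> p)) \<and>
     (\<forall>c\<in>atlas M. \<forall>u. smooth_on (cmap c ` cdom c)
        (local_rep M c (\<lambda>p. \<phi> p (tvec M c p u))))"

definition riemannian_metric ::
  "('m, 'e::euclidean_space) mfd \<Rightarrow> ('m \<Rightarrow> 'e \<Rightarrow> 'e \<Rightarrow> real) \<Rightarrow> bool" where
  "riemannian_metric M g \<longleftrightarrow>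
     (\<forall>p\<in>points M. bilinear (g p) \<and> (\<forall>u v. g p u v = g p v u) \<and> (\<forall>u. u \<noteq> 0 \<longrightarrow> 0 < g p u u)) \<and>
     (\<forall>c\<in>atlas M. \<forall>u v. smooth_on (cmap c ` cdom c)
        (\<lambda>x. g (cinv c x) (tvec M c (cinv c x) u) (tvec M c (cinv c x) v)))"

(* The derivative v f of a function f along the tangent vector v at p. *)
definition dir_deriv ::
  "('m, 'e::euclidean_space) mfd \<Rightarrow> 'm \<Rightarrow> 'e \<Rightarrow> ('m \<Rightarrow> real) \<Rightarrow> real" where
  "dir_deriv M p v f =
     frechet_derivative (f \<circ> cinv (chart_at M p)) (at (cmap (chart_at M p) p)) v"

(* [X,Y] = DY(X) - DX(Y) in coordinates, evaluated in the preferred chart. *)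
definition lie_bracket ::
  "('m, 'e::euclidean_space) mfd \<Rightarrow> ('m \<Rightarrow> 'e) \<Rightarrow> ('m \<Rightarrow> 'e) \<Rightarrow> 'm \<Rightarrow> 'e" where
  "lie_bracket M X Y p =
     (let c = chart_at M p; x = cmap c p in
        frechet_derivative (local_rep M c Y) (at x) (X p)
      - frechet_derivative (local_rep M c X) (at x) (Y p))"


section \<open>The Levi-Civita connection\<close>

definition affine_connection ::
  "('m, 'e::euclidean_space) mfd \<Rightarrow> (('m \<Rightarrow> 'e) \<Rightarrow> ('m \<Rightarrow> 'e) \<Rightarrow> 'm \<Rightarrow> 'e) \<Rightarrow> bool" where
  "affine_connection M nabla \<longleftrightarrow>
     (\<forall>X Y. vector_field M X \<and> vector_field M Y \<longrightarrow> vector_field M (nabla X Y)) \<and>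
     (\<forall>X Y Z. vector_field M X \<and> vector_field M Y \<and> vector_field M Z \<longrightarrow>
        (\<forall>p\<in>points M. nabla (\<lambda>q. X q + Y q) Z p = nabla X Z p + nabla Y Z p \<and>
                      nabla X (\<lambda>q. Y q + Z q) p = nabla X Y p + nabla X Z p)) \<and>
     (\<forall>f X Y. smooth_fun M f \<and> vector_field M X \<and> vector_field M Y \<longrightarrow>
        (\<forall>p\<in>points M. nabla (\<lambda>q. f q *\<^sub>R X q) Y p = f p *\<^sub>R nabla X Y p \<and>
                      nabla X (\<lambda>q. f q *\<^sub>R Y q) p =
                        dir_deriv M p (X p) f *\<^sub>R Y p + f p *\<^sub>R nabla X Y p))"

definition levi_civita ::
  "('m, 'e::euclidean_space) mfd \<Rightarrow> ('m \<Rightarrow> 'e \<Rightarrow> 'e \<Rightarrow> real) \<Rightarrow>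
   (('m \<Rightarrow> 'e) \<Rightarrow> ('m \<Rightarrow> 'e) \<Rightarrow> 'm \<Rightarrow> 'e) \<Rightarrow> bool" where
  "levi_civita M g nabla \<longleftrightarrow>
     affine_connection M nabla \<and>
     (\<forall>X Y. vector_field M X \<and> vector_field M Y \<longrightarrow>
        (\<forall>p\<in>points M. nabla X Y p - nabla Y X p = lie_bracket M X Y p)) \<and>
     (\<forall>X Y Z. vector_field M X \<and> vector_field M Y \<and> vector_field M Z \<longrightarrow>
        (\<forall>p\<in>points M. dir_deriv M p (X p) (\<lambda>q. g q (Y q) (Z q)) =
                        g p (nabla X Y p) (Z p) + g p (Y p) (nabla X Z p)))"


section \<open>Generalized Quasi-Sasakian manifolds\<close>

definition almost_contact_metric ::
  "('m, 'e::euclidean_space) mfd \<Rightarrow> ('m \<Rightarrow> 'e \<Rightarrow> 'e) \<Rightarrow> ('m \<Rightarrow> 'e) \<Rightarrow> ('m \<Rightarrow> 'e \<Rightarrow> real) \<Rightarrow>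
   ('m \<Rightarrow> 'e \<Rightarrow> 'e \<Rightarrow> real) \<Rightarrow> bool" where
  "almost_contact_metric M \<phi> \<xi> \<eta> g \<longleftrightarrow>
     smooth_manifold M \<and> (\<exists>n. DIM('e) = 2 * n + 1) \<and>
     tensor_field_11 M \<phi> \<and> vector_field M \<xi> \<and> one_form M \<eta> \<and> riemannian_metric M g \<and>
     (\<forall>p\<in>points M.
        (\<forall>u. \<phi> p (\<phi> p u) = - u + \<eta> p u *\<^sub>R \<xi> p) \<and>
        \<eta> p (\<xi> p) = 1 \<and>
        (\<forall>u. \<eta> p (\<phi> p u) = 0) \<and>
        \<phi> p (\<xi> p) = 0 \<and>
        (\<forall>u. \<eta> p u = g p u (\<xi> p)) \<and>
        (\<forall>u v. g p (\<phi> p u) v + g p u (\<phi> p v) = 0))"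

definition generalized_quasi_sasakian ::
  "('m, 'e::euclidean_space) mfd \<Rightarrow> ('m \<Rightarrow> 'e \<Rightarrow> 'e) \<Rightarrow> ('m \<Rightarrow> 'e) \<Rightarrow> ('m \<Rightarrow> 'e \<Rightarrow> real) \<Rightarrow>
   ('m \<Rightarrow> 'e \<Rightarrow> 'e \<Rightarrow> real) \<Rightarrow> (('m \<Rightarrow> 'e) \<Rightarrow> ('m \<Rightarrow> 'e) \<Rightarrow> 'm \<Rightarrow> 'e) \<Rightarrow> bool" where
  "generalized_quasi_sasakian M \<phi> \<xi> \<eta> g nabla \<longleftrightarrow>
     almost_contact_metric M \<phi> \<xi> \<eta> g \<and> levi_civita M g nabla \<and>
     (\<forall>X Y. vector_field M X \<and> vector_field M Y \<longrightarrow>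
        (\<forall>p\<in>points M.
           nabla X (\<lambda>q. \<phi> q (Y q)) p - \<phi> p (nabla X Y p) =
             g p (nabla (\<lambda>q. \<phi> q (X q)) \<xi> p) (Y p) *\<^sub>R \<xi> p
           - \<eta> p (Y p) *\<^sub>R nabla (\<lambda>q. \<phi> q (X q)) \<xi> p))"


section \<open>Isometric immersions\<close>

definition smooth_map ::
  "('m, 'd::euclidean_space) mfd \<Rightarrow> ('n, 'e::euclidean_space) mfd \<Rightarrow> ('m \<Rightarrow> 'n) \<Rightarrow> bool" where
  "smooth_map M N f \<longleftrightarrow>
     continuous_map (mtop M) (mtop N) f \<and>
     (\<forall>c\<in>atlas M. \<forall>d\<in>atlas N.
        smooth_on (cmap c ` (cdom c \<inter> f -` cdom d)) (cmap d \<circ> f \<circ> cinv c))"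

definition mdiff ::
  "('m, 'd::euclidean_space) mfd \<Rightarrow> ('n, 'e::euclidean_space) mfd \<Rightarrow> ('m \<Rightarrow> 'n) \<Rightarrow>
   'm \<Rightarrow> 'd \<Rightarrow> 'e" where
  "mdiff M N f p v =
     frechet_derivative (cmap (chart_at N (f p)) \<circ> f \<circ> cinv (chart_at M p))
       (at (cmap (chart_at M p) p)) v"

definition isometric_immersion ::
  "('m, 'd::euclidean_space) mfd \<Rightarrow> ('m \<Rightarrow> 'd \<Rightarrow> 'd \<Rightarrow> real) \<Rightarrow>
   ('n, 'e::euclidean_space) mfd \<Rightarrow> ('n \<Rightarrow> 'e \<Rightarrow> 'e \<Rightarrow> real) \<Rightarrow> ('m \<Rightarrow> 'n) \<Rightarrow> bool" where
  "isometric_immersion M g N h f \<longleftrightarrow>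
     smooth_map M N f \<and>
     (\<forall>p\<in>points M. inj (mdiff M N f p) \<and>
        (\<forall>u v. h (f p) (mdiff M N f p u) (mdiff M N f p v) = g p u v))"

(* The fibre at p of the normal bundle of the immersion f. *)
definition normal_space ::
  "('m, 'd::euclidean_space) mfd \<Rightarrow> ('n, 'e::euclidean_space) mfd \<Rightarrow>
   ('n \<Rightarrow> 'e \<Rightarrow> 'e \<Rightarrow> real) \<Rightarrow> ('m \<Rightarrow> 'n) \<Rightarrow> 'm \<Rightarrow> 'e set" where
  "normal_space M N h f p = {w. \<forall>v. h (f p) w (mdiff M N f p v) = 0}"


section \<open>Distributions and integrability\<close>

(* Smooth distributions of constant rank k, given locally by smooth frames. *)
definition smooth_distribution ::
  "('m, 'd::euclidean_space) mfd \<Rightarrow> ('m \<Rightarrow> 'd set) \<Rightarrow> bool" where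
  "smooth_distribution M D \<longleftrightarrow>
     (\<exists>k. \<forall>p\<in>points M. \<exists>U X. openin (mtop M) U \<and> p \<in> U \<and>
        (\<forall>i<k. smooth_vector_field_on M U (X i)) \<and>
        (\<forall>q\<in>U. D q = span ((\<lambda>i. X i q) ` {..<k}) \<and> dim (D q) = k))"

(* c is a slice chart at q for the subset S: in the coordinates of c, S is an open piece of the
   affine subspace through q with direction E. *)
definition slice_chart ::
  "('m, 'd::euclidean_space) mfd \<Rightarrow> 'm set \<Rightarrow> 'm \<Rightarrow> ('m, 'd) chart \<Rightarrow> 'd set \<Rightarrow> bool" where
  "slice_chart M S q c E \<longleftrightarrow>
     admissible_chart M c \<and> q \<in> cdom c \<and> subspace E \<and>
     S \<inter> cdom c = {r \<in> cdom c. cmap c r - cmap c q \<in> E}"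

(* An embedded submanifold S of M whose tangent space at each of its points q is D q; the tangent
   space of S at q consists of the vectors whose coordinates in a slice chart lie in E. *)
definition integral_manifold ::
  "('m, 'd::euclidean_space) mfd \<Rightarrow> ('m \<Rightarrow> 'd set) \<Rightarrow> 'm set \<Rightarrow> bool" where
  "integral_manifold M D S \<longleftrightarrow>
     S \<subseteq> points M \<and>
     (\<forall>q\<in>S. \<exists>c E. slice_chart M S q c E \<and> D q = {v. tcoord M c q v \<in> E})"

definition integrable_distribution ::
  "('m, 'd::euclidean_space) mfd \<Rightarrow> ('m \<Rightarrow> 'd set) \<Rightarrow> bool" where
  "integrable_distribution M D \<longleftrightarrow> (\<forall>p\<in>points M. \<exists>S. p \<in> S \<and> integral_manifold M D S)"


section \<open>Semi-invariant submanifolds\<close>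

definition semi_invariant_xi_perp_submanifold ::
  "('m, 'd::euclidean_space) mfd \<Rightarrow> ('m \<Rightarrow> 'd \<Rightarrow> 'd \<Rightarrow> real) \<Rightarrow> ('m \<Rightarrow> 'n) \<Rightarrow>
   ('m \<Rightarrow> 'd set) \<Rightarrow> ('m \<Rightarrow> 'd set) \<Rightarrow>
   ('n, 'e::euclidean_space) mfd \<Rightarrow> ('n \<Rightarrow> 'e \<Rightarrow> 'e) \<Rightarrow> ('n \<Rightarrow> 'e) \<Rightarrow>
   ('n \<Rightarrow> 'e \<Rightarrow> 'e \<Rightarrow> real) \<Rightarrow> bool" where
  "semi_invariant_xi_perp_submanifold M g f D D' N \<phi> \<xi> h \<longleftrightarrow>
     smooth_manifold M \<and> riemannian_metric M g \<and> isometric_immersion M g N h f \<and>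
     (\<forall>p\<in>points M. \<xi> (f p) \<in> normal_space M N h f p) \<and>
     smooth_distribution M D \<and> smooth_distribution M D' \<and>
     (\<forall>p\<in>points M.
        (\<forall>u\<in>D p. \<forall>v\<in>D' p. g p u v = 0) \<and>
        (\<forall>w. \<exists>u\<in>D p. \<exists>v\<in>D' p. w = u + v) \<and>
        \<phi> (f p) ` mdiff M N f p ` D p = mdiff M N f p ` D p \<and>
        \<phi> (f p) ` mdiff M N f p ` D' p \<subseteq> normal_space M N h f p)"

end

theory Submission
  imports Defs
begin

text \<open>The proof pulls the two-form $\Omega(u, v) = h(u, \phi v)$ back along the immersion $f$.
  Because $\phi D^{\bot}$ is normal and $\phi D = D$, the distribution $D^{\bot}$ is exactly the
  kernel of $f^*\Omega$. On vectors orthogonal to $\xi$ the G.Q.S. condition forces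
  $d\Omega = 0$, so $f^*\Omega$ is closed, and the kernel of a closed form of constant rank is
  involutive.

  Integral manifolds come from a direct proof of the Frobenius theorem. Near a point $x_0$ with
  kernel $E$, the kernel at $x$ is spanned by the fields $B(x)v$, $v \in E$, normalised by
  $PB(x)v = Pv$ with $P$ the projection onto $E$; closedness makes them commute. The leaf through
  $x_0$ is parametrised by $\sigma(a) = x_0 + \int_0^1 B(\sigma(ta))a\,dt$, obtained from the Banach
  fixed point theorem. Commutativity gives $D\sigma(a)v = B(\sigma(a))v$, whence $\sigma$ is smooth by
  bootstrapping, and subtracting $\sigma$ straightens the leaf.\<close>

section \<open>Calculus of smooth maps\<close>

text \<open>A form is used instead of vector fields because \<open>nabla\<close> acts only on global
  fields of \<open>N\<close>, while fields tangent to \<open>M\<close> live along \<open>f\<close>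
  and would first have to be extended. The form is differentiated at one point of \<open>N\<close>
  at a time, on fields that are constant in a chart and cut off by a bump function, and the result
  is pulled back; neither an induced connection nor a second fundamental form occurs. That \<xi> is
  normal is what makes this enough: tangent vectors of \<open>M\<close> lie in the kernel of \<eta>,
  the only directions in which the cyclic derivative is computed.

  The normalisation of B by P turns involutivity into commutativity: brackets of the fields stay in
  the kernel and have zero P-part, and near x_0 a kernel vector is determined by its P-part. The
  formula for \<sigma> integrates the ray equation y' = B(y)a, y(0) = x_0, for y(t) = \<sigma>(ta).
  Linearity of B(x) rescales every ray to one integral over [0,1], so a single fixed point treats
  all rays at once and is continuous in a.\<close>

abbreviation fd :: "('a::real_normed_vector \<Rightarrow> 'b::real_normed_vector) \<Rightarrow> 'a \<Rightarrow> 'a \<Rightarrow> 'b" where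
  "fd f x \<equiv> frechet_derivative f (at x)"

lemma fd_eq: "(f has_derivative f') (at x) \<Longrightarrow> fd f x = f'"
  by (rule frechet_derivative_at[symmetric])

lemma fd_works: "f differentiable (at x) \<Longrightarrow> (f has_derivative fd f x) (at x)"
  by (simp add: frechet_derivative_works)

lemma fd_linear: "f differentiable (at x) \<Longrightarrow> linear (fd f x)"
  by (rule linear_frechet_derivative)

text \<open>No differentiability is assumed: \<open>frechet_derivative\<close> picks a map
  satisfying the derivative predicate, and the predicates of \<open>f\<close> and \<open>g\<close>
  coincide.\<close>

lemma fd_cong:
  assumes "open S" "x \<in> S" "\<And>y. y \<in> S \<Longrightarrow> f y = g y"
  shows "fd f x = fd g x"
proof -
  have "(f has_derivative D) (at x) \<longleftrightarrow> (g has_derivative D) (at x)" for D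
    using assms has_derivative_transform_within_open[of f D x UNIV S g]
      has_derivative_transform_within_open[of g D x UNIV S f] by auto
  then show ?thesis by (simp add: frechet_derivative_def)
qed

lemma differentiable_cong:
  assumes "open S" "x \<in> S" "\<And>y. y \<in> S \<Longrightarrow> f y = g y" "f differentiable (at x)"
  shows "g differentiable (at x)"
  using assms has_derivative_transform_within_open unfolding differentiable_def by metis

text \<open>The tool for families of operators: smoothness of \<open>\<lambda>x. B x v\<close> for
  fixed \<open>v\<close> becomes usable for an argument that moves with \<open>x\<close>, since only
  the values on basis vectors enter.\<close>

lemma linear_expand:
  fixes L :: "'a::euclidean_space \<Rightarrow> 'b::real_vector"
  assumes "linear L"
  shows "L v = (\<Sum>b\<in>Basis. (v \<bullet> b) *\<^sub>R L b)"
proof -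
  have "L v = L (\<Sum>b\<in>Basis. (v \<bullet> b) *\<^sub>R b)" by (simp add: euclidean_representation)
  also have "\<dots> = (\<Sum>b\<in>Basis. (v \<bullet> b) *\<^sub>R L b)"
    by (simp add: linear_sum[OF assms] linear_scale[OF assms])
  finally show ?thesis .
qed

lemma fd_compose:
  assumes "f differentiable (at x)" "g differentiable (at (f x))"
  shows "fd (\<lambda>x. g (f x)) x v = fd g (f x) (fd f x v)"
proof -
  have "((\<lambda>x. g (f x)) has_derivative (\<lambda>v. fd g (f x) (fd f x v))) (at x)"
    using has_derivative_compose[OF fd_works[OF assms(1)] fd_works[OF assms(2)]] .
  then show ?thesis by (simp add: fd_eq)
qed

section \<open>Closure properties of maps of class C^k\<close>

lemma C_k_on_subset: "C_k_on k f S \<Longrightarrow> T \<subseteq> S \<Longrightarrow> C_k_on k f T"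
  by (induction k arbitrary: f) (auto intro: continuous_on_subset)

lemma C_k_on_cong:
  "open S \<Longrightarrow> (\<And>x. x \<in> S \<Longrightarrow> f x = g x) \<Longrightarrow> C_k_on k f S \<Longrightarrow> C_k_on k g S"
proof (induction k arbitrary: f g)
  case 0 then show ?case using continuous_on_cong by fastforce
next
  case (Suc k)
  have "C_k_on k (\<lambda>x. fd g x v) S" for v
    by (rule Suc.IH[of "\<lambda>x. fd f x v"])
      (use Suc.prems fd_cong[OF Suc.prems(1), of _ f g] in auto)
  moreover have "g differentiable (at x)" if "x \<in> S" for x
    using Suc.prems differentiable_cong[of S x f g] that by auto
  ultimately show ?case by auto
qed

lemma C_k_on_Suc_imp: "C_k_on (Suc k) f S \<Longrightarrow> C_k_on k f S"
proof (induction k arbitrary: f)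
  case 0 then show ?case
    by (auto intro!: continuous_at_imp_continuous_on differentiable_imp_continuous_within)
next
  case (Suc k)
  then have "C_k_on (Suc k) (\<lambda>x. fd f x v) S" for v
    using C_k_on.simps(2) by blast
  then have "C_k_on k (\<lambda>x. fd f x v) S" for v using Suc.IH by blast
  then show ?case using Suc.prems by simp
qed

lemma C_k_on_local:
  "(\<And>x. x \<in> S \<Longrightarrow> \<exists>T. open T \<and> x \<in> T \<and> C_k_on k f T) \<Longrightarrow> C_k_on k f S"
proof (induction k arbitrary: f)
  case 0
  then show ?case
    by (auto intro!: continuous_at_imp_continuous_on)
      (metis at_within_open continuous_on_eq_continuous_within)
next
  case (Suc k)
  have "C_k_on k (\<lambda>x. fd f x v) S" for v
    by (rule Suc.IH) (use Suc.prems in fastforce)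
  then show ?case using Suc.prems by fastforce
qed

lemma C_k_on_const: "C_k_on k (\<lambda>x. c) S"
  by (induction k arbitrary: c) auto

lemma C_k_on_linear:
  assumes "bounded_linear f" shows "C_k_on k f S"
proof (cases k)
  case 0 then show ?thesis using assms by (simp add: linear_continuous_on)
next
  case (Suc j)
  have "fd f x = f" for x by (rule fd_eq) (rule bounded_linear_imp_has_derivative[OF assms])
  then show ?thesis
    using Suc bounded_linear_imp_differentiable[OF assms] by (auto simp: C_k_on_const)
qed

lemma C_k_on_add:
  "open S \<Longrightarrow> C_k_on k f S \<Longrightarrow> C_k_on k g S \<Longrightarrow> C_k_on k (\<lambda>x. f x + g x) S"
proof (induction k arbitrary: f g)
  case 0 then show ?case by (auto intro: continuous_intros)
next
  case (Suc k)
  have eq: "fd f x v + fd g x v = fd (\<lambda>x. f x + g x) x v" if "x \<in> S" for x v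
    using Suc.prems that by (subst fd_eq[OF has_derivative_add]) (auto intro: fd_works)
  have "C_k_on k (\<lambda>x. fd (\<lambda>x. f x + g x) x v) S" for v
    by (rule C_k_on_cong[OF \<open>open S\<close> eq]) (use Suc in auto)
  then show ?case using Suc.prems by auto
qed

text \<open>The derivative is a sum of two products of the same shape with one factor
  differentiated, so the induction has to range over all \<open>f\<close> and
  \<open>g\<close>.\<close>

lemma C_k_on_bilinear:
  assumes h: "bounded_bilinear h"
  shows "open S \<Longrightarrow> C_k_on k f S \<Longrightarrow> C_k_on k g S \<Longrightarrow> C_k_on k (\<lambda>x. h (f x) (g x)) S"
proof (induction k arbitrary: f g)
  case 0 then show ?case by (auto intro: bounded_bilinear.continuous_on[OF h])
next
  case (Suc k)
  have d: "((\<lambda>x. h (f x) (g x)) has_derivative (\<lambda>v. h (f x) (fd g x v) + h (fd f x v) (g x))) (at x)"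
    if "x \<in> S" for x
    using Suc.prems that by (intro bounded_bilinear.FDERIV[OF h] fd_works) auto
  have eq: "h (f x) (fd g x v) + h (fd f x v) (g x) = fd (\<lambda>x. h (f x) (g x)) x v" if "x \<in> S" for x v
    using fd_eq[OF d[OF that]] by simp
  have "C_k_on k (\<lambda>x. fd (\<lambda>x. h (f x) (g x)) x v) S" for v
  proof (rule C_k_on_cong[OF \<open>open S\<close> eq])
    have "C_k_on k f S" "C_k_on k g S" using Suc.prems C_k_on_Suc_imp by blast+
    then show "C_k_on k (\<lambda>x. h (f x) (fd g x v) + h (fd f x v) (g x)) S"
      using Suc by (auto intro!: C_k_on_add)
  qed
  then show ?case using d by (auto simp: differentiable_def)
qed

lemma C_k_on_sum:
  "open S \<Longrightarrow> (\<And>i. i \<in> I \<Longrightarrow> C_k_on k (f i) S) \<Longrightarrow> C_k_on k (\<lambda>x. \<Sum>i\<in>I. f i x) S"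
  by (induction I rule: infinite_finite_induct) (auto intro!: C_k_on_add C_k_on_const)

lemmas C_k_on_scaleR = C_k_on_bilinear[OF bounded_bilinear_scaleR]
lemmas C_k_on_inner = C_k_on_bilinear[OF bounded_bilinear_inner]
lemmas C_k_on_mult = C_k_on_bilinear[OF bounded_bilinear_mult]

lemma C_k_on_compose:
  fixes f :: "'a::euclidean_space \<Rightarrow> 'b::euclidean_space"
  shows "open S \<Longrightarrow> C_k_on k f S \<Longrightarrow> C_k_on k g T \<Longrightarrow> f ` S \<subseteq> T \<Longrightarrow> C_k_on k (\<lambda>x. g (f x)) S"
proof (induction k arbitrary: g)
  case 0 then show ?case by (auto intro: continuous_on_compose2)
next
  case (Suc k)
  have d: "f differentiable (at x)" "g differentiable (at (f x))" if "x \<in> S" for x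
    using Suc.prems that by auto
  \<comment> \<open>In the form \<open>fd g (f x) (fd f x v)\<close> the chain rule is no
    composition to which the induction hypothesis applies. Expanded in a basis, its factors are
    \<open>\<lambda>x. fd g (f x) b\<close> with \<open>b\<close> fixed, and those are.\<close>
  have eq: "(\<Sum>b\<in>Basis. (fd f x v \<bullet> b) *\<^sub>R fd g (f x) b) = fd (\<lambda>x. g (f x)) x v" if "x \<in> S" for x v
    using fd_compose[OF d[OF that]] linear_expand[OF fd_linear[OF d(2)[OF that]]] by metis
  have "C_k_on k (\<lambda>x. fd (\<lambda>x. g (f x)) x v) S" for v
  proof (rule C_k_on_cong[OF \<open>open S\<close> eq])
    have "C_k_on k (\<lambda>x. fd g (f x) b) S" for b
    proof (rule Suc.IH)
      show "C_k_on k f S" using Suc.prems(2) by (rule C_k_on_Suc_imp)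
    qed (use Suc.prems(1,3,4) in simp_all)
    moreover have "C_k_on k (\<lambda>x. fd f x v) S" using Suc.prems(2) by simp
    ultimately show "C_k_on k (\<lambda>x. \<Sum>b\<in>Basis. (fd f x v \<bullet> b) *\<^sub>R fd g (f x) b) S"
      using Suc.prems(1) by (intro C_k_on_sum C_k_on_scaleR C_k_on_inner C_k_on_const) auto
  qed
  then show ?case using d
    by (auto intro: differentiable_compose)
qed

section \<open>The same closure properties for smooth maps\<close>

lemma smooth_on_subset: "smooth_on S f \<Longrightarrow> T \<subseteq> S \<Longrightarrow> smooth_on T f"
  by (auto simp: smooth_on_def intro: C_k_on_subset)

lemma smooth_on_cong:
  "open S \<Longrightarrow> (\<And>x. x \<in> S \<Longrightarrow> f x = g x) \<Longrightarrow> smooth_on S f \<Longrightarrow> smooth_on S g"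
  unfolding smooth_on_def using C_k_on_cong by blast

lemma smooth_on_local:
  "(\<And>x. x \<in> S \<Longrightarrow> \<exists>T. open T \<and> x \<in> T \<and> smooth_on T f) \<Longrightarrow> smooth_on S f"
  unfolding smooth_on_def by (intro allI C_k_on_local) metis

lemma smooth_on_const: "smooth_on S (\<lambda>x. c)"
  by (auto simp: smooth_on_def intro: C_k_on_const)

lemma smooth_on_linear: "bounded_linear f \<Longrightarrow> smooth_on S f"
  by (auto simp: smooth_on_def intro: C_k_on_linear)

lemma smooth_on_add: "open S \<Longrightarrow> smooth_on S f \<Longrightarrow> smooth_on S g \<Longrightarrow> smooth_on S (\<lambda>x. f x + g x)"
  by (auto simp: smooth_on_def intro: C_k_on_add)

lemma smooth_on_sum:
  "open S \<Longrightarrow> (\<And>i. i \<in> I \<Longrightarrow> smooth_on S (f i)) \<Longrightarrow> smooth_on S (\<lambda>x. \<Sum>i\<in>I. f i x)"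
  by (auto simp: smooth_on_def intro: C_k_on_sum)

lemma smooth_on_scaleR:
  "open S \<Longrightarrow> smooth_on S f \<Longrightarrow> smooth_on S g \<Longrightarrow> smooth_on S (\<lambda>x. f x *\<^sub>R g x)"
  by (auto simp: smooth_on_def intro: C_k_on_scaleR)

lemma smooth_on_inner:
  "open S \<Longrightarrow> smooth_on S f \<Longrightarrow> smooth_on S g \<Longrightarrow> smooth_on S (\<lambda>x. f x \<bullet> g x)"
  by (auto simp: smooth_on_def intro: C_k_on_inner)

lemma smooth_on_mult:
  fixes f g :: "'a::euclidean_space \<Rightarrow> real"
  shows "open S \<Longrightarrow> smooth_on S f \<Longrightarrow> smooth_on S g \<Longrightarrow> smooth_on S (\<lambda>x. f x * g x)"
  by (auto simp: smooth_on_def intro: C_k_on_mult)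

lemma smooth_on_compose:
  fixes f :: "'a::euclidean_space \<Rightarrow> 'b::euclidean_space"
  shows "open S \<Longrightarrow> smooth_on S f \<Longrightarrow> smooth_on T g \<Longrightarrow> f ` S \<subseteq> T \<Longrightarrow> smooth_on S (\<lambda>x. g (f x))"
  unfolding smooth_on_def using C_k_on_compose by blast

lemma smooth_on_linear_compose:
  "open S \<Longrightarrow> smooth_on S f \<Longrightarrow> bounded_linear L \<Longrightarrow> smooth_on S (\<lambda>x. L (f x))"
  for f :: "'a::euclidean_space \<Rightarrow> 'b::euclidean_space"
  using smooth_on_compose[of S f UNIV L] smooth_on_linear by blast

lemma smooth_on_minus:
  fixes f g :: "'a::euclidean_space \<Rightarrow> 'b::euclidean_space"
  shows "open S \<Longrightarrow> smooth_on S f \<Longrightarrow> smooth_on S g \<Longrightarrow> smooth_on S (\<lambda>x. f x - g x)"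
  using smooth_on_add[of S f "\<lambda>x. - g x"]
    smooth_on_linear_compose[OF _ _ bounded_linear_minus[OF bounded_linear_ident], of S g] by simp

lemma smooth_on_differentiable: "smooth_on S f \<Longrightarrow> x \<in> S \<Longrightarrow> f differentiable (at x)"
  unfolding smooth_on_def using C_k_on.simps(2) by blast

lemma smooth_on_works: "smooth_on S f \<Longrightarrow> x \<in> S \<Longrightarrow> (f has_derivative fd f x) (at x)"
  by (intro fd_works smooth_on_differentiable)

lemma smooth_on_fd: "smooth_on S f \<Longrightarrow> smooth_on S (\<lambda>x. fd f x v)"
  unfolding smooth_on_def using C_k_on.simps(2) by blast

lemma smooth_on_continuous: "smooth_on S f \<Longrightarrow> continuous_on S f"
  unfolding smooth_on_def using C_k_on.simps(1) by blast

text \<open>Both mixed partials equal the limit of the second difference quotient, and the latter is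
  symmetric.\<close>

lemma second_difference_bound:
  fixes f :: "'a::euclidean_space \<Rightarrow> 'b::real_normed_vector"
  assumes S: "open S" "x \<in> S" and f: "\<And>y. y \<in> S \<Longrightarrow> f differentiable (at y)"
    and fa: "(\<lambda>y. fd f y a) differentiable (at x)" and e: "e > 0"
  shows "\<forall>\<^sub>F t in at_right 0. norm (f (x + t *\<^sub>R a + t *\<^sub>R b) - f (x + t *\<^sub>R a) - f (x + t *\<^sub>R b) + f x
       - t\<^sup>2 *\<^sub>R fd (\<lambda>y. fd f y a) x b) \<le> e * t\<^sup>2"
proof -
  define G where "G = fd (\<lambda>y. fd f y a) x"
  \<comment> \<open>\<open>t * C\<close> bounds the two displacements from \<open>x\<close>
    together, see \<open>n1\<close>; the summand 1 keeps \<open>C\<close> positive.\<close>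
  define C where "C = 2 * norm a + norm b + 1"
  have C: "C > 0" by (simp add: C_def add_nonneg_pos)
  define e' where "e' = e / C"
  have e': "e' > 0" using e C by (simp add: e'_def)
  have "((\<lambda>y. fd f y a) has_derivative G) (at x)" using fd_works[OF fa] by (simp add: G_def)
  then obtain d0 where d0: "d0 > 0"
    "\<And>y. norm (y - x) < d0 \<Longrightarrow> norm (fd f y a - fd f x a - G (y - x)) \<le> e' * norm (y - x)"
    using e' unfolding has_derivative_at_alt by blast
  have G: "linear G" using fa fd_linear G_def by blast
  obtain r where r: "r > 0" "ball x r \<subseteq> S" using S open_contains_ball by blast
  define d where "d = min d0 r / C"
  have d: "d > 0" using d0 r C by (simp add: d_def)
  have "norm (f (x + t *\<^sub>R a + t *\<^sub>R b) - f (x + t *\<^sub>R a) - f (x + t *\<^sub>R b) + f x - t\<^sup>2 *\<^sub>R G b) \<le> e * t\<^sup>2"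
    if t: "0 < t" "t < d" for t
  proof -
    \<comment> \<open>\<open>p t - p 0\<close> is the second difference minus
      \<open>t^2 *\<^sub>R G b\<close>. Its derivative in \<open>s\<close> is a difference of first
      derivatives of \<open>f\<close> minus its linear approximation, so one mean value estimate in
      \<open>s\<close> suffices.\<close>
    define p where "p = (\<lambda>s. f (x + s *\<^sub>R a + t *\<^sub>R b) - f (x + s *\<^sub>R a) - (s * t) *\<^sub>R G b)"
    have tC: "t * C < d0" "t * C < r" using t C by (auto simp: d_def field_simps)
    have n1: "norm (s *\<^sub>R a + t *\<^sub>R b) + norm (s *\<^sub>R a) \<le> t * C" if "0 \<le> s" "s \<le> t" for s
    proof -
      have "norm (s *\<^sub>R a + t *\<^sub>R b) \<le> s * norm a + t * norm b"
        using norm_triangle_ineq[of "s *\<^sub>R a" "t *\<^sub>R b"] that t by simp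
      moreover have "s * norm a \<le> t * norm a" using that by (simp add: mult_right_mono)
      ultimately show ?thesis using that t by (simp add: C_def algebra_simps)
    qed
    have inS: "x + s *\<^sub>R a + t *\<^sub>R b \<in> S" "x + s *\<^sub>R a \<in> S" if "0 \<le> s" "s \<le> t" for s
    proof -
      have "norm (s *\<^sub>R a + t *\<^sub>R b) < r" "norm (s *\<^sub>R a) < r"
        using n1[OF that] tC norm_ge_zero[of "s *\<^sub>R a + t *\<^sub>R b"] norm_ge_zero[of "s *\<^sub>R a"] by linarith+
      then have "x + (s *\<^sub>R a + t *\<^sub>R b) \<in> ball x r" "x + s *\<^sub>R a \<in> ball x r"
        by (simp_all only: mem_ball dist_norm norm_minus_commute[of x] add_diff_cancel_left')
      then show "x + s *\<^sub>R a + t *\<^sub>R b \<in> S" "x + s *\<^sub>R a \<in> S"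
        using r(2) by (auto simp: add.assoc)
    qed
    have der: "(p has_derivative (\<lambda>u. u *\<^sub>R (fd f (x + s *\<^sub>R a + t *\<^sub>R b) a - fd f (x + s *\<^sub>R a) a - t *\<^sub>R G b)))
        (at s within {0..t})" if s: "s \<in> {0..t}" for s
    proof -
      have 1: "((\<lambda>s. f (x + s *\<^sub>R a + t *\<^sub>R b)) has_derivative (\<lambda>u. fd f (x + s *\<^sub>R a + t *\<^sub>R b) (u *\<^sub>R a))) (at s)"
        by (rule has_derivative_compose[where g = f, OF _ fd_works[OF f]])
          (use inS s in \<open>auto intro!: derivative_eq_intros\<close>)
      have 2: "((\<lambda>s. f (x + s *\<^sub>R a)) has_derivative (\<lambda>u. fd f (x + s *\<^sub>R a) (u *\<^sub>R a))) (at s)"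
        by (rule has_derivative_compose[where g = f, OF _ fd_works[OF f]])
          (use inS s in \<open>auto intro!: derivative_eq_intros\<close>)
      have 3: "((\<lambda>s. (s * t) *\<^sub>R G b) has_derivative (\<lambda>u. (u * t) *\<^sub>R G b)) (at s)"
        by (auto intro!: derivative_eq_intros)
      show ?thesis unfolding p_def
        apply (rule has_derivative_at_withinI)
        apply (rule has_derivative_eq_rhs)
        apply (rule has_derivative_diff[OF has_derivative_diff[OF 1 2] 3])
        using s inS linear_scale[OF fd_linear[OF f]]
        by (auto simp: fun_eq_iff scaleR_diff_right)
    qed
    have on: "onorm (\<lambda>u. u *\<^sub>R (fd f (x + s *\<^sub>R a + t *\<^sub>R b) a - fd f (x + s *\<^sub>R a) a - t *\<^sub>R G b)) \<le> e * t"
      if s: "s \<in> {0..t}" for s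
    proof -
      let ?y = "x + s *\<^sub>R a + t *\<^sub>R b" and ?z = "x + s *\<^sub>R a"
      have "norm (s *\<^sub>R a + t *\<^sub>R b) < d0" "norm (s *\<^sub>R a) < d0"
        using n1[of s] s tC norm_ge_zero[of "s *\<^sub>R a + t *\<^sub>R b"] norm_ge_zero[of "s *\<^sub>R a"]
        unfolding atLeastAtMost_iff by linarith+
      then have "norm (?y - x) < d0" "norm (?z - x) < d0" by (simp_all add: algebra_simps)
      then have b1: "norm (fd f ?y a - fd f x a - G (?y - x)) \<le> e' * norm (?y - x)"
        "norm (fd f ?z a - fd f x a - G (?z - x)) \<le> e' * norm (?z - x)" using d0(2) by blast+
      have "G (?y - x) - G (?z - x) = t *\<^sub>R G b"
        by (simp add: linear_diff[OF G, symmetric] linear_scale[OF G, symmetric])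
      then have eq: "fd f ?y a - fd f ?z a - t *\<^sub>R G b
         = (fd f ?y a - fd f x a - G (?y - x)) - (fd f ?z a - fd f x a - G (?z - x))"
        by (simp add: algebra_simps)
      have "norm (fd f ?y a - fd f ?z a - t *\<^sub>R G b) \<le> e' * norm (?y - x) + e' * norm (?z - x)"
        unfolding eq using norm_triangle_ineq4 b1 add_mono order_trans by blast
      also have "\<dots> = e' * (norm (s *\<^sub>R a + t *\<^sub>R b) + norm (s *\<^sub>R a))" by (simp add: algebra_simps)
      also have "\<dots> \<le> e' * (t * C)" using n1[of s] s e' by (intro mult_left_mono) auto
      also have "\<dots> = e * t" using C by (simp add: e'_def)
      finally have *: "norm (fd f ?y a - fd f ?z a - t *\<^sub>R G b) \<le> e * t" .
      show ?thesis
        by (rule onorm_le) (use * in \<open>simp add: mult.commute mult_left_mono\<close>)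
    qed
    have "norm (p t - p 0) \<le> e * t * norm (t - 0)"
      by (rule differentiable_bound[OF _ der on]) (use t in auto)
    then show ?thesis using t by (simp add: p_def power2_eq_square algebra_simps)
  qed
  then show ?thesis unfolding G_def
    by (auto simp: eventually_at_right_field intro!: exI[of _ d] d)
qed

lemma fd_fd_commute:
  fixes f :: "'a::euclidean_space \<Rightarrow> 'b::real_normed_vector"
  assumes S: "open S" "x \<in> S" and f: "smooth_on S f"
  shows "fd (\<lambda>y. fd f y a) x b = fd (\<lambda>y. fd f y b) x a" (is "?l = ?r")
proof (rule ccontr)
  assume ne: "?l \<noteq> ?r"
  \<comment> \<open>Two approximations with error \<open>e * t^2\<close> will give
    \<open>norm (?l - ?r) \<le> 2 * e\<close>, which is two thirds of that norm.\<close>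
  define e where "e = norm (?l - ?r) / 3"
  have e: "e > 0" using ne by (simp add: e_def)
  have d: "(\<lambda>y. fd f y v) differentiable (at x)" for v
    using smooth_on_differentiable[OF smooth_on_fd[OF f]] S by blast
  have q: "\<forall>\<^sub>F t in at_right 0. norm (f (x + t *\<^sub>R a + t *\<^sub>R b) - f (x + t *\<^sub>R a) - f (x + t *\<^sub>R b) + f x
       - t\<^sup>2 *\<^sub>R fd (\<lambda>y. fd f y a) x b) \<le> e * t\<^sup>2" for a b
    by (rule second_difference_bound[OF S smooth_on_differentiable[OF f] d e])
  have "\<forall>\<^sub>F t in at_right 0. t > (0::real) \<and> norm (t\<^sup>2 *\<^sub>R ?r - t\<^sup>2 *\<^sub>R ?l) \<le> 2 * e * t\<^sup>2"
    using q[of a b] q[of b a] eventually_at_right_less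
  proof eventually_elim
    case (elim t)
    let ?u = "f (x + t *\<^sub>R a + t *\<^sub>R b) - f (x + t *\<^sub>R a) - f (x + t *\<^sub>R b) + f x"
    have "f (x + t *\<^sub>R b + t *\<^sub>R a) - f (x + t *\<^sub>R b) - f (x + t *\<^sub>R a) + f x = ?u"
      by (simp add: algebra_simps)
    from order_trans[OF norm_triangle_ineq4 add_mono[OF elim(1) elim(2)[unfolded this]]]
    have "norm ((?u - t\<^sup>2 *\<^sub>R ?l) - (?u - t\<^sup>2 *\<^sub>R ?r)) \<le> e * t\<^sup>2 + e * t\<^sup>2" .
    then show ?case using elim(3) by simp
  qed
  then have "\<exists>t>0. norm (t\<^sup>2 *\<^sub>R ?r - t\<^sup>2 *\<^sub>R ?l) \<le> 2 * e * t\<^sup>2"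
    using eventually_happens'[OF trivial_limit_at_right_real] by blast
  then obtain t :: real where t: "t > 0" "norm (t\<^sup>2 *\<^sub>R (?r - ?l)) \<le> 2 * e * t\<^sup>2"
    by (auto simp: scaleR_diff_right)
  then have "t\<^sup>2 * norm (?r - ?l) \<le> t\<^sup>2 * (2 * e)" by (simp only: norm_scaleR abs_power2 mult_ac)
  then have "norm (?r - ?l) \<le> 2 * e" using t(1) by simp
  then show False using e by (simp add: e_def norm_minus_commute)
qed

section \<open>Total differential equations\<close>

lemma linear_norm_le:
  fixes L :: "'a::euclidean_space \<Rightarrow> 'b::real_normed_vector"
  assumes "linear L" "\<And>b. b \<in> Basis \<Longrightarrow> norm (L b) \<le> K b"
  shows "norm (L v) \<le> (\<Sum>b\<in>Basis. K b) * norm v"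
proof -
  have "norm (L v) \<le> (\<Sum>b\<in>Basis. norm ((v \<bullet> b) *\<^sub>R L b))"
    by (subst linear_expand[OF assms(1)]) (rule norm_sum)
  also have "\<dots> \<le> (\<Sum>b\<in>Basis. norm v * K b)"
    using assms(2) by (intro sum_mono) (auto intro!: mult_mono Basis_le_norm)
  finally show ?thesis by (simp add: sum_distrib_left mult.commute)
qed

lemma smooth_on_bounded:
  assumes "smooth_on S f" "compact C" "C \<subseteq> S"
  obtains K where "K \<ge> 0" "\<And>x. x \<in> C \<Longrightarrow> norm (f x) \<le> K"
proof -
  have "bounded (f ` C)"
    using assms by (intro compact_imp_bounded compact_continuous_image continuous_on_subset[OF smooth_on_continuous])
  then obtain K where "\<forall>x\<in>C. norm (f x) \<le> K" by (auto simp: bounded_iff)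
  then have "\<forall>x\<in>C. norm (f x) \<le> max K 0" by force
  then show ?thesis using that[of "max K 0"] by auto
qed

lemma smooth_on_lipschitz:
  fixes f :: "'a::euclidean_space \<Rightarrow> 'b::real_normed_vector"
  assumes "smooth_on S f" "compact C" "convex C" "C \<subseteq> S"
  obtains K where "K \<ge> 0" "\<And>x y. x \<in> C \<Longrightarrow> y \<in> C \<Longrightarrow> norm (f x - f y) \<le> K * norm (x - y)"
proof -
  have "\<exists>K\<ge>0. \<forall>x\<in>C. norm (fd f x b) \<le> K" for b
    using smooth_on_bounded[OF smooth_on_fd[OF assms(1)] assms(2,4)] by metis
  then obtain K where K: "\<And>b. K b \<ge> 0" "\<And>b x. x \<in> C \<Longrightarrow> norm (fd f x b) \<le> K b" by metis
  have *: "onorm (fd f x) \<le> sum K Basis" if "x \<in> C" for x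
  proof (rule onorm_le, rule linear_norm_le)
    show "linear (fd f x)"
      using that assms(4) by (intro fd_linear smooth_on_differentiable[OF assms(1)]) blast
  qed (rule K(2)[OF that])
  show ?thesis
    by (rule that[of "sum K Basis"], simp add: K sum_nonneg)
      (rule differentiable_bound[OF assms(3) _ *],
        use assms(4) in \<open>blast intro: has_derivative_at_withinI[OF smooth_on_works[OF assms(1)]]\<close>)
qed

text \<open>The derivative is Lipschitz on \<open>C\<close>, so along the segment from
  \<open>x\<close> to \<open>y\<close> it differs from its value at \<open>x\<close> by at most a
  multiple of \<open>norm (y - x)\<close>; the mean value inequality supplies the second
  factor.\<close>

lemma smooth_on_taylor2:
  fixes f :: "'a::euclidean_space \<Rightarrow> 'b::real_normed_vector"
  assumes "smooth_on S f" "compact C" "convex C" "C \<subseteq> S"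
  obtains K where "K \<ge> 0"
    "\<And>x y. x \<in> C \<Longrightarrow> y \<in> C \<Longrightarrow> norm (f y - f x - fd f x (y - x)) \<le> K * (norm (y - x))\<^sup>2"
proof -
  have "\<exists>K\<ge>0. \<forall>x\<in>C. \<forall>y\<in>C. norm (fd f x b - fd f y b) \<le> K * norm (x - y)" for b
    using smooth_on_lipschitz[OF smooth_on_fd[OF assms(1)] assms(2,3,4)] by metis
  then obtain K where K: "\<And>b. K b \<ge> 0"
    "\<And>b x y. x \<in> C \<Longrightarrow> y \<in> C \<Longrightarrow> norm (fd f x b - fd f y b) \<le> K b * norm (x - y)" by metis
  let ?K = "sum K Basis"
  have K0: "?K \<ge> 0" by (simp add: K sum_nonneg)
  have "norm (f y - f x - fd f x (y - x)) \<le> ?K * (norm (y - x))\<^sup>2" if xy: "x \<in> C" "y \<in> C" for x y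
  proof -
    have seg: "closed_segment x y \<subseteq> C" using xy assms(3) closed_segment_subset by blast
    have on: "onorm (fd f z - fd f x) \<le> ?K * norm (y - x)" if z: "z \<in> closed_segment x y" for z
    proof -
      have zC: "z \<in> C" using seg z by blast
      have l: "linear (fd f z - fd f x)"
        unfolding fun_diff_def using zC xy assms(4)
        by (intro linear_compose_sub fd_linear smooth_on_differentiable[OF assms(1)]) auto
      have "norm ((fd f z - fd f x) v) \<le> (\<Sum>b\<in>Basis. K b * norm (z - x)) * norm v" for v
        using K(2)[OF zC xy(1)] by (intro linear_norm_le[OF l]) simp
      then have "onorm (fd f z - fd f x) \<le> (\<Sum>b\<in>Basis. K b * norm (z - x))"
        by (rule onorm_le)
      also have "\<dots> = ?K * norm (z - x)" by (simp add: sum_distrib_right)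
      also have "\<dots> \<le> ?K * norm (y - x)"
        using segment_bound(1)[OF z] K0 by (intro mult_left_mono) (auto simp: norm_minus_commute)
      finally show ?thesis .
    qed
    have "norm (f y - f x - fd f x (y - x)) \<le> norm (y - x) * (?K * norm (y - x))"
    proof (rule differentiable_bound_linearization[where S = "closed_segment x y" and f' = "fd f"])
      show "x + t *\<^sub>R (y - x) \<in> closed_segment x y" if "t \<in> {0..1}" for t
        using that unfolding in_segment atLeastAtMost_iff
        by (intro exI[of _ t] conjI) (simp_all add: scaleR_diff_right scaleR_diff_left)
      show "(f has_derivative fd f z) (at z within closed_segment x y)" if "z \<in> closed_segment x y" for z
        using that seg assms(4) by (blast intro: has_derivative_at_withinI[OF smooth_on_works[OF assms(1)]])
    qed (use on in auto)
    then show ?thesis by (simp add: power2_eq_square mult_ac)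
  qed
  then show ?thesis using that K0 by blast
qed

lemma fd_linear_param:
  fixes B :: "'a::euclidean_space \<Rightarrow> 'b::euclidean_space \<Rightarrow> 'c::real_normed_vector"
  assumes S: "open S" "x \<in> S" and lin: "\<And>x. x \<in> S \<Longrightarrow> linear (B x)"
    and sm: "\<And>v. smooth_on S (\<lambda>x. B x v)"
  shows "fd (\<lambda>y. B y v) x u = (\<Sum>b\<in>Basis. (v \<bullet> b) *\<^sub>R fd (\<lambda>y. B y b) x u)"
proof -
  have "fd (\<lambda>y. B y v) x = fd (\<lambda>y. \<Sum>b\<in>Basis. (v \<bullet> b) *\<^sub>R B y b) x"
    by (rule fd_cong[OF S]) (rule linear_expand[OF lin])
  also have "\<dots> = (\<lambda>u. \<Sum>b\<in>Basis. (v \<bullet> b) *\<^sub>R fd (\<lambda>y. B y b) x u)"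
    by (rule fd_eq) (intro has_derivative_sum has_derivative_scaleR_right smooth_on_works[OF sm S(2)])
  finally show ?thesis by simp
qed

text \<open>Linearity in the parameter \<open>v\<close>, not in the direction \<open>u\<close>. It
  makes the Taylor remainder of an operator family linear in \<open>v\<close>, so that a bound on
  basis vectors suffices.\<close>

lemma fd_param_linear:
  fixes B :: "'a::euclidean_space \<Rightarrow> 'b::euclidean_space \<Rightarrow> 'c::real_normed_vector"
  assumes S: "open S" "x \<in> S" and lin: "\<And>x. x \<in> S \<Longrightarrow> linear (B x)"
    and sm: "\<And>v. smooth_on S (\<lambda>x. B x v)"
  shows "linear (\<lambda>v. fd (\<lambda>y. B y v) x u)"
proof -
  define F where "F = (\<lambda>b. fd (\<lambda>y. B y b) x u)"
  have "(\<lambda>v. fd (\<lambda>y. B y v) x u) = (\<lambda>v. \<Sum>b\<in>Basis. (v \<bullet> b) *\<^sub>R F b)"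
    unfolding F_def using fd_linear_param[OF assms] by (intro ext)
  then show ?thesis
    by (auto intro!: linearI simp: inner_add_left scaleR_add_left sum.distrib scaleR_sum_right)
qed

text \<open>The three estimates hold for each basis vector and extend to all \<open>v\<close> by
  linearity. A single constant serves as operator bound, Lipschitz constant and Taylor constant,
  which keeps the later smallness conditions on the radius short.\<close>

lemma operator_family_bounds:
  fixes B :: "'a::euclidean_space \<Rightarrow> 'b::euclidean_space \<Rightarrow> 'c::real_normed_vector"
  assumes S: "open S" and lin: "\<And>x. x \<in> S \<Longrightarrow> linear (B x)"
    and sm: "\<And>v. smooth_on S (\<lambda>x. B x v)"
    and C: "compact C" "convex C" "C \<subseteq> S"
  obtains K where "K > 0" "\<And>x v. x \<in> C \<Longrightarrow> norm (B x v) \<le> K * norm v"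
    "\<And>x y v. x \<in> C \<Longrightarrow> y \<in> C \<Longrightarrow> norm (B x v - B y v) \<le> K * norm (x - y) * norm v"
    "\<And>x y v. x \<in> C \<Longrightarrow> y \<in> C \<Longrightarrow>
      norm (B y v - B x v - fd (\<lambda>z. B z v) x (y - x)) \<le> K * (norm (y - x))\<^sup>2 * norm v"
proof -
  have "\<exists>K\<ge>0. \<forall>x\<in>C. norm (B x b) \<le> K" for b
    using smooth_on_bounded[OF sm C(1,3)] by metis
  then obtain K1 where K1: "\<And>b. K1 b \<ge> 0" "\<And>b x. x \<in> C \<Longrightarrow> norm (B x b) \<le> K1 b" by metis
  have "\<exists>K\<ge>0. \<forall>x\<in>C. \<forall>y\<in>C. norm (B x b - B y b) \<le> K * norm (x - y)" for b
    using smooth_on_lipschitz[OF sm C] by metis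
  then obtain K2 where K2: "\<And>b. K2 b \<ge> 0"
    "\<And>b x y. x \<in> C \<Longrightarrow> y \<in> C \<Longrightarrow> norm (B x b - B y b) \<le> K2 b * norm (x - y)" by metis
  have "\<exists>K\<ge>0. \<forall>x\<in>C. \<forall>y\<in>C.
      norm (B y b - B x b - fd (\<lambda>z. B z b) x (y - x)) \<le> K * (norm (y - x))\<^sup>2" for b
    using smooth_on_taylor2[OF sm C] by metis
  then obtain K3 where K3: "\<And>b. K3 b \<ge> 0" "\<And>b x y. x \<in> C \<Longrightarrow> y \<in> C \<Longrightarrow>
      norm (B y b - B x b - fd (\<lambda>z. B z b) x (y - x)) \<le> K3 b * (norm (y - x))\<^sup>2" by metis
  define k where "k = 1 + sum K1 Basis + sum K2 Basis + sum K3 Basis"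
  have nn: "sum K1 Basis \<ge> 0" "sum K2 Basis \<ge> 0" "sum K3 Basis \<ge> 0"
    by (simp_all add: sum_nonneg K1 K2 K3)
  show ?thesis
  proof (rule that[of k])
    show "k > 0" using nn by (simp add: k_def)
    show "norm (B x v) \<le> k * norm v" if "x \<in> C" for x v
    proof -
      have "norm (B x v) \<le> sum K1 Basis * norm v"
        using that C K1 by (intro linear_norm_le lin) auto
      also have "\<dots> \<le> k * norm v" using nn by (intro mult_right_mono) (auto simp: k_def)
      finally show ?thesis .
    qed
    show "norm (B x v - B y v) \<le> k * norm (x - y) * norm v" if xy: "x \<in> C" "y \<in> C" for x y v
    proof -
      have "norm (B x v - B y v) \<le> (\<Sum>b\<in>Basis. K2 b * norm (x - y)) * norm v"
        using xy C K2 by (intro linear_norm_le[of "\<lambda>v. B x v - B y v"] linear_compose_sub lin) auto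
      also have "\<dots> = sum K2 Basis * norm (x - y) * norm v" by (simp add: sum_distrib_right)
      also have "\<dots> \<le> k * norm (x - y) * norm v" using nn by (intro mult_right_mono) (auto simp: k_def)
      finally show ?thesis .
    qed
    show "norm (B y v - B x v - fd (\<lambda>z. B z v) x (y - x)) \<le> k * (norm (y - x))\<^sup>2 * norm v"
      if xy: "x \<in> C" "y \<in> C" for x y v
    proof -
      have x: "x \<in> S" using xy C by auto
      have "norm (B y v - B x v - fd (\<lambda>z. B z v) x (y - x)) \<le> (\<Sum>b\<in>Basis. K3 b * (norm (y - x))\<^sup>2) * norm v"
        using xy C K3 fd_param_linear[OF S x lin sm]
        by (intro linear_norm_le[of "\<lambda>v. B y v - B x v - fd (\<lambda>z. B z v) x (y - x)"] linear_compose_sub lin) auto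
      also have "\<dots> = sum K3 Basis * (norm (y - x))\<^sup>2 * norm v" by (simp add: sum_distrib_right)
      also have "\<dots> \<le> k * (norm (y - x))\<^sup>2 * norm v" using nn by (intro mult_right_mono) (auto simp: k_def)
      finally show ?thesis .
    qed
  qed
qed

text \<open>The contraction principle for the integral form of the ray equation, with all
  \<open>a\<close> treated together. \<open>K * r \<le> \<rho>\<close> keeps the values in the ball
  where \<open>B\<close> is controlled, and \<open>K * r \<le> 1/2\<close> makes the operator a
  contraction.\<close>

lemma ray_integral_fixed_point:
  fixes B :: "'a::euclidean_space \<Rightarrow> 'a \<Rightarrow> 'a"
  assumes cont: "continuous_on (cball x0 \<rho> \<times> UNIV) (\<lambda>(x, v). B x v)"
    and bd: "\<And>x v. x \<in> cball x0 \<rho> \<Longrightarrow> norm (B x v) \<le> K * norm v"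
    and lip: "\<And>x y v. x \<in> cball x0 \<rho> \<Longrightarrow> y \<in> cball x0 \<rho> \<Longrightarrow> norm (B x v - B y v) \<le> K * norm (x - y) * norm v"
    and r: "r > 0" "K * r \<le> \<rho>" "K * r \<le> 1/2" and K: "K > 0"
  obtains \<sigma> where "continuous_on (cball 0 r) \<sigma>" "\<sigma> ` cball 0 r \<subseteq> cball x0 \<rho>"
    "\<And>a. a \<in> cball 0 r \<Longrightarrow> \<sigma> a = x0 + integral {0..1} (\<lambda>t. B (\<sigma> (t *\<^sub>R a)) a)"
proof -
  \<comment> \<open>Retracting onto the ball makes the operator act on bounded continuous functions
    defined on the whole space; on the ball itself nothing changes.\<close>
  define \<pi> :: "'a \<Rightarrow> 'a" where "\<pi> = closest_point (cball 0 r)"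
  have ne: "cball (0::'a) r \<noteq> {}" using r by auto
  have \<pi>c: "continuous_on UNIV \<pi>"
    unfolding \<pi>_def by (rule continuous_on_closest_point) (use ne in auto)
  have \<pi>r: "norm (\<pi> a) \<le> r" for a
    using closest_point_in_set[OF closed_cball ne, of a] by (simp add: \<pi>_def)
  have \<pi>i: "\<pi> a = a" if "norm a \<le> r" for a
    using that by (simp add: \<pi>_def closest_point_self)
  have rho: "\<rho> > 0" using r K by (meson less_le_trans mult_pos_pos)
  define P :: "('a \<Rightarrow>\<^sub>C 'a) set" where "P = PiC UNIV (\<lambda>_. cball x0 \<rho>)"
  define T0 where "T0 = (\<lambda>(u::'a \<Rightarrow>\<^sub>C 'a) a. x0 + integral {0..1} (\<lambda>t. B (u (t *\<^sub>R \<pi> a)) (\<pi> a)))"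
  have P: "u \<in> P \<longleftrightarrow> (\<forall>a. u a \<in> cball x0 \<rho>)" for u by (auto simp: P_def mem_PiC_iff Pi_def)
  have c2: "continuous_on (UNIV \<times> cbox 0 (1::real)) (\<lambda>(a, t). B (u (t *\<^sub>R \<pi> a)) (\<pi> a))"
    if u: "u \<in> P" for u
  proof -
    have p: "continuous_on (UNIV \<times> cbox 0 (1::real)) (\<lambda>z. \<pi> (fst z))"
      by (intro continuous_on_compose2[OF \<pi>c] continuous_intros) auto
    have "continuous_on (UNIV \<times> cbox 0 (1::real)) (\<lambda>z. u (snd z *\<^sub>R \<pi> (fst z)))"
      by (intro continuous_on_compose2[OF continuous_on_apply_bcontfun[of UNIV u]] continuous_on_scaleR p
          continuous_intros) auto
    then have 1: "continuous_on (UNIV \<times> cbox 0 (1::real)) (\<lambda>z. (u (snd z *\<^sub>R \<pi> (fst z)), \<pi> (fst z)))"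
      using p by (intro continuous_on_Pair)
    have 2: "(\<lambda>z. (u (snd z *\<^sub>R \<pi> (fst z)), \<pi> (fst z))) ` (UNIV \<times> cbox 0 (1::real)) \<subseteq> cball x0 \<rho> \<times> UNIV"
      using u unfolding P by blast
    show ?thesis
      using continuous_on_compose2[OF cont 1 2] by (simp add: case_prod_unfold)
  qed
  have cI: "continuous_on {0..1} (\<lambda>t. B (u (t *\<^sub>R \<pi> a)) (\<pi> a))" if u: "u \<in> P" for u a
  proof -
    have "continuous_on {0..1} (Pair a)" by (intro continuous_intros)
    from continuous_on_compose2[OF c2[OF u] this] show ?thesis by auto
  qed
  have T0d: "dist (T0 u a) x0 \<le> K * r" if u: "u \<in> P" for u a
  proof -
    have "norm (integral {0..1} (\<lambda>t. B (u (t *\<^sub>R \<pi> a)) (\<pi> a))) \<le> K * r * (1 - 0)"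
    proof (rule integral_bound[OF _ cI[OF u]])
      show "norm (B (u (t *\<^sub>R \<pi> a)) (\<pi> a)) \<le> K * r" for t
      proof -
        have "norm (B (u (t *\<^sub>R \<pi> a)) (\<pi> a)) \<le> K * norm (\<pi> a)" using u P bd by blast
        then show ?thesis using mult_left_mono[OF \<pi>r[of a] less_imp_le[OF K]] by linarith
      qed
    qed auto
    then show ?thesis by (simp add: T0_def dist_norm)
  qed
  have T0b: "T0 u \<in> bcontfun" if u: "u \<in> P" for u
  proof -
    have "continuous_on UNIV (T0 u)"
      unfolding T0_def using integral_continuous_on_param[OF c2[OF u]]
      by (intro continuous_intros) simp
    moreover have "bounded (range (T0 u))"
      using T0d[OF u] by (auto simp: bounded_def dist_commute intro!: exI[of _ x0] exI[of _ "K * r"])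
    ultimately show ?thesis by (simp add: bcontfun_def)
  qed
  define T where "T = (\<lambda>u. Bcontfun (T0 u))"
  have T: "apply_bcontfun (T u) = T0 u" if "u \<in> P" for u
    unfolding T_def using Bcontfun_inverse[OF T0b[OF that]] .
  have "\<exists>!u\<in>P. T u = u"
  \<comment> \<open>The factor 1/2 is \<open>K * r\<close>: the Lipschitz constant of
    \<open>B\<close> times the bound on \<open>norm (\<pi> a)\<close>.\<close>
  proof (rule Banach_fix[where c = "1/2"])
    show "complete P" unfolding P_def by (intro complete_eq_closed[THEN iffD2] closed_PiC) auto
    show "P \<noteq> {}"
    proof -
      have "const_bcontfun x0 \<in> P" using rho by (simp add: P const_bcontfun.rep_eq)
      then show ?thesis by blast
    qed
    show "T ` P \<subseteq> P"
    proof (intro image_subsetI P[THEN iffD2] allI)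
      fix u a assume "u \<in> P"
      then show "T u a \<in> cball x0 \<rho>" using T0d[of u a] r(2) by (simp add: T dist_commute)
    qed
    show "dist (T u) (T w) \<le> 1/2 * dist u w" if uw: "u \<in> P" "w \<in> P" for u w
    proof (rule dist_bound)
      fix a
      have "T0 u a - T0 w a = integral {0..1} (\<lambda>t. B (u (t *\<^sub>R \<pi> a)) (\<pi> a) - B (w (t *\<^sub>R \<pi> a)) (\<pi> a))"
        using cI uw by (simp add: T0_def integral_diff integrable_continuous_interval)
      also have "norm \<dots> \<le> (1/2 * dist u w) * (1 - 0)"
      proof (rule integral_bound)
        fix t :: real
        let ?x = "u (t *\<^sub>R \<pi> a)" and ?y = "w (t *\<^sub>R \<pi> a)"
        have "norm (B ?x (\<pi> a) - B ?y (\<pi> a)) \<le> K * norm (?x - ?y) * norm (\<pi> a)"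
          using lip uw P by blast
        also have "\<dots> \<le> K * dist u w * r"
          using dist_bounded[of u "t *\<^sub>R \<pi> a" w] K \<pi>r[of a]
          by (intro mult_mono) (auto simp: dist_norm)
        also have "\<dots> \<le> 1/2 * dist u w"
          using mult_right_mono[OF r(3), of "dist u w"] by (simp add: mult_ac)
        finally show "norm (B ?x (\<pi> a) - B ?y (\<pi> a)) \<le> 1/2 * dist u w" .
      qed (use cI uw in \<open>auto intro: continuous_on_diff\<close>)
      finally show "dist (T u a) (T w a) \<le> 1/2 * dist u w" using uw by (simp add: T dist_norm)
    qed
  qed auto
  then obtain u where u: "u \<in> P" "T u = u" by blast
  have fp: "u a = T0 u a" for a using T u by metis
  show ?thesis
  proof (rule that[of u])
    show "u a = x0 + integral {0..1} (\<lambda>t. B (u (t *\<^sub>R a)) a)" if "a \<in> cball 0 r" for a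
      using fp[of a] \<pi>i[of a] that by (simp add: T0_def)
  qed (use u P in auto)
qed

text \<open>Because \<open>B x\<close> is linear, the substitution \<open>x \<mapsto> s * x\<close>
  turns the integral over [0,1] for the point \<open>s *\<^sub>R a\<close> into the integral over
  [0,s] for \<open>a\<close>. The fundamental theorem of calculus then applies.\<close>

lemma ray_integral_derivative:
  fixes B :: "'a::euclidean_space \<Rightarrow> 'a \<Rightarrow> 'a"
  assumes cont: "continuous_on (cball x0 \<rho> \<times> UNIV) (\<lambda>(x, v). B x v)"
    and lin: "\<And>x. x \<in> cball x0 \<rho> \<Longrightarrow> linear (B x)"
    and \<sigma>c: "continuous_on (cball 0 r) \<sigma>" and \<sigma>i: "\<sigma> ` cball 0 r \<subseteq> cball x0 \<rho>"
    and \<sigma>: "\<And>a. a \<in> cball 0 r \<Longrightarrow> \<sigma> a = x0 + integral {0..1} (\<lambda>t. B (\<sigma> (t *\<^sub>R a)) a)"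
    and a: "a \<in> cball 0 r" and t: "t \<in> {0..1}"
  shows "((\<lambda>t. \<sigma> (t *\<^sub>R a)) has_vector_derivative B (\<sigma> (t *\<^sub>R a)) a) (at t within {0..1})"
proof -
  have ta: "t *\<^sub>R a \<in> cball 0 r" if "t \<in> {0..1}" for t
    using that a mult_left_le_one_le[of "norm a" t] by simp
  define p where "p = (\<lambda>s. B (\<sigma> (s *\<^sub>R a)) a)"
  have pc: "continuous_on {0..1} p"
  proof -
    have "continuous_on {0..1} (\<lambda>s. \<sigma> (s *\<^sub>R a))"
      using ta by (intro continuous_on_compose2[OF \<sigma>c] continuous_intros) auto
    then have "continuous_on {0..1} (\<lambda>s. (\<sigma> (s *\<^sub>R a), a))" by (intro continuous_intros)
    from continuous_on_compose2[OF cont this] show ?thesis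
      unfolding p_def using ta \<sigma>i by (force simp: case_prod_unfold)
  qed
  have eq: "x0 + integral {0..s} p = \<sigma> (s *\<^sub>R a)" if s: "s \<in> {0..1}" for s
  \<comment> \<open>The substitution degenerates at \<open>s = 0\<close>; there both sides equal
    \<open>x0\<close>, since \<open>B (\<sigma> 0) 0 = 0\<close>.\<close>
  proof (cases "s = 0")
    case True
    have "0 \<in> cball (0::'a) r" using ta[of 0] by simp
    then have "\<sigma> 0 \<in> cball x0 \<rho>" using \<sigma>i by blast
    then have "B (\<sigma> 0) 0 = 0" using linear_0[OF lin] by blast
    then show ?thesis using True \<sigma>[of 0] a norm_ge_zero[of a] by (auto simp del: norm_ge_zero)
  next
    case False
    then have s0: "s > 0" using s by auto
    have int: "p integrable_on {0..s}"
      using s by (intro integrable_continuous_interval continuous_on_subset[OF pc]) auto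
    have im: "(\<lambda>x. x / s) ` {0..s} = {0..1}"
      using s0 by (auto simp: image_iff field_simps intro!: bexI[of _ "s * _"])
    have "((\<lambda>x. p (s * x)) has_integral (1 / s) *\<^sub>R integral {0..s} p) {0..1}"
      using has_integral_stretch_real[OF integrable_integral[OF int] False] s0 im by simp
    then have "((\<lambda>x. s *\<^sub>R p (s * x)) has_integral s *\<^sub>R (1 / s) *\<^sub>R integral {0..s} p) {0..1}"
      by (rule has_integral_cmul)
    then have "((\<lambda>x. s *\<^sub>R p (s * x)) has_integral integral {0..s} p) {0..1}" using s0 by simp
    moreover have "s *\<^sub>R p (s * x) = B (\<sigma> (x *\<^sub>R (s *\<^sub>R a))) (s *\<^sub>R a)" if "x \<in> {0..1}" for x
    proof -
      have "s * x \<in> {0..1}" using that s by (auto intro: mult_le_one)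
      then have "\<sigma> ((s * x) *\<^sub>R a) \<in> cball x0 \<rho>" using ta \<sigma>i by blast
      from linear_scale[OF lin[OF this], of s a] show ?thesis by (simp add: p_def mult.commute)
    qed
    ultimately have "((\<lambda>x. B (\<sigma> (x *\<^sub>R (s *\<^sub>R a))) (s *\<^sub>R a)) has_integral integral {0..s} p) {0..1}"
      using has_integral_cong by (metis (no_types, lifting))
    then show ?thesis using \<sigma>[OF ta[OF s]] by (simp add: integral_unique)
  qed
  have "((\<lambda>u. x0 + integral {0..u} p) has_vector_derivative p t) (at t within {0..1})"
    using integral_has_vector_derivative[OF pc t] by (auto intro!: derivative_eq_intros)
  from has_vector_derivative_transform[OF t eq[symmetric] this] show ?thesis
    by (simp add: p_def)
qed

text \<open>If the fields $B(\cdot)v$ commute, then $t \mapsto y(t) + t B(y(t))d$ solves the equation of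
  $t \mapsto \sigma(t(a + d))$ up to an error $O(|d|^2)$, where $y(t) = \sigma(ta)$.\<close>

lemma total_equation_has_derivative:
  fixes B :: "'a::euclidean_space \<Rightarrow> 'a \<Rightarrow> 'a"
  assumes S: "open S" "cball x0 \<rho> \<subseteq> S" and lin: "\<And>x. x \<in> S \<Longrightarrow> linear (B x)"
    and sm: "\<And>v. smooth_on S (\<lambda>x. B x v)"
    and comm: "\<And>x v w. x \<in> S \<Longrightarrow> fd (\<lambda>y. B y w) x (B x v) = fd (\<lambda>y. B y v) x (B x w)"
    and K: "K > 0" "\<rho> > 0" and bd: "\<And>x v. x \<in> cball x0 \<rho> \<Longrightarrow> norm (B x v) \<le> K * norm v"
    and lip: "\<And>x y v. x \<in> cball x0 \<rho> \<Longrightarrow> y \<in> cball x0 \<rho> \<Longrightarrow> norm (B x v - B y v) \<le> K * norm (x - y) * norm v"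
    and tay: "\<And>x y v. x \<in> cball x0 \<rho> \<Longrightarrow> y \<in> cball x0 \<rho> \<Longrightarrow>
      norm (B y v - B x v - fd (\<lambda>z. B z v) x (y - x)) \<le> K * (norm (y - x))\<^sup>2 * norm v"
    and r: "r > 0" "K * r \<le> 1/2"
    and \<sigma>c: "continuous_on (cball 0 r) \<sigma>" and \<sigma>i: "\<sigma> ` cball 0 r \<subseteq> cball x0 (\<rho>/2)" and \<sigma>0: "\<sigma> 0 = x0"
    and \<sigma>: "\<And>a t. a \<in> cball 0 r \<Longrightarrow> t \<in> {0..1} \<Longrightarrow>
      ((\<lambda>t. \<sigma> (t *\<^sub>R a)) has_vector_derivative B (\<sigma> (t *\<^sub>R a)) a) (at t within {0..1})"
    and a: "a \<in> ball 0 r"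
  shows "(\<sigma> has_derivative B (\<sigma> a)) (at a)"
proof -
  have ta: "t *\<^sub>R a \<in> cball 0 r" if "t \<in> {0..1}" "a \<in> cball 0 r" for t and a :: 'a
    using that mult_left_le_one_le[of "norm a" t] by simp
  have half: "x \<in> cball x0 (\<rho>/2) \<Longrightarrow> x \<in> cball x0 \<rho>" for x using K by auto
  have \<sigma>S: "\<sigma> b \<in> S" "\<sigma> b \<in> cball x0 \<rho>" if "b \<in> cball 0 r" for b
    using that \<sigma>i S half by blast+
  \<comment> \<open>The two quadratic errors in the estimate of \<open>e'\<close>: the Taylor
    remainder of \<open>B\<close> applied to \<open>a\<close>, and the Lipschitz error of
    \<open>B\<close> applied to \<open>d\<close>.\<close>
  define C where "C = K * K\<^sup>2 * r + K * K"
  have C: "C > 0" using K r by (simp add: C_def add_pos_pos)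
  \<comment> \<open>The first bound keeps \<open>a + d\<close> in the ball of radius
    \<open>r\<close>. The second gives \<open>K * norm d \<le> \<rho>/2\<close>, so that
    \<open>w\<close> stays within \<rho> of \<open>x0\<close>, because \<open>y\<close> stays within
    \<rho>/2.\<close>
  define d0 where "d0 = min (r - norm a) (\<rho> / (2 * K))"
  have d0: "d0 > 0" using a K by (simp add: d0_def)
  have est: "norm (\<sigma> (a + d) - \<sigma> a - B (\<sigma> a) d) \<le> 2 * C * (norm d)\<^sup>2" if d: "norm d < d0" for d
  proof -
    have ar: "a \<in> cball 0 r" using a by simp
    have adr: "a + d \<in> cball 0 r"
      using d norm_triangle_ineq[of a d] by (simp add: d0_def)
    have Kd: "K * norm d \<le> \<rho> / 2" using d K by (simp add: d0_def field_simps)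
    define y where "y = (\<lambda>t. \<sigma> (t *\<^sub>R a))"
    define z where "z = (\<lambda>t. \<sigma> (t *\<^sub>R (a + d)))"
    define w where "w = (\<lambda>t. y t + t *\<^sub>R B (y t) d)"
    define e where "e = (\<lambda>t. z t - w t)"
    define e' where "e' = (\<lambda>t. B (z t) (a + d) - (B (y t) a + (B (y t) d + t *\<^sub>R fd (\<lambda>x. B x d) (y t) (B (y t) a))))"
    have yz: "y t \<in> cball x0 (\<rho>/2)" "z t \<in> cball x0 \<rho>" "y t \<in> S" if "t \<in> {0..1}" for t
      using ta[OF that ar] ta[OF that adr] \<sigma>i half \<sigma>S unfolding y_def z_def by blast+
    have wc: "w t \<in> cball x0 \<rho>" if t: "t \<in> {0..1}" for t
    proof -
      have "norm (t *\<^sub>R B (y t) d) \<le> 1 * norm (B (y t) d)"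
        using t by (simp add: mult_left_le_one_le)
      also have "\<dots> \<le> \<rho>/2" using bd[OF half[OF yz(1)[OF t]], of d] Kd by simp
      finally show ?thesis
        using yz(1)[OF t] norm_triangle_ineq4[of "x0 - y t" "t *\<^sub>R B (y t) d"]
        by (simp add: w_def dist_norm diff_diff_eq)
    qed
    have der: "(e has_vector_derivative e' t) (at t within {0..1})" if t: "t \<in> {0..1}" for t
    proof -
      have dy: "(y has_vector_derivative B (y t) a) (at t within {0..1})"
        unfolding y_def by (rule \<sigma>[OF ar t])
      have dz: "(z has_vector_derivative B (z t) (a + d)) (at t within {0..1})"
        unfolding z_def by (rule \<sigma>[OF adr t])
      have "((\<lambda>t. B (y t) d) has_derivative (\<lambda>h. fd (\<lambda>x. B x d) (y t) (h *\<^sub>R B (y t) a))) (at t within {0..1})"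
        using has_derivative_compose[OF dy[unfolded has_vector_derivative_def] smooth_on_works[OF sm yz(3)[OF t]]] .
      then have "((\<lambda>t. B (y t) d) has_vector_derivative fd (\<lambda>x. B x d) (y t) (B (y t) a)) (at t within {0..1})"
        unfolding has_vector_derivative_def
        by (simp add: linear_scale[OF fd_linear[OF smooth_on_differentiable[OF sm yz(3)[OF t]]]])
      then have "((\<lambda>t. t *\<^sub>R B (y t) d) has_vector_derivative
          t *\<^sub>R fd (\<lambda>x. B x d) (y t) (B (y t) a) + 1 *\<^sub>R B (y t) d) (at t within {0..1})"
        by (intro has_vector_derivative_scaleR) (auto intro: derivative_eq_intros)
      then show ?thesis
        unfolding e_def e'_def w_def using dy dz
        by (intro has_vector_derivative_diff has_vector_derivative_add) (simp_all add: add.commute)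
    qed
    have e'b: "norm (e' t) \<le> norm (e t) / 2 + C * (norm d)\<^sup>2" if t: "t \<in> {0..1}" for t
    proof -
      note yt = half[OF yz(1)[OF t]]
      have dlin: "linear (fd (\<lambda>x. B x a) (y t))"
        by (rule fd_linear[OF smooth_on_differentiable[OF sm yz(3)[OF t]]])
      have wy: "w t - y t = t *\<^sub>R B (y t) d" by (simp add: w_def)
      have nwy: "norm (w t - y t) \<le> K * norm d"
      proof -
        have "norm (w t - y t) \<le> 1 * norm (B (y t) d)"
          unfolding wy using t by (simp add: mult_left_le_one_le)
        then show ?thesis using bd[OF yt, of d] by simp
      qed
      \<comment> \<open>Here commutativity enters. The left side comes from differentiating
        \<open>t *\<^sub>R B (y t) d\<close>, the right side is the first-order change of
        \<open>B x a\<close> from \<open>y t\<close> to \<open>w t\<close>; their equality leaves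
        only quadratic errors.\<close>
      have "fd (\<lambda>x. B x d) (y t) (B (y t) a) = fd (\<lambda>x. B x a) (y t) (B (y t) d)"
        by (rule comm[OF yz(3)[OF t]])
      then have tf: "t *\<^sub>R fd (\<lambda>x. B x d) (y t) (B (y t) a) = fd (\<lambda>x. B x a) (y t) (w t - y t)"
        unfolding wy by (simp add: linear_scale[OF dlin])
      have lw: "B (w t) (a + d) = B (w t) a + B (w t) d"
        using linear_add[OF lin] wc[OF t] S by blast
      have "e' t = (B (z t) (a + d) - B (w t) (a + d))
          + ((B (w t) a - B (y t) a - fd (\<lambda>x. B x a) (y t) (w t - y t)) + (B (w t) d - B (y t) d))"
        unfolding e'_def tf lw by simp
      also have "norm \<dots> \<le> K * norm (z t - w t) * norm (a + d)
          + (K * (norm (w t - y t))\<^sup>2 * norm a + K * norm (w t - y t) * norm d)"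
        by (intro order_trans[OF norm_triangle_ineq add_mono] lip tay yz(2) wc t yt)
      also have "\<dots> \<le> norm (e t) / 2 + (K * (K * norm d)\<^sup>2 * r + K * (K * norm d) * norm d)"
      proof (intro add_mono mult_mono power_mono nwy)
        have "K * norm (z t - w t) * norm (a + d) \<le> norm (z t - w t) * (K * r)"
          using adr K mult_left_mono[of "norm (a + d)" r "K * norm (z t - w t)"] by (simp add: mult_ac)
        also have "\<dots> \<le> norm (z t - w t) * (1/2)" using r by (intro mult_left_mono) auto
        finally show "K * norm (z t - w t) * norm (a + d) \<le> norm (e t) / 2" by (simp add: e_def)
      qed (use K r ar in auto)
      also have "\<dots> = norm (e t) / 2 + C * (norm d)\<^sup>2"
        by (simp add: C_def power2_eq_square algebra_simps)
      finally show ?thesis .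
    qed
    have ec: "continuous_on {0..1} (\<lambda>t. norm (e t))"
      using der by (intro continuous_on_norm continuous_on_vector_derivative)
    \<comment> \<open>This replaces a Gronwall estimate: at a maximum of \<open>norm (e t)\<close>
      the mean value bound reads \<open>norm (e s) \<le> norm (e s) / 2 + C * (norm d)^2\<close>,
      and the first term is absorbed on the left.\<close>
    obtain s where s: "s \<in> {0..1}" "\<And>t. t \<in> {0..1} \<Longrightarrow> norm (e t) \<le> norm (e s)"
      using continuous_attains_sup[OF _ _ ec] by auto
    have "norm (e s - e 0) \<le> (norm (e s) / 2 + C * (norm d)\<^sup>2) * norm (s - 0)"
    proof (rule differentiable_bound[where S = "{0..1}" and f = e and f' = "\<lambda>t h. h *\<^sub>R e' t"])
      show "(e has_derivative (\<lambda>h. h *\<^sub>R e' t)) (at t within {0..1})" if "t \<in> {0..1}" for t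
        using der[OF that] by (simp add: has_vector_derivative_def)
      show "onorm (\<lambda>h. h *\<^sub>R e' t) \<le> norm (e s) / 2 + C * (norm d)\<^sup>2" if "t \<in> {0..1}" for t
      proof (rule onorm_le)
        fix h :: real
        have "norm (e' t) \<le> norm (e s) / 2 + C * (norm d)\<^sup>2" using e'b[OF that] s(2)[OF that] by simp
        then show "norm (h *\<^sub>R e' t) \<le> (norm (e s) / 2 + C * (norm d)\<^sup>2) * norm h"
          by (simp add: mult.commute mult_left_mono)
      qed
    qed (use s in auto)
    also have "\<dots> \<le> (norm (e s) / 2 + C * (norm d)\<^sup>2) * 1"
      using s C by (intro mult_left_mono) (auto intro: add_nonneg_nonneg)
    also have "e s - e 0 = e s" by (simp add: e_def w_def y_def z_def)
    finally have "norm (e s) \<le> 2 * C * (norm d)\<^sup>2" by simp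
    then have "norm (e 1) \<le> 2 * C * (norm d)\<^sup>2" using s(2)[of 1] by simp
    then show ?thesis by (simp add: e_def w_def y_def z_def diff_diff_eq)
  qed
  show ?thesis
    unfolding has_derivative_at_alt
  proof (intro conjI allI impI)
    show "bounded_linear (B (\<sigma> a))"
      using lin \<sigma>S a by (simp add: linear_linear)
    fix e :: real assume e: "e > 0"
    show "\<exists>d>0. \<forall>y. norm (y - a) < d \<longrightarrow> norm (\<sigma> y - \<sigma> a - B (\<sigma> a) (y - a)) \<le> e * norm (y - a)"
    proof (intro exI[of _ "min d0 (e / (2 * C))"] conjI allI impI)
      show "0 < min d0 (e / (2 * C))" using d0 e C by simp
      fix y assume y: "norm (y - a) < min d0 (e / (2 * C))"
      have "norm (\<sigma> y - \<sigma> a - B (\<sigma> a) (y - a)) \<le> 2 * C * (norm (y - a))\<^sup>2"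
        using est[of "y - a"] y by simp
      also have "\<dots> = (2 * C * norm (y - a)) * norm (y - a)" by (simp add: power2_eq_square)
      also have "\<dots> \<le> e * norm (y - a)"
        using y C by (intro mult_right_mono) (auto simp: field_simps)
      finally show "norm (\<sigma> y - \<sigma> a - B (\<sigma> a) (y - a)) \<le> e * norm (y - a)" .
    qed
  qed
qed

text \<open>The Frobenius theorem as a total differential equation. \<open>comm\<close> is its
  integrability condition: it expresses the symmetry of the second derivative of \<sigma> that the
  equation would impose.\<close>

theorem total_equation_solution:
  fixes B :: "'a::euclidean_space \<Rightarrow> 'a \<Rightarrow> 'a"
  assumes S: "open S" "x0 \<in> S" and lin: "\<And>x. x \<in> S \<Longrightarrow> linear (B x)"
    and sm: "\<And>v. smooth_on S (\<lambda>x. B x v)"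
    and comm: "\<And>x v w. x \<in> S \<Longrightarrow> fd (\<lambda>y. B y w) x (B x v) = fd (\<lambda>y. B y v) x (B x w)"
  obtains r \<sigma> where "r > 0" "\<sigma> 0 = x0" "\<sigma> ` ball 0 r \<subseteq> S" "smooth_on (ball 0 r) \<sigma>"
    "\<And>a v. a \<in> ball 0 r \<Longrightarrow> fd \<sigma> a v = B (\<sigma> a) v"
proof -
  obtain \<rho> where \<rho>: "\<rho> > 0" "cball x0 \<rho> \<subseteq> S" using S open_contains_cball by blast
  obtain K where K: "K > 0" and bd: "\<And>x v. x \<in> cball x0 \<rho> \<Longrightarrow> norm (B x v) \<le> K * norm v"
    and lip: "\<And>x y v. x \<in> cball x0 \<rho> \<Longrightarrow> y \<in> cball x0 \<rho> \<Longrightarrow> norm (B x v - B y v) \<le> K * norm (x - y) * norm v"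
    and tay: "\<And>x y v. x \<in> cball x0 \<rho> \<Longrightarrow> y \<in> cball x0 \<rho> \<Longrightarrow>
      norm (B y v - B x v - fd (\<lambda>z. B z v) x (y - x)) \<le> K * (norm (y - x))\<^sup>2 * norm v"
    using operator_family_bounds[OF S(1) lin sm compact_cball convex_cball \<rho>(2)] by blast
  have cont: "continuous_on (cball x0 \<rho> \<times> UNIV) (\<lambda>(x, v). B x v)"
  proof -
    have "continuous_on (cball x0 \<rho> \<times> UNIV) (\<lambda>z. \<Sum>b\<in>Basis. (snd z \<bullet> b) *\<^sub>R B (fst z) b)"
      using \<rho>(2)
      by (intro continuous_intros continuous_on_compose2[OF smooth_on_continuous[OF sm]]) auto
    moreover have "(\<Sum>b\<in>Basis. (snd z \<bullet> b) *\<^sub>R B (fst z) b) = (case z of (x, v) \<Rightarrow> B x v)"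
      if "z \<in> cball x0 \<rho> \<times> UNIV" for z
      using that \<rho>(2) linear_expand[OF lin, of "fst z" "snd z"] by (auto simp: case_prod_unfold)
    ultimately show ?thesis using continuous_on_cong by (metis (no_types, lifting))
  qed
  have cs: "cball x0 (\<rho>/2) \<subseteq> cball x0 \<rho>" using \<rho> by auto
  \<comment> \<open>The solution is confined to the ball of radius \<rho>/2, which leaves room for
    the perturbed curves of \<open>total_equation_has_derivative\<close> in the ball of radius
    \<rho>.\<close>
  define r where "r = min (\<rho> / (2 * K)) (1 / (2 * K))"
  have r: "r > 0" "K * r \<le> \<rho> / 2" "K * r \<le> 1 / 2"
    using \<rho> K by (auto simp: r_def min_def field_simps)
  have cont2: "continuous_on (cball x0 (\<rho>/2) \<times> UNIV) (\<lambda>(x, v). B x v)"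
    by (rule continuous_on_subset[OF cont]) (use cs in auto)
  obtain \<sigma> where \<sigma>: "continuous_on (cball 0 r) \<sigma>" "\<sigma> ` cball 0 r \<subseteq> cball x0 (\<rho>/2)"
    "\<And>a. a \<in> cball 0 r \<Longrightarrow> \<sigma> a = x0 + integral {0..1} (\<lambda>t. B (\<sigma> (t *\<^sub>R a)) a)"
    by (rule ray_integral_fixed_point[OF cont2 bd lip r K]) (use cs in auto)
  have lin0: "linear (B x)" if "x \<in> cball x0 (\<rho>/2)" for x using that cs \<rho> lin by blast
  have ray: "((\<lambda>t. \<sigma> (t *\<^sub>R a)) has_vector_derivative B (\<sigma> (t *\<^sub>R a)) a) (at t within {0..1})"
    if "a \<in> cball 0 r" "t \<in> {0..1}" for a t
    using ray_integral_derivative[OF cont2 lin0 \<sigma> that] .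
  have \<sigma>0: "\<sigma> 0 = x0"
  proof -
    have "\<sigma> 0 \<in> cball x0 (\<rho>/2)" using \<sigma>(2) r(1) by (simp add: image_subset_iff)
    then have B0: "B (\<sigma> 0) 0 = 0" using linear_0[OF lin0] by blast
    have "0 \<in> cball (0::'a) r" using r(1) by simp
    from \<sigma>(3)[OF this] have "\<sigma> 0 = x0 + integral {0..1} (\<lambda>t::real. B (\<sigma> 0) 0)"
      unfolding scaleR_zero_right .
    also have "\<dots> = x0" unfolding B0 by simp
    finally show ?thesis .
  qed
  have der: "(\<sigma> has_derivative B (\<sigma> a)) (at a)" if "a \<in> ball 0 r" for a
    by (rule total_equation_has_derivative[OF S(1) \<rho>(2) lin sm comm K \<rho>(1) bd lip tay r(1,3) \<sigma>(1,2) \<sigma>0 ray that])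
  have im: "\<sigma> ` ball 0 r \<subseteq> S" using \<sigma>(2) cs \<rho>(2) by force
  have "C_k_on k \<sigma> (ball 0 r)" for k
  proof (induction k)
    case 0
    then show ?case using \<sigma>(1) continuous_on_subset by (metis C_k_on.simps(1) ball_subset_cball)
  next
    case (Suc k)
    have "C_k_on k (\<lambda>x. fd \<sigma> x v) (ball 0 r)" for v
    proof (rule C_k_on_cong)
      show "C_k_on k (\<lambda>a. B (\<sigma> a) v) (ball 0 r)"
        using C_k_on_compose[OF open_ball Suc _ im] sm unfolding smooth_on_def by blast
    qed (use fd_eq[OF der] in auto)
    then show ?case using differentiableI[OF der] by simp
  qed
  then show ?thesis using that[OF r(1) \<sigma>0 im] fd_eq[OF der] by (simp add: smooth_on_def)
qed

section \<open>Inverses of families of linear operators\<close>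

text \<open>An injective operator is bounded below by some \<open>c\<close>, and a perturbation of
  norm below \<open>c/2\<close> preserves the bound \<open>c/2\<close>. The constant is uniform in
  \<open>x\<close>, which yields both nearby injectivity and continuity of the inverses.\<close>

lemma operator_family_bounded_below:
  fixes L :: "'a::euclidean_space \<Rightarrow> 'a \<Rightarrow> 'a"
  assumes S: "open S" "x0 \<in> S" and lin: "\<And>x. x \<in> S \<Longrightarrow> linear (L x)"
    and cont: "\<And>v. continuous_on S (\<lambda>x. L x v)" and inj: "inj (L x0)"
  obtains T k where "open T" "x0 \<in> T" "T \<subseteq> S" "k > 0" "\<And>x w. x \<in> T \<Longrightarrow> norm w \<le> k * norm (L x w)"
proof -
  obtain c where c: "c > 0" "\<And>w. c * norm w \<le> norm (L x0 w)"
    using linear_inj_bounded_below_pos[OF lin[OF S(2)] inj] by blast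
  define e where "e = (\<lambda>x. \<Sum>b\<in>Basis. norm (L x0 b - L x b))"
  have ec: "continuous_on S e" unfolding e_def by (intro continuous_intros cont)
  define T where "T = S \<inter> e -` {..< c/2}"
  have oT: "open T" unfolding T_def by (rule continuous_open_preimage[OF ec S(1)]) simp
  have "norm w \<le> (2 / c) * norm (L x w)" if x: "x \<in> T" for x w
  proof -
    have xS: "x \<in> S" using x by (simp add: T_def)
    have "norm (L x0 w - L x w) \<le> e x * norm w"
      unfolding e_def by (rule linear_norm_le) (use xS S in \<open>auto intro: linear_compose_sub lin\<close>)
    also have "\<dots> \<le> c/2 * norm w" using x by (intro mult_right_mono) (auto simp: T_def)
    finally have "c * norm w \<le> c/2 * norm w + norm (L x w)"
      using c(2)[of w] norm_triangle_ineq2[of "L x0 w" "L x w"] by linarith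
    then show ?thesis using c(1) by (simp add: field_simps)
  qed
  moreover have "x0 \<in> T" using S c(1) by (simp add: T_def e_def)
  ultimately show ?thesis using that[OF oT, of "2 / c"] c(1) by (auto simp: T_def)
qed

text \<open>A product rule in which \<open>g\<close> is merely continuous: because
  \<open>f x = 0\<close>, the increment of \<open>g\<close> is always multiplied by something of
  first order. It serves to differentiate an inverse not yet known to be differentiable.\<close>

lemma has_derivative_scaleR_vanishing:
  fixes f :: "'a::real_normed_vector \<Rightarrow> real" and g :: "'a \<Rightarrow> 'b::real_normed_vector"
  assumes f: "(f has_derivative f') (at x)" "f x = 0" and g: "isCont g x"
  shows "((\<lambda>y. f y *\<^sub>R g y) has_derivative (\<lambda>h. f' h *\<^sub>R g x)) (at x)"
proof -
  obtain M where M: "M > 0" "\<And>h. norm (f' h) \<le> M * norm h"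
    using bounded_linear.pos_bounded[OF has_derivative_bounded_linear[OF f(1)]] by (auto simp: mult.commute)
  show ?thesis
    unfolding has_derivative_at_alt
  proof (intro conjI allI impI)
    show "bounded_linear (\<lambda>h. f' h *\<^sub>R g x)"
      using has_derivative_bounded_linear[OF f(1)] by (rule bounded_linear_scaleR_left[THEN bounded_linear_compose])
    fix e :: real assume e: "e > 0"
    define N where "N = norm (g x) + 1"
    have N: "N > 0" by (simp add: N_def add_nonneg_pos)
    have e1: "e / (2 * N) > 0" "min 1 (e / (2 * M)) > 0" using e N M by auto
    obtain d1 where d1: "d1 > 0"
      "\<And>y. norm (y - x) < d1 \<Longrightarrow> norm (f y - f x - f' (y - x)) \<le> e / (2 * N) * norm (y - x)"
      using f(1) e1(1) unfolding has_derivative_at_alt by blast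
    obtain d2 where d2: "d2 > 0" "\<And>y. norm (y - x) < d2 \<Longrightarrow> norm (g y - g x) < min 1 (e / (2 * M))"
      using g e1(2) unfolding continuous_at_eps_delta dist_norm by metis
    show "\<exists>d>0. \<forall>y. norm (y - x) < d \<longrightarrow>
      norm (f y *\<^sub>R g y - f x *\<^sub>R g x - f' (y - x) *\<^sub>R g x) \<le> e * norm (y - x)"
    proof (intro exI[of _ "min d1 d2"] conjI allI impI)
      show "min d1 d2 > 0" using d1 d2 by simp
      fix y assume y: "norm (y - x) < min d1 d2"
      have gy: "norm (g y) \<le> N" "norm (g y - g x) \<le> e / (2 * M)"
        using d2(2)[of y] y norm_triangle_ineq2[of "g y" "g x"] by (auto simp: N_def)
      have "f y *\<^sub>R g y - f x *\<^sub>R g x - f' (y - x) *\<^sub>R g x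
          = (f y - f x - f' (y - x)) *\<^sub>R g y + f' (y - x) *\<^sub>R (g y - g x)"
        using f(2) by (simp add: algebra_simps)
      also have "norm \<dots> \<le> norm (f y - f x - f' (y - x)) * norm (g y) + norm (f' (y - x)) * norm (g y - g x)"
        by (rule order_trans[OF norm_triangle_ineq]) simp
      also have "\<dots> \<le> (e / (2 * N) * norm (y - x)) * N + (M * norm (y - x)) * (e / (2 * M))"
        using d1(2)[of y] y M gy e N by (intro add_mono mult_mono) auto
      also have "\<dots> = e * norm (y - x)" using M(1) N by (simp add: field_simps)
      finally show "norm (f y *\<^sub>R g y - f x *\<^sub>R g x - f' (y - x) *\<^sub>R g x) \<le> e * norm (y - x)" .
    qed
  qed
qed

text \<open>A uniform lower bound for \<open>L\<close> gives continuity of \<open>R\<close>. The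
  formula DR = -R (DL) R then expresses the derivative through \<open>R\<close> and the smooth
  family \<open>L\<close> alone, so each order of regularity yields the next.\<close>

lemma smooth_on_inverse_operator:
  fixes L R :: "'a::euclidean_space \<Rightarrow> 'a \<Rightarrow> 'a"
  assumes S: "open S" and lin: "\<And>x. x \<in> S \<Longrightarrow> linear (L x)"
    and sm: "\<And>v. smooth_on S (\<lambda>x. L x v)"
    and LR: "\<And>x v. x \<in> S \<Longrightarrow> L x (R x v) = v" and RL: "\<And>x v. x \<in> S \<Longrightarrow> R x (L x v) = v"
  shows "smooth_on S (\<lambda>x. R x v)"
proof -
  have Rlin: "linear (R x)" if "x \<in> S" for x
    using that LR RL linear_add[OF lin[OF that]] linear_scale[OF lin[OF that]]
    by (intro linearI) metis+
  have cont: "isCont (\<lambda>x. R x v) x0" if x0: "x0 \<in> S" for x0 v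
  proof -
    have "inj (L x0)" using RL[OF x0] by (metis injI)
    then obtain T k where T: "open T" "x0 \<in> T" "T \<subseteq> S" "k > 0" "\<And>x w. x \<in> T \<Longrightarrow> norm w \<le> k * norm (L x w)"
      using operator_family_bounded_below[OF S x0 lin smooth_on_continuous[OF sm]] by metis
    have "isCont (\<lambda>x. L x (R x0 v)) x0"
      using smooth_on_continuous[OF sm] S x0 continuous_on_eq_continuous_at by blast
    then have "((\<lambda>x. k * norm (v - L x (R x0 v))) \<longlongrightarrow> k * norm (v - L x0 (R x0 v))) (at x0)"
      unfolding isCont_def by (intro tendsto_intros)
    then have "((\<lambda>x. k * norm (v - L x (R x0 v))) \<longlongrightarrow> 0) (at x0)" using LR[OF x0] by simp
    moreover have "\<forall>\<^sub>F x in at x0. norm (R x v - R x0 v) \<le> k * norm (v - L x (R x0 v))"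
      using eventually_at_in_open'[OF T(1,2)]
    proof eventually_elim
      case (elim x)
      then show ?case
        using T(3) T(5)[OF elim, of "R x v - R x0 v"] LR linear_diff[OF lin] by (metis subsetD)
    qed
    ultimately have "((\<lambda>x. R x v - R x0 v) \<longlongrightarrow> 0) (at x0)"
      by (rule Lim_null_comparison[rotated])
    then show ?thesis unfolding isCont_def by (simp add: LIM_zero_iff)
  qed
  \<comment> \<open>This is -R (DL h) R v, expanded twice in the basis so that only \<open>R\<close>
    and the derivative of \<open>L\<close> on fixed vectors occur.\<close>
  define D where "D = (\<lambda>x v h. (-1) *\<^sub>R (\<Sum>b\<in>Basis. ((\<Sum>c\<in>Basis. (R x v \<bullet> c) *\<^sub>R fd (\<lambda>y. L y c) x h) \<bullet> b) *\<^sub>R R x b))"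
  have der: "((\<lambda>x. R x v) has_derivative D x v) (at x)" if x: "x \<in> S" for x v
  proof -
    \<comment> \<open>\<open>F y\<close> is \<open>L y - L x\<close> applied to
      \<open>R x v\<close>. It vanishes at \<open>x\<close> and satisfies
      \<open>R y v = R x v - R y (F y)\<close>, so continuity of \<open>R\<close> suffices for the
      derivative.\<close>
    define F where "F = (\<lambda>y. L y (R x v) - v)"
    have "((\<lambda>y. L y (R x v)) has_derivative fd (\<lambda>y. L y (R x v)) x) (at x)" by (rule smooth_on_works[OF sm x])
    then have Fd: "(F has_derivative fd (\<lambda>y. L y (R x v)) x) (at x)"
      unfolding F_def by (auto intro!: derivative_eq_intros)
    have "((\<lambda>y. (F y \<bullet> b) *\<^sub>R R y b) has_derivative (\<lambda>h. (fd (\<lambda>y. L y (R x v)) x h \<bullet> b) *\<^sub>R R x b)) (at x)" for b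
      using LR[OF x] by (intro has_derivative_scaleR_vanishing has_derivative_inner_left Fd cont[OF x]) (simp add: F_def)
    then have "((\<lambda>y. R x v - (\<Sum>b\<in>Basis. (F y \<bullet> b) *\<^sub>R R y b)) has_derivative
        (\<lambda>h. 0 - (\<Sum>b\<in>Basis. (fd (\<lambda>y. L y (R x v)) x h \<bullet> b) *\<^sub>R R x b))) (at x)"
      by (intro has_derivative_diff has_derivative_const has_derivative_sum)
    moreover have "0 - (\<Sum>b\<in>Basis. (fd (\<lambda>y. L y (R x v)) x h \<bullet> b) *\<^sub>R R x b) = D x v h" for h
    proof -
      have "fd (\<lambda>y. L y (R x v)) x h = (\<Sum>c\<in>Basis. (R x v \<bullet> c) *\<^sub>R fd (\<lambda>y. L y c) x h)"
        by (rule fd_linear_param[OF S x lin sm])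
      then show ?thesis unfolding D_def by simp
    qed
    moreover have "R x v - (\<Sum>b\<in>Basis. (F y \<bullet> b) *\<^sub>R R y b) = R y v" if y: "y \<in> S" for y
    proof -
      have "(\<Sum>b\<in>Basis. (F y \<bullet> b) *\<^sub>R R y b) = R y (F y)" by (rule linear_expand[OF Rlin[OF y], symmetric])
      also have "\<dots> = R x v - R y v" unfolding F_def by (simp add: linear_diff[OF Rlin[OF y]] RL[OF y])
      finally show ?thesis by simp
    qed
    ultimately show ?thesis
      using has_derivative_transform_within_open[OF _ S x] by (metis (no_types, lifting) ext)
  qed
  have "\<forall>v. C_k_on k (\<lambda>x. R x v) S" for k
  proof (induction k)
    case 0
    then show ?case using cont S by (auto simp: continuous_on_eq_continuous_at)
  next
    case (Suc k)
    have sm1: "C_k_on k (\<lambda>x. fd (\<lambda>y. L y c) x h) S" for c h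
      using smooth_on_fd[OF sm] unfolding smooth_on_def by blast
    have "C_k_on k (\<lambda>x. D x v h) S" for v h
      unfolding D_def using Suc sm1 S
      by (intro C_k_on_scaleR C_k_on_sum C_k_on_inner C_k_on_const) auto
    then have "C_k_on k (\<lambda>x. fd (\<lambda>x. R x v) x h) S" for v h
      using C_k_on_cong[OF S, of "\<lambda>x. D x v h"] fd_eq[OF der] by fastforce
    then show ?case using differentiableI[OF der] by auto
  qed
  then show ?thesis by (simp add: smooth_on_def)
qed

section \<open>The kernel of a closed two-form\<close>

lemma orthogonal_projection_onto_subspace:
  fixes E :: "'a::euclidean_space set"
  assumes "subspace E"
  obtains P where "linear P" "\<And>v. P v \<in> E" "\<And>v. v \<in> E \<Longrightarrow> P v = v"
    "\<And>v. (\<And>e. e \<in> E \<Longrightarrow> v \<bullet> e = 0) \<Longrightarrow> P v = 0"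
proof -
  obtain B where B: "B \<subseteq> E" "pairwise orthogonal B" "\<And>x. x \<in> B \<Longrightarrow> norm x = 1" "independent B" "span B = E"
    using orthonormal_basis_subspace[OF assms] by metis
  have fin: "finite B" using B(4) independent_imp_finite by blast
  define P where "P = (\<lambda>v. \<Sum>b\<in>B. (v \<bullet> b) *\<^sub>R b)"
  have lin: "linear P"
    unfolding P_def by (rule linearI) (simp_all add: inner_add_left scaleR_add_left sum.distrib scaleR_sum_right)
  have PE: "P v \<in> E" for v
    unfolding P_def using B(1) assms by (intro subspace_sum subspace_scale) auto
  have Pb: "P b = b" if b: "b \<in> B" for b
  proof -
    have "P b = (\<Sum>c\<in>B. if c = b then b else 0)"
      unfolding P_def using B(2,3) b
      by (intro sum.cong) (auto simp: pairwise_def orthogonal_def norm_eq_1 inner_commute)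
    then show ?thesis using fin b by simp
  qed
  have Pe: "P v = v" if "v \<in> E" for v
    using linear_eq_on_span[OF lin linear_ident Pb] that B(5) by blast
  show ?thesis
    by (rule that[OF lin PE Pe]) (use B(1) in \<open>auto simp: P_def subset_iff\<close>)
qed

definition form_kernel :: "('a \<Rightarrow> 'a \<Rightarrow> real) \<Rightarrow> 'a set" where
  "form_kernel \<omega> = {v. \<forall>w. \<omega> v w = 0}"

text \<open>The cyclic sum is the exterior derivative evaluated on \<open>a\<close>,
  \<open>b\<close>, \<open>c\<close>. These are constant vector fields, which commute, so the
  bracket terms of the invariant formula are absent.\<close>

definition closed_two_form_on :: "'a::euclidean_space set \<Rightarrow> ('a \<Rightarrow> 'a \<Rightarrow> 'a \<Rightarrow> real) \<Rightarrow> bool" where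
  "closed_two_form_on S \<omega> \<longleftrightarrow>
     (\<forall>x\<in>S. bilinear (\<omega> x) \<and> (\<forall>a b. \<omega> x a b = - \<omega> x b a)) \<and>
     (\<forall>a b. smooth_on S (\<lambda>x. \<omega> x a b)) \<and>
     (\<forall>x\<in>S. \<forall>a b c. fd (\<lambda>y. \<omega> y b c) x a + fd (\<lambda>y. \<omega> y c a) x b + fd (\<lambda>y. \<omega> y a b) x c = 0)"

lemma bilinear_linear: "bilinear h \<Longrightarrow> linear (\<lambda>x. h x y)" "bilinear h \<Longrightarrow> linear (h x)"
  by (auto simp: bilinear_def)

lemma subspace_form_kernel: "bilinear \<omega> \<Longrightarrow> subspace (form_kernel \<omega>)"
  by (auto simp: subspace_def form_kernel_def bilinear_ladd bilinear_lmul bilinear_lzero)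

text \<open>$L_x = P + (1 - P)\Omega_x$, with $P$ the orthogonal projection onto the kernel $E$ at $x_0$
  and $\Omega_x$ the skew operator of the form, is invertible at $x_0$; counting dimensions, the
  kernel at a nearby $x$ is $L_x^{-1} E$.\<close>

lemma form_kernel_frame:
  fixes \<omega> :: "'a::euclidean_space \<Rightarrow> 'a \<Rightarrow> 'a \<Rightarrow> real"
  assumes S: "open S" "x0 \<in> S" and cl: "closed_two_form_on S \<omega>"
    and dim: "\<And>x. x \<in> S \<Longrightarrow> dim (form_kernel (\<omega> x)) = k"
  obtains T P B where "open T" "x0 \<in> T" "T \<subseteq> S" "linear P" "\<And>v. P (P v) = P v"
    "\<And>x. x \<in> T \<Longrightarrow> linear (B x)" "\<And>v. smooth_on T (\<lambda>x. B x v)"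
    "\<And>x v. x \<in> T \<Longrightarrow> P (B x v) = P v" "\<And>x v. B x (P v) = B x v"
    "\<And>x v. x \<in> T \<Longrightarrow> v \<in> form_kernel (\<omega> x) \<longleftrightarrow> B x v = v"
    "\<And>x v. x \<in> T \<Longrightarrow> B x v \<in> form_kernel (\<omega> x)"
proof -
  have bil: "bilinear (\<omega> x)" and skew: "\<omega> x a b = - \<omega> x b a" if "x \<in> S" for x a b
    using cl that unfolding closed_two_form_on_def by blast+
  have sm: "smooth_on S (\<lambda>x. \<omega> x a b)" for a b using cl unfolding closed_two_form_on_def by blast
  define E where "E = form_kernel (\<omega> x0)"
  have sE: "subspace E" unfolding E_def by (rule subspace_form_kernel[OF bil[OF S(2)]])
  obtain P where P: "linear P" "\<And>v. P v \<in> E" "\<And>v. v \<in> E \<Longrightarrow> P v = v"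
    "\<And>v. (\<And>e. e \<in> E \<Longrightarrow> v \<bullet> e = 0) \<Longrightarrow> P v = 0"
    using orthogonal_projection_onto_subspace[OF sE] by blast
  have PP: "P (P v) = P v" for v using P by blast
  define \<Omega> where "\<Omega> = (\<lambda>x v. \<Sum>b\<in>Basis. \<omega> x v b *\<^sub>R b)"
  have \<Omega>: "\<omega> x v w = \<Omega> x v \<bullet> w" if "x \<in> S" for x v w
  proof -
    have "\<omega> x v w = (\<Sum>b\<in>Basis. (w \<bullet> b) *\<^sub>R \<omega> x v b)"
      by (rule linear_expand[OF bilinear_linear(2)[OF bil[OF that]]])
    then show ?thesis by (simp add: \<Omega>_def inner_sum_left inner_commute[of w] mult.commute)
  qed
  have ker: "v \<in> form_kernel (\<omega> x) \<longleftrightarrow> \<Omega> x v = 0" if "x \<in> S" for x v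
    using \<Omega>[OF that, of v] inner_eq_zero_iff[of "\<Omega> x v"] by (auto simp: form_kernel_def)
  have \<Omega>lin: "linear (\<Omega> x)" if "x \<in> S" for x
    using bil[OF that] unfolding \<Omega>_def
    by (intro linearI) (simp_all add: bilinear_ladd bilinear_lmul scaleR_add_left sum.distrib scaleR_sum_right)
  define L where "L = (\<lambda>x v. P v + (\<Omega> x v - P (\<Omega> x v)))"
  have Llin: "linear (L x)" if "x \<in> S" for x
    unfolding L_def
    by (intro linear_compose_add linear_compose_sub P(1) \<Omega>lin that
        linear_compose[OF \<Omega>lin P(1), unfolded o_def])
  have PL: "P (L x v) = P v" for x v by (simp add: L_def linear_add[OF P(1)] linear_diff[OF P(1)] PP)
  have Lsm: "smooth_on S (\<lambda>x. L x v)" for v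
  proof -
    have 1: "smooth_on S (\<lambda>x. \<Omega> x v)"
      unfolding \<Omega>_def by (intro smooth_on_sum smooth_on_scaleR smooth_on_const sm S)
    have "bounded_linear P" using P(1) by (simp add: linear_linear)
    from smooth_on_linear_compose[OF S(1) 1 this] show ?thesis
      unfolding L_def by (intro smooth_on_add smooth_on_minus smooth_on_const S 1)
  qed
  have inj0: "inj (L x0)"
  proof (rule linear_injective_0[OF Llin[OF S(2)], THEN iffD2], intro allI impI)
    fix w assume "L x0 w = 0"
    then have Pw: "P w = 0" using PL[of x0 w] linear_0[OF P(1)] by simp
    \<comment> \<open>By skewness the range of \<open>\<Omega> x0\<close> is orthogonal to the
      kernel \<open>E\<close>, and \<open>P\<close> annihilates the orthogonal complement of
      \<open>E\<close>.\<close>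
    have "P (\<Omega> x0 w) = 0"
    proof (rule P(4))
      fix e assume "e \<in> E"
      then have "\<omega> x0 e w = 0" by (simp add: E_def form_kernel_def)
      then show "\<Omega> x0 w \<bullet> e = 0" using \<Omega>[OF S(2), of w e] skew[OF S(2), of w e] by simp
    qed
    then have "\<Omega> x0 w = 0" using \<open>L x0 w = 0\<close> Pw by (simp add: L_def)
    then have "w \<in> E" using ker[OF S(2)] by (simp add: E_def)
    then show "w = 0" using P(3) Pw by simp
  qed
  obtain T c where T: "open T" "x0 \<in> T" "T \<subseteq> S" "c > 0" "\<And>x w. x \<in> T \<Longrightarrow> norm w \<le> c * norm (L x w)"
    using operator_family_bounded_below[OF S Llin smooth_on_continuous[OF Lsm] inj0] by blast
  have inj: "inj (L x)" if "x \<in> T" for x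
  proof (rule linear_injective_0[OF Llin, THEN iffD2])
    show "x \<in> S" using T that by auto
    show "\<forall>w. L x w = 0 \<longrightarrow> w = 0"
    proof (intro allI impI)
      fix w assume "L x w = 0"
      then show "w = 0" using T(5)[OF that, of w] by simp
    qed
  qed
  define R where "R = (\<lambda>x. inv (L x))"
  have RL: "R x (L x v) = v" if "x \<in> T" for x v using inj[OF that] by (simp add: R_def)
  have LR: "L x (R x v) = v" if "x \<in> T" for x v
  proof -
    have "surj (L x)" using linear_inj_imp_surj[OF Llin inj[OF that]] T that by blast
    then show ?thesis by (simp add: R_def surj_f_inv_f)
  qed
  have LlinT: "linear (L x)" if "x \<in> T" for x using Llin T that by blast
  have Rlin: "linear (R x)" if "x \<in> T" for x
    using that LR RL linear_add[OF LlinT[OF that]] linear_scale[OF LlinT[OF that]]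
    by (intro linearI) metis+
  have Rsm: "smooth_on T (\<lambda>x. R x v)" for v
    by (rule smooth_on_inverse_operator[OF T(1) LlinT smooth_on_subset[OF Lsm T(3)] LR RL])
  \<comment> \<open>On the kernel at \<open>x\<close> the operator \<open>L x\<close> reduces to
    \<open>P\<close>, so \<open>R x (P v)\<close> recovers a kernel vector \<open>v\<close> from its
    projection.\<close>
  define B where "B = (\<lambda>x v. R x (P v))"
  have kerB: "B x v = v" if x: "x \<in> T" and v: "v \<in> form_kernel (\<omega> x)" for x v
  proof -
    have "\<Omega> x v = 0" using ker v x T by blast
    then have "L x v = P v" by (simp add: L_def linear_0[OF P(1)])
    then show ?thesis using RL[OF x, of v] by (simp add: B_def)
  qed
  have Bker: "B x v \<in> form_kernel (\<omega> x)" if x: "x \<in> T" for x v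
  proof -
    have xS: "x \<in> S" using x T by blast
    have "form_kernel (\<omega> x) \<subseteq> R x ` E" using kerB[OF x] P(2) unfolding B_def by (metis image_eqI subsetI)
    moreover have "dim (R x ` E) \<le> dim (form_kernel (\<omega> x))"
      using dim_image_le[OF Rlin[OF x], of E] dim[OF xS] dim[OF S(2)] by (simp add: E_def)
    ultimately have "form_kernel (\<omega> x) = R x ` E"
      by (intro subspace_dim_equal subspace_form_kernel bil xS linear_subspace_image Rlin x sE)
    then show ?thesis using P(2) by (simp add: B_def)
  qed
  show ?thesis
  proof (rule that[OF T(1-3) P(1) PP])
    show "linear (B x)" if "x \<in> T" for x
      unfolding B_def using linear_compose[OF P(1) Rlin[OF that]] by (simp add: o_def)
    show "smooth_on T (\<lambda>x. B x v)" for v unfolding B_def by (rule Rsm)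
    show "P (B x v) = P v" if "x \<in> T" for x v
      using PL[of x "B x v"] LR[OF that, of "P v"] PP by (simp add: B_def)
    show "v \<in> form_kernel (\<omega> x) \<longleftrightarrow> B x v = v" if "x \<in> T" for x v
      using kerB[OF that] Bker[OF that] by metis
  qed (use Bker PP in \<open>auto simp: B_def\<close>)
qed

text \<open>Leibniz rule for the identity \<open>\<omega> y (X y) c = 0\<close>: the derivative of
  the form with frozen argument \<open>X x\<close> cancels the term in which the field is
  differentiated.\<close>

lemma fd_two_form_kernel_field:
  fixes \<omega> :: "'a::euclidean_space \<Rightarrow> 'a \<Rightarrow> 'a \<Rightarrow> real"
  assumes S: "open S" "x \<in> S" and bil: "\<And>x. x \<in> S \<Longrightarrow> bilinear (\<omega> x)"
    and sm: "\<And>a b. smooth_on S (\<lambda>x. \<omega> x a b)" and X: "smooth_on S X"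
    and ker: "\<And>y. y \<in> S \<Longrightarrow> X y \<in> form_kernel (\<omega> y)"
  shows "fd (\<lambda>y. \<omega> y (X x) c) x a = - \<omega> x (fd X x a) c"
proof -
  have lin: "linear (\<lambda>b. \<omega> y b c)" if "y \<in> S" for y by (rule bilinear_linear(1)[OF bil[OF that]])
  have 1: "((\<lambda>y. \<Sum>b\<in>Basis. (X y \<bullet> b) *\<^sub>R \<omega> y b c) has_derivative
      (\<lambda>h. \<Sum>b\<in>Basis. (X x \<bullet> b) *\<^sub>R fd (\<lambda>y. \<omega> y b c) x h + (fd X x h \<bullet> b) *\<^sub>R \<omega> x b c)) (at x)"
    by (intro has_derivative_sum has_derivative_scaleR has_derivative_inner_left smooth_on_works[OF X S(2)]
        smooth_on_works[OF sm S(2)])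
  have 2: "(\<Sum>b\<in>Basis. (X y \<bullet> b) *\<^sub>R \<omega> y b c) = 0" if "y \<in> S" for y
    using ker[OF that] unfolding linear_expand[OF lin[OF that], symmetric] by (simp add: form_kernel_def)
  have "((\<lambda>y. 0) has_derivative
      (\<lambda>h. \<Sum>b\<in>Basis. (X x \<bullet> b) *\<^sub>R fd (\<lambda>y. \<omega> y b c) x h + (fd X x h \<bullet> b) *\<^sub>R \<omega> x b c)) (at x)"
    by (rule has_derivative_transform_within_open[OF 1 S 2])
  from fd_eq[OF this] have "0 = (\<Sum>b\<in>Basis. (X x \<bullet> b) *\<^sub>R fd (\<lambda>y. \<omega> y b c) x a + (fd X x a \<bullet> b) *\<^sub>R \<omega> x b c)"
    by (simp add: fun_eq_iff)
  also have "\<dots> = fd (\<lambda>y. \<omega> y (X x) c) x a + \<omega> x (fd X x a) c"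
    unfolding sum.distrib
    by (intro arg_cong2[where f = "(+)"] fd_linear_param[OF S, of "\<lambda>y b. \<omega> y b c", OF lin sm, symmetric]
        linear_expand[OF lin[OF S(2)], symmetric])
  finally show ?thesis by simp
qed

text \<open>Let \<open>u\<close> be the difference of the two sides, a bracket of kernel fields.
  Closedness puts \<open>u\<close> into the kernel, so \<open>u = B x u = B x (P u)\<close>. Since
  \<open>P (B y v) = P v\<close> does not depend on \<open>y\<close>, differentiating gives
  \<open>P u = 0\<close>.\<close>

lemma kernel_fields_commute:
  fixes \<omega> :: "'a::euclidean_space \<Rightarrow> 'a \<Rightarrow> 'a \<Rightarrow> real"
  assumes T: "open T" and cl: "closed_two_form_on T \<omega>"
    and P: "linear P" and lin: "\<And>x. x \<in> T \<Longrightarrow> linear (B x)" and sm: "\<And>v. smooth_on T (\<lambda>x. B x v)"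
    and PB: "\<And>x v. x \<in> T \<Longrightarrow> P (B x v) = P v" and BP: "\<And>x v. B x (P v) = B x v"
    and ker: "\<And>x v. x \<in> T \<Longrightarrow> v \<in> form_kernel (\<omega> x) \<longleftrightarrow> B x v = v"
    and Bker: "\<And>x v. x \<in> T \<Longrightarrow> B x v \<in> form_kernel (\<omega> x)"
    and x: "x \<in> T"
  shows "fd (\<lambda>y. B y w) x (B x v) = fd (\<lambda>y. B y v) x (B x w)"
proof -
  have bil: "bilinear (\<omega> x)" and skew: "\<omega> x a b = - \<omega> x b a" if "x \<in> T" for x a b
    using cl that unfolding closed_two_form_on_def by blast+
  have sm\<omega>: "smooth_on T (\<lambda>x. \<omega> x a b)" for a b using cl unfolding closed_two_form_on_def by blast
  define u where "u = fd (\<lambda>y. B y w) x (B x v) - fd (\<lambda>y. B y v) x (B x w)"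
  have K: "fd (\<lambda>y. \<omega> y (B x v) c) x a = - \<omega> x (fd (\<lambda>y. B y v) x a) c" for v c a
    by (rule fd_two_form_kernel_field[OF T x bil sm\<omega> sm Bker])
  have sk: "fd (\<lambda>y. \<omega> y c b) x a = - fd (\<lambda>y. \<omega> y b c) x a" for a b c
  proof -
    have "fd (\<lambda>y. \<omega> y c b) x = fd (\<lambda>y. - \<omega> y b c) x" by (rule fd_cong[OF T x]) (rule skew)
    also have "\<dots> = (\<lambda>h. - fd (\<lambda>y. \<omega> y b c) x h)"
      by (intro fd_eq has_derivative_minus smooth_on_works[OF sm\<omega> x])
    finally show ?thesis by simp
  qed
  have "\<omega> x u c = 0" for c
  proof -
    have "fd (\<lambda>y. \<omega> y (B x v) c) x (B x w) + fd (\<lambda>y. \<omega> y c (B x w)) x (B x v)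
        + fd (\<lambda>y. \<omega> y (B x w) (B x v)) x c = 0"
      using cl x unfolding closed_two_form_on_def by blast
    \<comment> \<open>By \<open>K\<close> this is, up to sign, the third term of the cyclic sum; it
      vanishes because \<open>B x v\<close> lies in the kernel.\<close>
    moreover have "\<omega> x (fd (\<lambda>y. B y w) x c) (B x v) = 0"
      using Bker[OF x, of v] skew[OF x, of _ "B x v"] by (simp add: form_kernel_def)
    ultimately have "\<omega> x (fd (\<lambda>y. B y w) x (B x v)) c - \<omega> x (fd (\<lambda>y. B y v) x (B x w)) c = 0"
      unfolding sk[of c "B x w"] K by simp
    then show ?thesis unfolding u_def bilinear_lsub[OF bil[OF x]] .
  qed
  then have "u \<in> form_kernel (\<omega> x)" by (simp add: form_kernel_def)
  then have Bu: "B x u = u" using ker[OF x] by blast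
  have "P (fd (\<lambda>y. B y v) x a) = 0" for v a
  proof -
    have "((\<lambda>y. P (B y v)) has_derivative (\<lambda>h. P (fd (\<lambda>y. B y v) x h))) (at x)"
      using P by (intro bounded_linear.has_derivative[OF _ smooth_on_works[OF sm x]]) (simp add: linear_linear)
    then have "((\<lambda>y. P v) has_derivative (\<lambda>h. P (fd (\<lambda>y. B y v) x h))) (at x)"
      by (rule has_derivative_transform_within_open[OF _ T x]) (rule PB)
    from fd_eq[OF this] show ?thesis by (simp add: fun_eq_iff)
  qed
  then have "P u = 0" by (simp add: u_def linear_diff[OF P])
  have "u = B x (P u)" unfolding BP Bu ..
  also have "\<dots> = 0" unfolding \<open>P u = 0\<close> by (rule linear_0[OF lin[OF x]])
  finally show ?thesis by (simp add: u_def)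
qed

text \<open>Only the leaf through $x_0$ is straightened.\<close>

theorem flat_coordinates_form_kernel:
  fixes \<omega> :: "'a::euclidean_space \<Rightarrow> 'a \<Rightarrow> 'a \<Rightarrow> real"
  assumes S: "open S" "x0 \<in> S" and cl: "closed_two_form_on S \<omega>"
    and dim: "\<And>x. x \<in> S \<Longrightarrow> dim (form_kernel (\<omega> x)) = k"
  obtains W V E :: "'a set" and \<psi> \<theta> :: "'a \<Rightarrow> 'a" where "open W" "x0 \<in> W" "W \<subseteq> S" "open V" "\<psi> ` W \<subseteq> V" "\<theta> ` V \<subseteq> W"
    "\<And>x. x \<in> W \<Longrightarrow> \<theta> (\<psi> x) = x" "\<And>z. z \<in> V \<Longrightarrow> \<psi> (\<theta> z) = z"
    "smooth_on W \<psi>" "smooth_on V \<theta>" "subspace E"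
    "\<And>x. x \<in> W \<Longrightarrow> \<psi> x - \<psi> x0 \<in> E \<Longrightarrow> form_kernel (\<omega> x) = {v. fd \<psi> x v \<in> E}"
proof -
  obtain T P B where T: "open T" "x0 \<in> T" "T \<subseteq> S" and P: "linear P" "\<And>v. P (P v) = P v"
    and B: "\<And>x. x \<in> T \<Longrightarrow> linear (B x)" "\<And>v. smooth_on T (\<lambda>x. B x v)"
    "\<And>x v. x \<in> T \<Longrightarrow> P (B x v) = P v" "\<And>x v. B x (P v) = B x v"
    "\<And>x v. x \<in> T \<Longrightarrow> v \<in> form_kernel (\<omega> x) \<longleftrightarrow> B x v = v"
    "\<And>x v. x \<in> T \<Longrightarrow> B x v \<in> form_kernel (\<omega> x)"
    using form_kernel_frame[OF S cl dim] by blast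
  have clT: "closed_two_form_on T \<omega>"
    using cl T(3) smooth_on_subset unfolding closed_two_form_on_def by blast
  have comm: "fd (\<lambda>y. B y w) x (B x v) = fd (\<lambda>y. B y v) x (B x w)" if "x \<in> T" for x v w
    by (rule kernel_fields_commute[OF T(1) clT P(1) B that])
  obtain r \<sigma> where \<sigma>: "r > 0" "\<sigma> 0 = x0" "\<sigma> ` ball 0 r \<subseteq> T" "smooth_on (ball 0 r) \<sigma>"
    "\<And>a v. a \<in> ball 0 r \<Longrightarrow> fd \<sigma> a v = B (\<sigma> a) v"
    using total_equation_solution[OF T(1,2) B(1,2) comm] by metis
  have bP: "bounded_linear P" using P(1) by (simp add: linear_linear)
  \<comment> \<open>The derivative of \<sigma> is \<open>B (\<sigma> a)\<close>, whose P-part is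
    that of its argument, so \<open>P (\<sigma> a) - P a\<close> is constant on the ball.\<close>
  have P\<sigma>: "P (\<sigma> a) = P x0 + P a" if a: "a \<in> ball 0 r" for a
  proof -
    have "((\<lambda>a. P (\<sigma> a) - P a) has_derivative (\<lambda>h. 0)) (at b within ball 0 r)" if b: "b \<in> ball 0 r" for b
    proof -
      have "((\<lambda>a. P (\<sigma> a) - P a) has_derivative (\<lambda>h. P (fd \<sigma> b h) - P h)) (at b)"
        by (intro has_derivative_diff bounded_linear.has_derivative[OF bP] smooth_on_works[OF \<sigma>(4) b]
            has_derivative_ident)
      moreover have "P (fd \<sigma> b h) - P h = 0" for h using \<sigma>(3,5) b B(3) by (simp add: image_subset_iff)
      ultimately show ?thesis using has_derivative_at_withinI by fastforce
    qed
    from has_derivative_zero_constant[OF convex_ball this]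
    obtain c where c: "\<And>b. b \<in> ball 0 r \<Longrightarrow> P (\<sigma> b) - P b = c" by metis
    from c[OF a] c[of 0] \<sigma>(1,2) linear_0[OF P(1)] show ?thesis by (simp add: algebra_simps)
  qed
  define O1 where "O1 = {a. P a \<in> ball 0 r}"
  have Pc: "continuous_on A P" for A using linear_continuous_on[OF bP] .
  have oO1: "open O1"
    using open_vimage[OF open_ball, OF Pc[of UNIV], of 0 r] by (simp add: O1_def vimage_def)
  \<comment> \<open>The leaf is a graph over the range of \<open>P\<close>: it consists of the
    points \<open>x0 + P a + u a\<close>, and \<open>u a\<close> has zero P-part by
    \<open>Pu\<close>.\<close>
  define u where "u = (\<lambda>a. \<sigma> (P a) - (x0 + P a))"
  have usm: "smooth_on O1 u"
  proof -
    have sP: "smooth_on O1 P" by (rule smooth_on_linear[OF bP])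
    have "smooth_on O1 (\<lambda>a. \<sigma> (P a))"
      by (rule smooth_on_compose[OF oO1 sP \<sigma>(4)]) (auto simp: O1_def)
    then show ?thesis unfolding u_def by (intro smooth_on_minus smooth_on_add smooth_on_const sP oO1)
  qed
  have Pu: "P (u a) = 0" if "a \<in> O1" for a
    using P\<sigma>[of "P a"] that P by (simp add: u_def O1_def linear_diff[OF P(1)] linear_add[OF P(1)])
  have uP: "u a = u b" if "P a = P b" for a b using that by (simp add: u_def)
  define sh where "sh = (\<lambda>x. x - x0)"
  have shsm: "smooth_on A sh" for A
    using smooth_on_minus[OF open_UNIV smooth_on_linear[OF bounded_linear_ident] smooth_on_const]
    unfolding sh_def by (rule smooth_on_subset) simp
  define G where "G = {x. sh x \<in> O1}"
  have oG: "open G"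
    using open_vimage[OF oO1 smooth_on_continuous[OF shsm]] by (simp add: G_def vimage_def)
  have idsm: "smooth_on G (\<lambda>x. x)" by (rule smooth_on_linear[OF bounded_linear_ident])
  have ush: "smooth_on G (\<lambda>x. u (sh x))"
    by (rule smooth_on_compose[OF oG shsm usm]) (auto simp: G_def)
  \<comment> \<open>A shear: \<open>u (sh x)\<close> depends only on the P-part of
    \<open>sh x\<close>, and subtracting it does not change that part. Hence adding it back is the
    inverse.\<close>
  define \<psi> where "\<psi> = (\<lambda>x. x - u (sh x))"
  define \<theta> where "\<theta> = (\<lambda>x. x + u (sh x))"
  have \<psi>sm: "smooth_on G \<psi>" unfolding \<psi>_def by (intro smooth_on_minus idsm ush oG)
  have \<theta>sm: "smooth_on G \<theta>" unfolding \<theta>_def by (intro smooth_on_add idsm ush oG)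
  have Psh: "P (sh (\<psi> x)) = P (sh x)" "P (sh (\<theta> x)) = P (sh x)" if "x \<in> G" for x
    using Pu[of "sh x"] that
    by (simp_all add: \<psi>_def \<theta>_def sh_def G_def linear_diff[OF P(1)] linear_add[OF P(1)])
  have GG: "\<psi> x \<in> G" "\<theta> x \<in> G" if "x \<in> G" for x
    using Psh[OF that] that by (simp_all add: G_def O1_def)
  have inv: "\<theta> (\<psi> x) = x" "\<psi> (\<theta> x) = x" if "x \<in> G" for x
    using uP[OF Psh(1)[OF that]] uP[OF Psh(2)[OF that]] by (simp_all add: \<theta>_def \<psi>_def)
  define W where "W = G \<inter> T"
  \<comment> \<open>\<open>\<theta>\<close> need not preserve \<open>T\<close>, the set on which
    \<open>B\<close> describes the kernel, so the target is cut down to the points that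
    \<open>\<theta>\<close> sends into \<open>T\<close>.\<close>
  define V where "V = G \<inter> \<theta> -` T"
  have x0G: "x0 \<in> G" using \<sigma>(1) linear_0[OF P(1)] by (simp add: G_def sh_def O1_def)
  have \<psi>x0: "\<psi> x0 = x0" using \<sigma>(2) linear_0[OF P(1)] by (simp add: \<psi>_def u_def sh_def)
  show ?thesis
  proof (rule that[of W V \<psi> \<theta> "range P"])
    show "open W" using oG T by (auto simp: W_def)
    show "x0 \<in> W" using x0G T by (simp add: W_def)
    show "W \<subseteq> S" using T by (auto simp: W_def)
    show "open V"
      unfolding V_def by (rule continuous_open_preimage[OF smooth_on_continuous[OF \<theta>sm] oG T(1)])
    show "\<psi> ` W \<subseteq> V" using GG inv by (auto simp: W_def V_def)
    show "\<theta> ` V \<subseteq> W" using GG by (auto simp: W_def V_def)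
    show "\<theta> (\<psi> x) = x" if "x \<in> W" for x using that inv by (simp add: W_def)
    show "\<psi> (\<theta> z) = z" if "z \<in> V" for z using that inv by (simp add: V_def)
    show "smooth_on W \<psi>" using smooth_on_subset[OF \<psi>sm] by (simp add: W_def)
    show "smooth_on V \<theta>" using smooth_on_subset[OF \<theta>sm] by (simp add: V_def)
    show "subspace (range P)" using P(1) linear_subspace_image subspace_UNIV by blast
    fix x assume x: "x \<in> W" and e: "\<psi> x - \<psi> x0 \<in> range P"
    have xG: "x \<in> G" and xT: "x \<in> T" using x by (auto simp: W_def)
    define a where "a = P (sh x)"
    have ab: "a \<in> ball 0 r" using xG by (simp add: G_def O1_def a_def)
    \<comment> \<open>The hypothesis \<open>e\<close> says that \<open>x\<close> lies on the leaf:
      once \<open>sh (\<psi> x)\<close> equals its own projection \<open>a\<close>, undoing the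
      shear gives \<open>x = \<sigma> a\<close>, where the derivative of \<sigma> is known.\<close>
    have "sh (\<psi> x) = a"
    proof -
      have "sh (\<psi> x) = P (sh (\<psi> x))" using e P(2) \<psi>x0 by (auto simp: sh_def)
      then show ?thesis using Psh(1)[OF xG] by (simp add: a_def)
    qed
    then have "x = x0 + a + u (sh x)" by (simp add: \<psi>_def sh_def algebra_simps)
    then have xs: "x = \<sigma> a" by (simp add: u_def a_def algebra_simps)
    have "(\<psi> has_derivative (\<lambda>v. v - (fd \<sigma> a (P v) - (0 + P v)))) (at x)"
    proof -
      have 1: "((\<lambda>x. P (sh x)) has_derivative P) (at x)"
        unfolding sh_def
        by (rule has_derivative_eq_rhs[OF bounded_linear.has_derivative[OF bP]])
          (auto intro!: derivative_eq_intros)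
      have "((\<lambda>x. \<sigma> (P (sh x))) has_derivative (\<lambda>v. fd \<sigma> a (P v))) (at x)"
        unfolding a_def
        by (rule has_derivative_compose[OF 1 smooth_on_works[OF \<sigma>(4)]]) (use ab in \<open>simp add: a_def\<close>)
      then show ?thesis unfolding \<psi>_def u_def
        by (intro has_derivative_diff has_derivative_add has_derivative_ident has_derivative_const 1)
    qed
    from fd_eq[OF this] have fd\<psi>: "fd \<psi> x v = v - B x v + P v" for v
      using \<sigma>(5)[OF ab] B(4) xs by simp
    \<comment> \<open>The derivative of \<psi> preserves P-parts, so it maps \<open>v\<close> into
      the range of \<open>P\<close> exactly when the result is \<open>P v\<close>, that is, when
      \<open>v - B x v = 0\<close>.\<close>
    have "fd \<psi> x v \<in> range P \<longleftrightarrow> B x v = v" for v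
    proof
      assume "fd \<psi> x v \<in> range P"
      then have "P (fd \<psi> x v) = fd \<psi> x v" using P(2) by auto
      moreover have "P (fd \<psi> x v) = P v"
        using B(3)[OF xT] P unfolding fd\<psi> by (simp add: linear_diff[OF P(1)] linear_add[OF P(1)])
      ultimately show "B x v = v" by (simp add: fd\<psi>)
    qed (simp add: fd\<psi>)
    then show "form_kernel (\<omega> x) = {v. fd \<psi> x v \<in> range P}" using B(5)[OF xT] by blast
  qed
qed

section \<open>Pulling back two-forms\<close>

lemma bilinear_expand:
  fixes h :: "'a::euclidean_space \<Rightarrow> 'b::euclidean_space \<Rightarrow> 'c::real_vector"
  assumes "bilinear h"
  shows "h v w = (\<Sum>i\<in>Basis. \<Sum>j\<in>Basis. (v \<bullet> i) *\<^sub>R (w \<bullet> j) *\<^sub>R h i j)"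
proof -
  have "h v w = (\<Sum>i\<in>Basis. (v \<bullet> i) *\<^sub>R h i w)"
    by (rule linear_expand[OF bilinear_linear(1)[OF assms]])
  also have "\<dots> = (\<Sum>i\<in>Basis. (v \<bullet> i) *\<^sub>R (\<Sum>j\<in>Basis. (w \<bullet> j) *\<^sub>R h i j))"
    by (intro sum.cong refl arg_cong[where f = "scaleR _"] linear_expand[OF bilinear_linear(2)[OF assms]])
  finally show ?thesis by (simp add: scaleR_sum_right)
qed

text \<open>The passage from constant arguments, for which smoothness of forms and metrics is
  stated, to arguments and a base point that move.\<close>

lemma smooth_on_bilinear_family:
  fixes \<Omega> :: "'b::euclidean_space \<Rightarrow> 'c::euclidean_space \<Rightarrow> 'd::euclidean_space \<Rightarrow> real"
    and F :: "'a::euclidean_space \<Rightarrow> 'b"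
  assumes S: "open S" and F: "smooth_on S F" "F ` S \<subseteq> T"
    and bil: "\<And>y. y \<in> T \<Longrightarrow> bilinear (\<Omega> y)" and sm: "\<And>a b. smooth_on T (\<lambda>y. \<Omega> y a b)"
    and X: "smooth_on S X" and Y: "smooth_on S Y"
  shows "smooth_on S (\<lambda>x. \<Omega> (F x) (X x) (Y x))"
proof (rule smooth_on_cong[OF S])
  show "(\<Sum>i\<in>Basis. \<Sum>j\<in>Basis. (X x \<bullet> i) *\<^sub>R (Y x \<bullet> j) *\<^sub>R \<Omega> (F x) i j) = \<Omega> (F x) (X x) (Y x)"
    if "x \<in> S" for x
    by (rule bilinear_expand[OF bil, symmetric]) (use that F(2) in auto)
  show "smooth_on S (\<lambda>x. \<Sum>i\<in>Basis. \<Sum>j\<in>Basis. (X x \<bullet> i) *\<^sub>R (Y x \<bullet> j) *\<^sub>R \<Omega> (F x) i j)"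
    by (intro smooth_on_sum smooth_on_scaleR smooth_on_inner smooth_on_const S X Y
        smooth_on_compose[OF S F(1) sm F(2)])
qed

lemma has_derivative_bilinear_family:
  fixes \<Omega> :: "'b::euclidean_space \<Rightarrow> 'c::euclidean_space \<Rightarrow> 'd::euclidean_space \<Rightarrow> real"
    and F :: "'a::euclidean_space \<Rightarrow> 'b"
  assumes S: "open S" and T: "open T" and F: "smooth_on S F" "F ` S \<subseteq> T"
    and bil: "\<And>y. y \<in> T \<Longrightarrow> bilinear (\<Omega> y)" and sm: "\<And>a b. smooth_on T (\<lambda>y. \<Omega> y a b)"
    and X: "smooth_on S X" and Y: "smooth_on S Y" and x: "x \<in> S"
  shows "((\<lambda>x. \<Omega> (F x) (X x) (Y x)) has_derivative
    (\<lambda>h. fd (\<lambda>y. \<Omega> y (X x) (Y x)) (F x) (fd F x h) + \<Omega> (F x) (fd X x h) (Y x) + \<Omega> (F x) (X x) (fd Y x h))) (at x)"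
proof -
  have Fx: "F x \<in> T" using F(2) x by auto
  define G where "G = (\<lambda>i j h. fd (\<lambda>y. \<Omega> y i j) (F x) (fd F x h))"
  have dG: "((\<lambda>x. \<Omega> (F x) i j) has_derivative G i j) (at x)" for i j
    unfolding G_def using has_derivative_compose[OF smooth_on_works[OF F(1) x] smooth_on_works[OF sm Fx]] .
  have "((\<lambda>x. \<Sum>i\<in>Basis. \<Sum>j\<in>Basis. (X x \<bullet> i) *\<^sub>R (Y x \<bullet> j) *\<^sub>R \<Omega> (F x) i j) has_derivative
     (\<lambda>h. \<Sum>i\<in>Basis. \<Sum>j\<in>Basis. (X x \<bullet> i) *\<^sub>R ((Y x \<bullet> j) *\<^sub>R G i j h + (fd Y x h \<bullet> j) *\<^sub>R \<Omega> (F x) i j)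
       + (fd X x h \<bullet> i) *\<^sub>R (Y x \<bullet> j) *\<^sub>R \<Omega> (F x) i j)) (at x)"
    by (intro has_derivative_sum has_derivative_scaleR has_derivative_inner_left dG
        smooth_on_works[OF X x] smooth_on_works[OF Y x])
  then have 1: "((\<lambda>x. \<Omega> (F x) (X x) (Y x)) has_derivative
     (\<lambda>h. \<Sum>i\<in>Basis. \<Sum>j\<in>Basis. (X x \<bullet> i) *\<^sub>R ((Y x \<bullet> j) *\<^sub>R G i j h + (fd Y x h \<bullet> j) *\<^sub>R \<Omega> (F x) i j)
       + (fd X x h \<bullet> i) *\<^sub>R (Y x \<bullet> j) *\<^sub>R \<Omega> (F x) i j)) (at x)"
    by (rule has_derivative_transform_within_open[OF _ S x])
      (rule bilinear_expand[OF bil, symmetric], use F(2) in auto)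
  have 2: "fd (\<lambda>y. \<Omega> y v w) (F x) (fd F x h) = (\<Sum>i\<in>Basis. \<Sum>j\<in>Basis. (v \<bullet> i) *\<^sub>R (w \<bullet> j) *\<^sub>R G i j h)"
    for v w h
  proof -
    have "fd (\<lambda>y. \<Omega> y v w) (F x) = fd (\<lambda>y. \<Sum>i\<in>Basis. \<Sum>j\<in>Basis. (v \<bullet> i) *\<^sub>R (w \<bullet> j) *\<^sub>R \<Omega> y i j) (F x)"
      by (rule fd_cong[OF T Fx]) (rule bilinear_expand[OF bil])
    also have "\<dots> = (\<lambda>h. \<Sum>i\<in>Basis. \<Sum>j\<in>Basis. (v \<bullet> i) *\<^sub>R (w \<bullet> j) *\<^sub>R fd (\<lambda>y. \<Omega> y i j) (F x) h)"
      by (rule fd_eq) (intro has_derivative_sum has_derivative_scaleR_right smooth_on_works[OF sm Fx])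
    finally show ?thesis by (simp add: G_def)
  qed
  show ?thesis
  proof (rule has_derivative_eq_rhs[OF 1], rule ext)
    fix h
    show "(\<Sum>i\<in>Basis. \<Sum>j\<in>Basis. (X x \<bullet> i) *\<^sub>R ((Y x \<bullet> j) *\<^sub>R G i j h + (fd Y x h \<bullet> j) *\<^sub>R \<Omega> (F x) i j)
        + (fd X x h \<bullet> i) *\<^sub>R (Y x \<bullet> j) *\<^sub>R \<Omega> (F x) i j)
      = fd (\<lambda>y. \<Omega> y (X x) (Y x)) (F x) (fd F x h) + \<Omega> (F x) (fd X x h) (Y x) + \<Omega> (F x) (X x) (fd Y x h)"
      unfolding 2 bilinear_expand[OF bil[OF Fx], of "fd X x h"] bilinear_expand[OF bil[OF Fx], of "X x" "fd Y x h"]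
        sum.distrib[symmetric]
      by (intro sum.cong refl) (simp add: algebra_simps)
  qed
qed

text \<open>The second derivatives of \<open>F\<close> cancel in the cyclic sum, because they are
  symmetric and \<Omega> is skew. The identity \<open>cl\<close> is asked only for vectors in the
  image of \<open>fd F x\<close>: in the application it is available only for vectors orthogonal to
  \<xi>.\<close>

lemma pullback_closed:
  fixes \<Omega> :: "'b::euclidean_space \<Rightarrow> 'b \<Rightarrow> 'b \<Rightarrow> real" and F :: "'a::euclidean_space \<Rightarrow> 'b"
  assumes S: "open S" and T: "open T" and F: "smooth_on S F" "F ` S \<subseteq> T"
    and bil: "\<And>y. y \<in> T \<Longrightarrow> bilinear (\<Omega> y)" and sm: "\<And>a b. smooth_on T (\<lambda>y. \<Omega> y a b)"
    and x: "x \<in> S" and skew: "\<And>a b. \<Omega> (F x) a b = - \<Omega> (F x) b a"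
    and \<omega>: "\<omega> = (\<lambda>x a b. \<Omega> (F x) (fd F x a) (fd F x b))"
    and cl: "fd (\<lambda>y. \<Omega> y (fd F x b) (fd F x c)) (F x) (fd F x a)
      + fd (\<lambda>y. \<Omega> y (fd F x c) (fd F x a)) (F x) (fd F x b)
      + fd (\<lambda>y. \<Omega> y (fd F x a) (fd F x b)) (F x) (fd F x c) = 0"
  shows "fd (\<lambda>y. \<omega> y b c) x a + fd (\<lambda>y. \<omega> y c a) x b + fd (\<lambda>y. \<omega> y a b) x c = 0"
proof -
  have d: "fd (\<lambda>y. \<omega> y b c) x a = fd (\<lambda>y. \<Omega> y (fd F x b) (fd F x c)) (F x) (fd F x a)
      + \<Omega> (F x) (fd (\<lambda>y. fd F y b) x a) (fd F x c) + \<Omega> (F x) (fd F x b) (fd (\<lambda>y. fd F y c) x a)" for a b c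
    unfolding \<omega>
    using fd_eq[OF has_derivative_bilinear_family[OF S T F bil sm smooth_on_fd[OF F(1)] smooth_on_fd[OF F(1)] x]]
    by simp
  show ?thesis
    unfolding d
    using cl fd_fd_commute[OF S x F(1), of a b] fd_fd_commute[OF S x F(1), of b c]
      fd_fd_commute[OF S x F(1), of c a]
      skew[of "fd F x a"] skew[of "fd F x b"] skew[of "fd F x c"]
    by simp
qed

section \<open>Charts\<close>

lemma is_chartD:
  assumes "is_chart T c"
  shows "openin T (cdom c)" "cdom c \<subseteq> topspace T" "open (cmap c ` cdom c)" "inj_on (cmap c) (cdom c)"
    "continuous_map (subtopology T (cdom c)) euclidean (cmap c)"
proof -
  show op: "openin T (cdom c)" "open (cmap c ` cdom c)" using assms by (auto simp: is_chart_def)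
  show sub: "cdom c \<subseteq> topspace T" using op(1) by (rule openin_subset)
  have h: "homeomorphic_map (subtopology T (cdom c)) (top_of_set (cmap c ` cdom c)) (cmap c)"
    using assms by (simp add: is_chart_def)
  show "inj_on (cmap c) (cdom c)"
    using homeomorphic_imp_injective_map[OF h] sub by (simp add: topspace_subtopology Int_absorb1)
  show "continuous_map (subtopology T (cdom c)) euclidean (cmap c)"
    using homeomorphic_imp_continuous_map[OF h] continuous_map_into_fulltopology by blast
qed

lemma cinv_cmap: "is_chart T c \<Longrightarrow> q \<in> cdom c \<Longrightarrow> cinv c (cmap c q) = q"
  by (simp add: cinv_def is_chartD(4) inv_into_f_f)

lemma cmap_cinv: "x \<in> cmap c ` A \<Longrightarrow> A \<subseteq> cdom c \<Longrightarrow> cmap c (cinv c x) = x"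
  by (auto simp: cinv_def intro!: f_inv_into_f)

lemma cinv_in: "is_chart T c \<Longrightarrow> x \<in> cmap c ` A \<Longrightarrow> A \<subseteq> cdom c \<Longrightarrow> cinv c x \<in> A"
  using cinv_cmap by fastforce

lemma open_chart_image:
  assumes c: "is_chart T c" and U: "openin T U"
  shows "open (cmap c ` (cdom c \<inter> U))"
proof -
  have h: "homeomorphic_map (subtopology T (cdom c)) (top_of_set (cmap c ` cdom c)) (cmap c)"
    using c by (simp add: is_chart_def)
  have "openin (subtopology T (cdom c)) (cdom c \<inter> U)"
    using U by (simp add: openin_subtopology_Int2)
  then have "openin (top_of_set (cmap c ` cdom c)) (cmap c ` (cdom c \<inter> U))"
    using homeomorphic_imp_open_map[OF h] by (simp add: open_map_def)
  then show ?thesis using is_chartD(3)[OF c] openin_open_trans by blast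
qed

lemma openin_chart_preimage:
  assumes c: "is_chart T c" and W: "open W"
  shows "openin T {q \<in> cdom c. cmap c q \<in> W}"
proof -
  have "openin (subtopology T (cdom c)) {q \<in> topspace (subtopology T (cdom c)). cmap c q \<in> W}"
    by (rule openin_continuous_map_preimage[OF is_chartD(5)[OF c] iffD1[OF open_openin W]])
  then have "openin T {q \<in> topspace (subtopology T (cdom c)). cmap c q \<in> W}"
    using is_chartD(1)[OF c] openin_trans_full by blast
  then show ?thesis using is_chartD(2)[OF c] by (simp add: topspace_subtopology Int_absorb1)
qed

text \<open>The chain rule through a second chart. \<open>F\<close> may be another coordinate map or
  a map into a second manifold read in a chart, so this covers both changes of tangent coordinates
  and differentials.\<close>

lemma fd_change_chart:
  fixes c :: "('m, 'd::euclidean_space) chart" and d :: "('m, 'e::euclidean_space) chart"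
    and F :: "'m \<Rightarrow> 'b::real_normed_vector"
  assumes c: "is_chart T c" and d: "is_chart T d"
    and cd: "smooth_on (cmap c ` (cdom c \<inter> cdom d)) (cmap d \<circ> cinv c)"
    and q: "q \<in> cdom c" "q \<in> cdom d" and F: "(F \<circ> cinv d) differentiable (at (cmap d q))"
  shows "fd (F \<circ> cinv c) (cmap c q) v = fd (F \<circ> cinv d) (cmap d q) (fd (cmap d \<circ> cinv c) (cmap c q) v)"
proof -
  let ?U = "cmap c ` (cdom c \<inter> cdom d)"
  have oU: "open ?U" by (rule open_chart_image[OF c is_chartD(1)[OF d]])
  have qU: "cmap c q \<in> ?U" using q by auto
  have q': "(cmap d \<circ> cinv c) (cmap c q) = cmap d q" using cinv_cmap[OF c q(1)] by simp
  have "fd (F \<circ> cinv c) (cmap c q) v = fd (\<lambda>x. (F \<circ> cinv d) ((cmap d \<circ> cinv c) x)) (cmap c q) v"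
  proof (rule arg_cong[where f = "\<lambda>D. D v"], rule fd_cong[OF oU qU])
    fix y assume "y \<in> ?U"
    from cinv_in[OF c this] have "cinv c y \<in> cdom d" by simp
    then show "(F \<circ> cinv c) y = (F \<circ> cinv d) ((cmap d \<circ> cinv c) y)" using cinv_cmap[OF d] by simp
  qed
  also have "\<dots> = fd (F \<circ> cinv d) ((cmap d \<circ> cinv c) (cmap c q)) (fd (cmap d \<circ> cinv c) (cmap c q) v)"
    by (rule fd_compose[OF smooth_on_differentiable[OF cd qU]]) (subst q', rule F)
  also have "\<dots> = fd (F \<circ> cinv d) (cmap d q) (fd (cmap d \<circ> cinv c) (cmap c q) v)"
    by (subst q') (rule refl)
  finally show ?thesis .
qed

lemma fd_chart_self:
  assumes c: "is_chart T c" and q: "q \<in> cdom c"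
  shows "fd (cmap c \<circ> cinv c) (cmap c q) v = v"
proof -
  have "fd (cmap c \<circ> cinv c) (cmap c q) = fd (\<lambda>x. x) (cmap c q)"
    using q cmap_cinv[of _ c "cdom c"] by (intro fd_cong[OF is_chartD(3)[OF c]]) auto
  then show ?thesis by simp
qed

section \<open>Tangent vectors in the charts of an atlas\<close>

lemma chart_at_in:
  assumes "smooth_manifold M" "p \<in> points M"
  shows "chart_at M p \<in> atlas M" "p \<in> cdom (chart_at M p)"
proof -
  have "\<exists>c. c \<in> atlas M \<and> p \<in> cdom c" using assms unfolding smooth_manifold_def by blast
  from someI_ex[OF this] show "chart_at M p \<in> atlas M" "p \<in> cdom (chart_at M p)"
    by (auto simp: chart_at_def)
qed

lemma atlas_is_chart: "smooth_manifold M \<Longrightarrow> c \<in> atlas M \<Longrightarrow> is_chart (mtop M) c"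
  by (auto simp: smooth_manifold_def)

lemma atlas_points: "smooth_manifold M \<Longrightarrow> c \<in> atlas M \<Longrightarrow> q \<in> cdom c \<Longrightarrow> q \<in> points M"
  using is_chartD(2)[OF atlas_is_chart] by blast

lemma atlas_transition:
  assumes "smooth_manifold M" "c \<in> atlas M" "d \<in> atlas M"
  shows "smooth_on (cmap c ` (cdom c \<inter> cdom d)) (cmap d \<circ> cinv c)"
  using assms unfolding smooth_manifold_def smooth_compat_def by blast

lemma atlas_transition_differentiable:
  assumes "smooth_manifold M" "c \<in> atlas M" "d \<in> atlas M" "q \<in> cdom c" "q \<in> cdom d"
  shows "(cmap d \<circ> cinv c) differentiable (at (cmap c q))"
  using smooth_on_differentiable[OF atlas_transition[OF assms(1-3)]] assms(4,5) by blast

lemma fd_transition_compose: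
  assumes M: "smooth_manifold M" and c: "c \<in> atlas M" "d \<in> atlas M" "e \<in> atlas M"
    and q: "q \<in> cdom c" "q \<in> cdom d" "q \<in> cdom e"
  shows "fd (cmap e \<circ> cinv d) (cmap d q) (fd (cmap d \<circ> cinv c) (cmap c q) v) = fd (cmap e \<circ> cinv c) (cmap c q) v"
  using fd_change_chart[OF atlas_is_chart[OF M c(1)] atlas_is_chart[OF M c(2)] atlas_transition[OF M c(1,2)]
      q(1,2) atlas_transition_differentiable[OF M c(2,3) q(2,3)], of v] by simp

lemma tcoord_tvec:
  assumes M: "smooth_manifold M" and c: "c \<in> atlas M" "d \<in> atlas M" and q: "q \<in> cdom c" "q \<in> cdom d"
  shows "tcoord M d q (tvec M c q v) = fd (cmap d \<circ> cinv c) (cmap c q) v"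
  using fd_transition_compose[OF M c(1) chart_at_in(1)[OF M] c(2) q(1) chart_at_in(2)[OF M] q(2)]
    atlas_points[OF M c(1) q(1)] by (simp add: tcoord_def tvec_def)

lemma tcoord_tvec_same:
  assumes M: "smooth_manifold M" and c: "c \<in> atlas M" and q: "q \<in> cdom c"
  shows "tcoord M c q (tvec M c q v) = v"
  using tcoord_tvec[OF M c c q q] fd_chart_self[OF atlas_is_chart[OF M c] q] by simp

lemma tvec_tcoord:
  assumes M: "smooth_manifold M" and c: "c \<in> atlas M" and q: "q \<in> cdom c"
  shows "tvec M c q (tcoord M c q v) = v"
proof -
  have p: "q \<in> points M" using atlas_points[OF M c q] .
  note ca = chart_at_in[OF M p]
  show ?thesis
    using fd_transition_compose[OF M ca(1) c ca(1) ca(2) q ca(2)] fd_chart_self[OF atlas_is_chart[OF M ca(1)] ca(2)]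
    by (simp add: tcoord_def tvec_def)
qed

lemma tvec_chart_at:
  assumes M: "smooth_manifold M" and p: "p \<in> points M"
  shows "tvec M (chart_at M p) p v = v"
  using fd_chart_self[OF atlas_is_chart[OF M chart_at_in(1)[OF M p]] chart_at_in(2)[OF M p]]
  by (simp add: tvec_def)

lemma linear_tcoord:
  assumes M: "smooth_manifold M" and c: "c \<in> atlas M" and q: "q \<in> cdom c"
  shows "linear (tcoord M c q)"
  using fd_linear[OF atlas_transition_differentiable[OF M chart_at_in(1)[OF M] c chart_at_in(2)[OF M] q]]
    atlas_points[OF M c q] unfolding tcoord_def[abs_def] by simp

lemma linear_tvec:
  assumes M: "smooth_manifold M" and c: "c \<in> atlas M" and q: "q \<in> cdom c"
  shows "linear (tvec M c q)"
  using fd_linear[OF atlas_transition_differentiable[OF M c chart_at_in(1)[OF M] q chart_at_in(2)[OF M]]]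
    atlas_points[OF M c q] unfolding tvec_def[abs_def] by simp

lemma tvec_local_rep:
  assumes M: "smooth_manifold M" and c: "c \<in> atlas M" and x: "x \<in> cmap c ` cdom c"
  shows "tvec M c (cinv c x) (local_rep M c X x) = X (cinv c x)"
  using tvec_tcoord[OF M c cinv_in[OF atlas_is_chart[OF M c] x]] by (simp add: local_rep_def)

section \<open>Bump functions\<close>

text \<open>Differentiating exp(-1/t) produces powers of 1/t. The index \<open>n\<close> makes the
  family closed under differentiation up to linear combinations, which drives the induction for
  smoothness; the bump function uses \<open>n = 0\<close>.\<close>

definition flat_fun :: "nat \<Rightarrow> real \<Rightarrow> real" where
  "flat_fun n t = (if t \<le> 0 then 0 else exp (- 1 / t) / t ^ n)"

lemma power_over_fact_le_exp:
  assumes "(x::real) \<ge> 0" shows "x ^ n / fact n \<le> exp x"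
proof -
  have "(\<Sum>i\<in>{n}. x ^ i /\<^sub>R fact i) \<le> (\<Sum>i. x ^ i /\<^sub>R fact i)"
    using assms by (intro sum_le_suminf summable_exp_generic) auto
  then show ?thesis by (simp add: exp_def divide_inverse mult.commute)
qed

text \<open>One term of the exponential series at 1/t beats the pole. The exponent
  \<open>n + 2\<close> leaves a quadratic bound, just what gives derivative zero at
  \<open>t = 0\<close>.\<close>

lemma flat_fun_le: "\<bar>flat_fun n t\<bar> \<le> fact (n + 2) * t\<^sup>2"
proof (cases "t \<le> 0")
  case False
  then have t: "t > 0" by simp
  have "(1 / t) ^ (n + 2) / fact (n + 2) \<le> exp (1 / t)" using t by (intro power_over_fact_le_exp) simp
  then have "1 / t ^ (n + 2) \<le> fact (n + 2) * exp (1 / t)"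
    by (simp only: pos_divide_le_eq[OF fact_gt_zero] power_one_over mult.commute)
  then have "exp (- (1 / t)) * (1 / t ^ (n + 2)) \<le> exp (- (1 / t)) * (fact (n + 2) * exp (1 / t))"
    by (rule mult_left_mono) simp
  also have "\<dots> = fact (n + 2)" by (simp add: exp_minus field_simps)
  finally have "exp (- (1 / t)) / t ^ n / t\<^sup>2 \<le> fact (n + 2)" by (simp only: power_add times_divide_eq_right divide_divide_eq_left mult_1_right)
  then show ?thesis using t by (simp add: flat_fun_def pos_divide_le_eq mult_ac del: fact_Suc)
qed (simp add: flat_fun_def)

lemma flat_fun_deriv:
  "(flat_fun n has_real_derivative (flat_fun (n + 2) t - real n * flat_fun (n + 1) t)) (at t)"
proof -
  consider "t < 0" | "t = 0" | "t > 0" by linarith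
  then show ?thesis
  proof cases
    case 1
    have "((\<lambda>t. 0) has_real_derivative 0) (at t)" by simp
    then have "(flat_fun n has_real_derivative 0) (at t)"
      by (rule has_field_derivative_transform_within_open[where S = "{..<0}"]) (use 1 in \<open>auto simp: flat_fun_def\<close>)
    then show ?thesis using 1 by (simp add: flat_fun_def)
  next
    case 2
    have "(flat_fun n has_derivative (\<lambda>h. 0)) (at 0)"
      unfolding has_derivative_at_alt
    proof (intro conjI allI impI)
      fix e :: real assume e: "e > 0"
      have F: "(fact (n + 2) :: real) > 0" by simp
      show "\<exists>d>0. \<forall>y. norm (y - 0) < d \<longrightarrow> norm (flat_fun n y - flat_fun n 0 - 0) \<le> e * norm (y - 0)"
      proof (intro exI[of _ "e / fact (n + 2)"] conjI allI impI)
        show "e / fact (n + 2) > 0" using e F by (rule divide_pos_pos)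
        fix y :: real assume y: "norm (y - 0) < e / fact (n + 2)"
        have "norm (flat_fun n y - flat_fun n 0 - 0) \<le> (fact (n + 2) * \<bar>y\<bar>) * \<bar>y\<bar>"
          using flat_fun_le[of n y] by (simp add: flat_fun_def power2_eq_square mult.assoc abs_mult_self_eq)
        also have "\<dots> \<le> e * \<bar>y\<bar>"
          using y F by (intro mult_right_mono) (simp_all add: pos_less_divide_eq mult.commute del: fact_Suc)
        finally show "norm (flat_fun n y - flat_fun n 0 - 0) \<le> e * norm (y - 0)" by simp
      qed
    qed simp
    moreover have "(*) 0 = (\<lambda>h::real. 0)" by (simp add: fun_eq_iff)
    ultimately show ?thesis using 2 by (simp add: flat_fun_def has_field_derivative_def)
  next
    case 3
    have "((\<lambda>t. exp (- 1 / t) / t ^ n) has_real_derivative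
        (exp (- 1 / t) * (1 / t\<^sup>2) * t ^ n - exp (- 1 / t) * (real n * t ^ (n - 1))) / (t ^ n * t ^ n)) (at t)"
      using 3 by (auto intro!: derivative_eq_intros simp: power2_eq_square)
    moreover have "(exp (- 1 / t) * (1 / t\<^sup>2) * t ^ n - exp (- 1 / t) * (real n * t ^ (n - 1))) / (t ^ n * t ^ n)
        = flat_fun (n + 2) t - real n * flat_fun (n + 1) t"
      using 3 by (cases n) (simp_all add: flat_fun_def field_simps power2_eq_square power_add)
    ultimately have "((\<lambda>t. exp (- 1 / t) / t ^ n) has_real_derivative
        flat_fun (n + 2) t - real n * flat_fun (n + 1) t) (at t)" by simp
    then show ?thesis
      by (rule has_field_derivative_transform_within_open[where S = "{0<..}"]) (use 3 in \<open>auto simp: flat_fun_def\<close>)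
  qed
qed

lemma smooth_on_flat_fun: "smooth_on UNIV (flat_fun n)"
proof -
  have d: "(flat_fun n has_derivative (\<lambda>h. h *\<^sub>R flat_fun (n + 2) t + (- h * real n) *\<^sub>R flat_fun (n + 1) t)) (at t)" for n t
    using flat_fun_deriv[of n t] unfolding has_field_derivative_def
    by (rule has_derivative_eq_rhs) (simp add: fun_eq_iff algebra_simps)
  have "\<forall>n. C_k_on k (flat_fun n) UNIV" for k
  proof (induction k)
    case 0
    show ?case using differentiableI[OF d]
      by (auto intro!: continuous_at_imp_continuous_on differentiable_imp_continuous_within)
  next
    case (Suc k)
    have "C_k_on k (\<lambda>t. v *\<^sub>R flat_fun (n + 2) t + (- v * real n) *\<^sub>R flat_fun (n + 1) t) UNIV" for v n
      using Suc by (intro C_k_on_add C_k_on_scaleR C_k_on_const open_UNIV) blast+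
    then show ?case using differentiableI[OF d] by (simp add: fd_eq[OF d])
  qed
  then show ?thesis by (simp add: smooth_on_def)
qed

text \<open>The function need not be constant near \<open>x0\<close>: the later computation at
  \<open>x0\<close> uses only its value and its first derivative there.\<close>

lemma bump_function:
  fixes x0 :: "'a::euclidean_space"
  assumes "R > 0"
  obtains \<psi> :: "'a \<Rightarrow> real" where "smooth_on UNIV \<psi>" "\<psi> x0 = 1" "fd \<psi> x0 = (\<lambda>h. 0)"
    "\<And>x. x \<notin> cball x0 R \<Longrightarrow> \<psi> x = 0"
proof -
  define s where "s = (\<lambda>x. R\<^sup>2 - (x - x0) \<bullet> (x - x0))"
  \<comment> \<open>At the centre \<open>s x0 = R^2\<close> and \<open>flat_fun 0\<close> takes the
    value exp(-1/R^2), which the factor normalises to 1.\<close>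
  define \<psi> where "\<psi> = (\<lambda>x. exp (1 / R\<^sup>2) * flat_fun 0 (s x))"
  have sh: "smooth_on UNIV (\<lambda>x. x - x0)"
    by (intro smooth_on_minus smooth_on_linear[OF bounded_linear_ident] smooth_on_const open_UNIV)
  have s: "smooth_on UNIV s"
    unfolding s_def by (intro smooth_on_minus smooth_on_inner smooth_on_const sh open_UNIV)
  have fs: "smooth_on UNIV (\<lambda>x. flat_fun 0 (s x))"
    by (rule smooth_on_compose[OF open_UNIV s smooth_on_flat_fun]) simp
  have "(s has_derivative (\<lambda>h. 0)) (at x0)"
    unfolding s_def by (auto intro!: derivative_eq_intros)
  then have "((\<lambda>x. flat_fun 0 (s x)) has_derivative (\<lambda>h. fd (flat_fun 0) (s x0) 0)) (at x0)"
    by (rule has_derivative_compose) (rule smooth_on_works[OF smooth_on_flat_fun], simp)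
  moreover have "fd (flat_fun 0) (s x0) 0 = 0"
    by (rule linear_0[OF fd_linear[OF smooth_on_differentiable[OF smooth_on_flat_fun]]]) simp
  ultimately have "((\<lambda>x. flat_fun 0 (s x)) has_derivative (\<lambda>h. 0)) (at x0)" by simp
  from has_derivative_mult_right[OF this, of "exp (1 / R\<^sup>2)"]
  have "(\<psi> has_derivative (\<lambda>h. 0)) (at x0)" by (simp add: \<psi>_def)
  moreover have "\<psi> x = 0" if "x \<notin> cball x0 R" for x
  proof -
    have "R\<^sup>2 < (norm (x - x0))\<^sup>2"
      using that assms by (intro power_strict_mono) (auto simp: dist_norm norm_minus_commute)
    then show ?thesis by (simp add: \<psi>_def s_def flat_fun_def power2_norm_eq_inner)
  qed
  ultimately show ?thesis
    using that[of \<psi>] fs assms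
    by (simp add: fd_eq \<psi>_def smooth_on_mult smooth_on_const)
      (simp add: s_def flat_fun_def exp_minus)
qed

section \<open>The fundamental two-form\<close>

text \<open>Global fields are required because \<open>nabla\<close> is specified only on them. The
  set that corresponds to \<open>K\<close> is compact, hence closed as the manifold is Hausdorff; so
  the field vanishes near every point outside \<open>cdom d\<close>, and extending by zero is
  smooth.\<close>

lemma vector_field_bump:
  fixes N :: "('n, 'e::euclidean_space) mfd"
  assumes N: "smooth_manifold N" and d: "d \<in> atlas N" and K: "compact K" "K \<subseteq> cmap d ` cdom d"
    and \<psi>: "smooth_on UNIV \<psi>" "\<And>x. x \<notin> K \<Longrightarrow> \<psi> x = 0"
  shows "vector_field N (\<lambda>q. if q \<in> cdom d then \<psi> (cmap d q) *\<^sub>R tvec N d q u else 0)" (is "vector_field N ?U")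
  unfolding smooth_vector_field_on_def
proof (intro ballI smooth_on_local)
  fix c x assume c: "c \<in> atlas N" and x: "x \<in> cmap c ` (cdom c \<inter> points N)"
  note ic = atlas_is_chart[OF N c] and id = atlas_is_chart[OF N d]
  define q where "q = cinv c x"
  have q: "q \<in> cdom c" "q \<in> points N" "x = cmap c q"
    using cinv_in[OF ic x] cmap_cinv[OF x] by (auto simp: q_def)
  show "\<exists>T. open T \<and> x \<in> T \<and> smooth_on T (local_rep N c ?U)"
  proof (cases "q \<in> cdom d")
    case True
    let ?T = "cmap c ` (cdom c \<inter> cdom d)"
    have oT: "open ?T" by (rule open_chart_image[OF ic is_chartD(1)[OF id]])
    have \<tau>: "smooth_on ?T (cmap d \<circ> cinv c)" by (rule atlas_transition[OF N c d])
    have \<sigma>: "smooth_on (cmap d ` (cdom d \<inter> cdom c)) (\<lambda>y. fd (cmap c \<circ> cinv d) y u)"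
      by (rule smooth_on_fd[OF atlas_transition[OF N d c]])
    have im: "(cmap d \<circ> cinv c) ` ?T \<subseteq> cmap d ` (cdom d \<inter> cdom c)"
      using cinv_cmap[OF ic] by auto
    have "smooth_on ?T (\<lambda>y. \<psi> ((cmap d \<circ> cinv c) y) *\<^sub>R fd (cmap c \<circ> cinv d) ((cmap d \<circ> cinv c) y) u)"
      by (intro smooth_on_scaleR oT smooth_on_compose[OF oT \<tau> \<psi>(1)] smooth_on_compose[OF oT \<tau> \<sigma> im]) simp
    then have "smooth_on ?T (local_rep N c ?U)"
    proof (rule smooth_on_cong[OF oT, rotated])
      fix y assume "y \<in> ?T"
      then obtain q' where q': "y = cmap c q'" "q' \<in> cdom c" "q' \<in> cdom d" by blast
      have "local_rep N c ?U y = \<psi> (cmap d q') *\<^sub>R tcoord N c q' (tvec N d q' u)"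
        using q' cinv_cmap[OF ic q'(2)] linear_scale[OF linear_tcoord[OF N c q'(2)]] by (simp add: local_rep_def)
      then show "\<psi> ((cmap d \<circ> cinv c) y) *\<^sub>R fd (cmap c \<circ> cinv d) ((cmap d \<circ> cinv c) y) u = local_rep N c ?U y"
        using q' cinv_cmap[OF ic q'(2)] tcoord_tvec[OF N d c q'(3,2)] by simp
    qed
    then show ?thesis using oT q True by blast
  next
    case False
    define C where "C = cinv d ` K"
    have Cd: "C \<subseteq> cdom d" unfolding C_def using K(2) cinv_in[OF id] by blast
    have hom: "homeomorphic_map (subtopology (mtop N) (cdom d)) (top_of_set (cmap d ` cdom d)) (cmap d)"
      using id by (simp add: is_chart_def)
    have "compactin (subtopology (mtop N) (cdom d)) C"
    proof -
      have "cmap d ` C = K" unfolding C_def using K(2) cmap_cinv[of _ d "cdom d"] by (force simp: image_image)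
      moreover have "compactin (top_of_set (cmap d ` cdom d)) K" using K by (simp add: compactin_subtopology)
      ultimately show ?thesis
        using homeomorphic_map_compactness_eq[OF hom, of C] Cd is_chartD(2)[OF id]
        by (simp add: topspace_subtopology Int_absorb1)
    qed
    then have "compactin (mtop N) C" by (simp add: compactin_subtopology)
    moreover have "Hausdorff_space (mtop N)" using N by (simp add: smooth_manifold_def)
    ultimately have "closedin (mtop N) C" by (rule compactin_imp_closedin[rotated])
    then have op: "openin (mtop N) (points N - C)" by blast
    let ?T = "cmap c ` (cdom c \<inter> (points N - C))"
    have oT: "open ?T" by (rule open_chart_image[OF ic op])
    have "smooth_on ?T (local_rep N c ?U)"
    proof (rule smooth_on_cong[OF oT _ smooth_on_const[of _ 0]])
      fix y assume "y \<in> ?T"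
      then obtain q' where q': "y = cmap c q'" "q' \<in> cdom c" "q' \<notin> C" by blast
      have "\<psi> (cmap d q') = 0" if q'd: "q' \<in> cdom d"
      proof (rule \<psi>(2), rule notI)
        assume "cmap d q' \<in> K"
        then have "cinv d (cmap d q') \<in> C" by (simp add: C_def)
        then show False using q'(3) cinv_cmap[OF id q'd] by simp
      qed
      then show "0 = local_rep N c ?U y"
        using q' cinv_cmap[OF ic q'(2)] linear_0[OF linear_tcoord[OF N c q'(2)]] by (simp add: local_rep_def)
    qed
    moreover have "x \<in> ?T" using q False Cd by blast
    ultimately show ?thesis using oT by blast
  qed
qed

text \<open>\<open>tensor_field_11\<close> tests \<phi> only on fields with constant coefficients in
  a chart; this sum carries smoothness over to arbitrary fields.\<close>

lemma local_rep_tensor_field: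
  assumes N: "smooth_manifold N" and \<phi>: "tensor_field_11 N \<phi>" and c: "c \<in> atlas N" and x: "x \<in> cmap c ` cdom c"
  shows "local_rep N c (\<lambda>q. \<phi> q (X q)) x
    = (\<Sum>b\<in>Basis. (local_rep N c X x \<bullet> b) *\<^sub>R local_rep N c (\<lambda>q. \<phi> q (tvec N c q b)) x)"
proof -
  define q where "q = cinv c x"
  have q: "q \<in> cdom c" using cinv_in[OF atlas_is_chart[OF N c] x] by (simp add: q_def)
  have l: "linear (\<lambda>v. tcoord N c q (\<phi> q (tvec N c q v)))"
    using linear_compose[OF linear_compose[OF linear_tvec[OF N c q]] linear_tcoord[OF N c q], of "\<phi> q"]
      \<phi> atlas_points[OF N c q] by (simp add: tensor_field_11_def o_def)
  have "local_rep N c (\<lambda>q. \<phi> q (X q)) x = tcoord N c q (\<phi> q (tvec N c q (local_rep N c X x)))"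
    using tvec_local_rep[OF N c x, of X] by (simp add: local_rep_def q_def)
  also have "\<dots> = (\<Sum>b\<in>Basis. (local_rep N c X x \<bullet> b) *\<^sub>R tcoord N c q (\<phi> q (tvec N c q b)))"
    by (rule linear_expand[OF l])
  finally show ?thesis by (simp add: local_rep_def q_def)
qed

lemma vector_field_tensor_field:
  fixes N :: "('n, 'e::euclidean_space) mfd"
  assumes N: "smooth_manifold N" and \<phi>: "tensor_field_11 N \<phi>" and X: "vector_field N X"
  shows "vector_field N (\<lambda>q. \<phi> q (X q))"
  unfolding smooth_vector_field_on_def
proof (intro ballI)
  fix c assume c: "c \<in> atlas N"
  note ic = atlas_is_chart[OF N c]
  have eq: "cdom c \<inter> points N = cdom c" using is_chartD(2)[OF ic] by blast
  have o: "open (cmap c ` cdom c)" by (rule is_chartD(3)[OF ic])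
  have "smooth_on (cmap c ` cdom c) (local_rep N c X)"
    using X c eq unfolding smooth_vector_field_on_def by metis
  then have "smooth_on (cmap c ` cdom c)
      (\<lambda>x. \<Sum>b\<in>Basis. (local_rep N c X x \<bullet> b) *\<^sub>R local_rep N c (\<lambda>q. \<phi> q (tvec N c q b)) x)"
    using \<phi> c unfolding tensor_field_11_def
    by (intro smooth_on_sum smooth_on_scaleR smooth_on_inner smooth_on_const o) blast+
  then have "smooth_on (cmap c ` cdom c) (local_rep N c (\<lambda>q. \<phi> q (X q)))"
    by (rule smooth_on_cong[OF o, rotated]) (rule local_rep_tensor_field[OF N \<phi> c, symmetric])
  then show "smooth_on (cmap c ` (cdom c \<inter> points N)) (local_rep N c (\<lambda>q. \<phi> q (X q)))" by (simp add: eq)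
qed

definition fundamental_form ::
  "('n, 'e::euclidean_space) mfd \<Rightarrow> ('n \<Rightarrow> 'e \<Rightarrow> 'e) \<Rightarrow> ('n \<Rightarrow> 'e \<Rightarrow> 'e \<Rightarrow> real) \<Rightarrow> ('n, 'e) chart \<Rightarrow>
   'e \<Rightarrow> 'e \<Rightarrow> 'e \<Rightarrow> real" where
  "fundamental_form N \<phi> h d x v w =
     h (cinv d x) (tvec N d (cinv d x) v) (\<phi> (cinv d x) (tvec N d (cinv d x) w))"

lemma fundamental_form_bilinear:
  assumes N: "smooth_manifold N" and \<phi>: "tensor_field_11 N \<phi>" and h: "riemannian_metric N h"
    and d: "d \<in> atlas N" and x: "x \<in> cmap d ` cdom d"
  shows "bilinear (fundamental_form N \<phi> h d x)"
proof -
  define q where "q = cinv d x"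
  have q: "q \<in> cdom d" using cinv_in[OF atlas_is_chart[OF N d] x] by (simp add: q_def)
  have p: "q \<in> points N" by (rule atlas_points[OF N d q])
  have t: "linear (tvec N d q)" by (rule linear_tvec[OF N d q])
  have f: "linear (\<lambda>w. \<phi> q (tvec N d q w))"
    using linear_compose[OF t, of "\<phi> q"] \<phi> p by (simp add: tensor_field_11_def o_def)
  have b: "bilinear (h q)" using h p by (simp add: riemannian_metric_def)
  show ?thesis
    unfolding bilinear_def fundamental_form_def q_def[symmetric]
    using linear_compose[OF t bilinear_linear(1)[OF b]] linear_compose[OF f bilinear_linear(2)[OF b]]
    by (simp add: o_def)
qed

text \<open>In coordinates \<phi> applied to \<open>w\<close> is a moving argument of the metric, so
  the smoothness of the metric on constant arguments is extended by
  \<open>smooth_on_bilinear_family\<close>.\<close>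

lemma smooth_on_fundamental_form:
  assumes N: "smooth_manifold N" and \<phi>: "tensor_field_11 N \<phi>" and h: "riemannian_metric N h"
    and d: "d \<in> atlas N"
  shows "smooth_on (cmap d ` cdom d) (\<lambda>x. fundamental_form N \<phi> h d x v w)"
proof -
  note id = atlas_is_chart[OF N d]
  let ?S = "cmap d ` cdom d"
  let ?X = "local_rep N d (\<lambda>q. \<phi> q (tvec N d q w))"
  have o: "open ?S" by (rule is_chartD(3)[OF id])
  have X: "smooth_on ?S ?X" using \<phi> d unfolding tensor_field_11_def by blast
  have "smooth_on ?S (\<lambda>x. h (cinv d x) (tvec N d (cinv d x) v) (tvec N d (cinv d x) (?X x)))"
  proof (rule smooth_on_bilinear_family[where F = "\<lambda>x. x" and X = "\<lambda>x. v" and Y = ?X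
        and \<Omega> = "\<lambda>x v w. h (cinv d x) (tvec N d (cinv d x) v) (tvec N d (cinv d x) w)", OF o _ _ _ _ smooth_on_const X])
    show "smooth_on ?S (\<lambda>x. x)" by (rule smooth_on_linear[OF bounded_linear_ident])
    show "(\<lambda>x. x) ` ?S \<subseteq> ?S" by simp
    show "bilinear (\<lambda>v w. h (cinv d y) (tvec N d (cinv d y) v) (tvec N d (cinv d y) w))" if y: "y \<in> ?S" for y
    proof -
      have q: "cinv d y \<in> cdom d" by (rule cinv_in[OF id y order_refl])
      have t: "linear (tvec N d (cinv d y))" by (rule linear_tvec[OF N d q])
      have b: "bilinear (h (cinv d y))" using h atlas_points[OF N d q] by (simp add: riemannian_metric_def)
      show ?thesis unfolding bilinear_def
        using linear_compose[OF t bilinear_linear(1)[OF b]] linear_compose[OF t bilinear_linear(2)[OF b]]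
        by (simp add: o_def)
    qed
    show "smooth_on ?S (\<lambda>y. h (cinv d y) (tvec N d (cinv d y) a) (tvec N d (cinv d y) b))" for a b
      using h d unfolding riemannian_metric_def by blast
  qed
  then show ?thesis
    by (rule smooth_on_cong[OF o, rotated])
      (simp add: fundamental_form_def tvec_local_rep[OF N d])
qed

text \<open>Evaluated on vectors orthogonal to $\xi$, the right-hand side of the defining equation of a
  G.Q.S. manifold drops out, and the cyclic sum cancels since $\nabla$ is torsion-free.\<close>

lemma fundamental_form_closed:
  fixes N :: "('n, 'e::euclidean_space) mfd"
  assumes gqs: "generalized_quasi_sasakian N \<phi> \<xi> \<eta> h nabla" and y: "y \<in> points N"
    and d: "d = chart_at N y" and \<eta>: "\<eta> y u = 0" "\<eta> y v = 0" "\<eta> y w = 0"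
  shows "fd (\<lambda>x. fundamental_form N \<phi> h d x v w) (cmap d y) u
    + fd (\<lambda>x. fundamental_form N \<phi> h d x w u) (cmap d y) v
    + fd (\<lambda>x. fundamental_form N \<phi> h d x u v) (cmap d y) w = 0"
proof -
  have acm: "almost_contact_metric N \<phi> \<xi> \<eta> h" and lc: "levi_civita N h nabla"
    using gqs by (auto simp: generalized_quasi_sasakian_def)
  have N: "smooth_manifold N" and \<phi>: "tensor_field_11 N \<phi>" and h: "riemannian_metric N h"
    using acm by (auto simp: almost_contact_metric_def)
  have dA: "d \<in> atlas N" and yd: "y \<in> cdom d" using chart_at_in[OF N y] d by auto
  note id = atlas_is_chart[OF N dA]
  let ?S = "cmap d ` cdom d"
  define x0 where "x0 = cmap d y"
  have oS: "open ?S" by (rule is_chartD(3)[OF id])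
  have x0S: "x0 \<in> ?S" using yd by (simp add: x0_def)
  have cy: "cinv d x0 = y" using cinv_cmap[OF id yd] by (simp add: x0_def)
  obtain R where R: "R > 0" "cball x0 R \<subseteq> ?S" using oS x0S open_contains_cball by blast
  obtain \<psi> :: "'e \<Rightarrow> real" where \<psi>: "smooth_on UNIV \<psi>" "\<psi> x0 = 1" "fd \<psi> x0 = (\<lambda>h. 0)"
    "\<And>x. x \<notin> cball x0 R \<Longrightarrow> \<psi> x = 0"
    using bump_function[OF R(1), of x0] by blast
  \<comment> \<open>Since \<open>d\<close> is the preferred chart at \<open>y\<close>, a tangent
    vector at \<open>y\<close> equals its own coordinates, and \<open>X u\<close> takes the value
    \<open>u\<close> there.\<close>
  define X where "X = (\<lambda>u q. if q \<in> cdom d then \<psi> (cmap d q) *\<^sub>R tvec N d q u else 0)"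
  have X: "vector_field N (X u)" for u
    unfolding X_def by (rule vector_field_bump[OF N dA compact_cball R(2) \<psi>(1,4)])
  have \<phi>X: "vector_field N (\<lambda>q. \<phi> q (X u q))" for u by (rule vector_field_tensor_field[OF N \<phi> X])
  have Xy: "X u y = u" for u
    using yd \<psi>(2) tvec_chart_at[OF N y, folded d] by (simp add: X_def x0_def)
  have \<psi>d: "(\<psi> has_derivative (\<lambda>h. 0)) (at x0)" using smooth_on_works[OF \<psi>(1), of x0] \<psi>(3) by simp
  \<comment> \<open>In the chart \<open>X u\<close> is \<psi> times a constant vector, and \<psi>
    has derivative zero at \<open>x0\<close>; so both terms of the bracket vanish at
    \<open>y\<close>.\<close>
  have br: "lie_bracket N (X u) (X v) y = 0" for u v
  proof -
    have "fd (local_rep N d (X u)) x0 = (\<lambda>h. 0)" for u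
    proof -
      have "fd (local_rep N d (X u)) x0 = fd (\<lambda>x. \<psi> x *\<^sub>R u) x0"
      proof (rule fd_cong[OF oS x0S])
        fix x assume x: "x \<in> ?S"
        have q: "cinv d x \<in> cdom d" by (rule cinv_in[OF id x order_refl])
        then show "local_rep N d (X u) x = \<psi> x *\<^sub>R u"
          using cmap_cinv[OF x order_refl] linear_scale[OF linear_tcoord[OF N dA q]] tcoord_tvec_same[OF N dA q]
          by (simp add: local_rep_def X_def)
      qed
      also have "\<dots> = (\<lambda>h. 0)" using has_derivative_scaleR_left[OF \<psi>d, of u] by (simp add: fd_eq)
      finally show ?thesis .
    qed
    then show ?thesis by (simp add: lie_bracket_def Let_def d[symmetric] x0_def[symmetric])
  qed
  have sym: "h y a b = h y b a" and bil: "bilinear (h y)" for a b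
    using h y by (auto simp: riemannian_metric_def)
  have skew: "h y (\<phi> y a) b = - h y a (\<phi> y b)" and \<eta>h: "\<eta> y a = h y a (\<xi> y)" for a b
    using acm y unfolding almost_contact_metric_def by (auto simp: add_eq_0_iff)
  define A where "A = (\<lambda>u v. nabla (X u) (X v) y)"
  have Asym: "A u v = A v u" for u v
    using lc X y br[of u v] unfolding levi_civita_def A_def by (metis eq_iff_diff_eq_0)
  have compat: "dir_deriv N p (X p) (\<lambda>q. h q (Y q) (Z q)) = h p (nabla X Y p) (Z p) + h p (Y p) (nabla X Z p)"
    if "vector_field N X" "vector_field N Y" "vector_field N Z" "p \<in> points N" for X Y Z p
    using lc that unfolding levi_civita_def by blast
  \<comment> \<open>Metric compatibility differentiates the form. In the G.Q.S. term the multiple of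
    \<xi> is orthogonal to \<open>v\<close>, and the other summand carries the factor
    \<open>\<eta> y w\<close>; both vanish.\<close>
  have D: "fd (\<lambda>x. fundamental_form N \<phi> h d x v w) x0 u = h y (A u v) (\<phi> y w) - h y (\<phi> y v) (A u w)"
    if "\<eta> y v = 0" "\<eta> y w = 0" for u v w
  proof -
    have "dir_deriv N y (X u y) (\<lambda>q. h q (X v q) (\<phi> q (X w q)))
        = h y (A u v) (\<phi> y w) + h y v (nabla (X u) (\<lambda>q. \<phi> q (X w q)) y)"
      using compat[OF X X \<phi>X y] unfolding Xy A_def .
    moreover have "nabla (X u) (\<lambda>q. \<phi> q (X w q)) y = \<phi> y (A u w)
        + h y (nabla (\<lambda>q. \<phi> q (X u q)) \<xi> y) w *\<^sub>R \<xi> y"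
    proof -
      have "nabla (X u) (\<lambda>q. \<phi> q (X w q)) y - \<phi> y (A u w) =
          h y (nabla (\<lambda>q. \<phi> q (X u q)) \<xi> y) (X w y) *\<^sub>R \<xi> y - \<eta> y (X w y) *\<^sub>R nabla (\<lambda>q. \<phi> q (X u q)) \<xi> y"
        using gqs X y unfolding generalized_quasi_sasakian_def A_def by blast
      then show ?thesis using that(2) Xy by (simp add: algebra_simps)
    qed
    moreover have "h y v (\<phi> y (A u w) + r *\<^sub>R \<xi> y) = - h y (\<phi> y v) (A u w)" for r
      using that(1) skew[of v "A u w"] \<eta>h[of v] by (simp add: bilinear_radd[OF bil] bilinear_rmul[OF bil])
    moreover have "dir_deriv N y (X u y) (\<lambda>q. h q (X v q) (\<phi> q (X w q)))
        = fd (\<lambda>x. fundamental_form N \<phi> h d x v w) x0 u"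
    proof -
      let ?f = "\<lambda>x. fundamental_form N \<phi> h d x v w"
      have "dir_deriv N y (X u y) (\<lambda>q. h q (X v q) (\<phi> q (X w q)))
          = fd ((\<lambda>q. h q (X v q) (\<phi> q (X w q))) \<circ> cinv d) x0 u"
        by (simp add: dir_deriv_def d[symmetric] x0_def Xy)
      also have "fd ((\<lambda>q. h q (X v q) (\<phi> q (X w q))) \<circ> cinv d) x0 = fd (\<lambda>x. (\<psi> x * \<psi> x) * ?f x) x0"
      proof (rule fd_cong[OF oS x0S])
        fix x assume x: "x \<in> ?S"
        have q: "cinv d x \<in> cdom d" by (rule cinv_in[OF id x order_refl])
        have p: "cinv d x \<in> points N" by (rule atlas_points[OF N dA q])
        have "linear (\<phi> (cinv d x))" "bilinear (h (cinv d x))"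
          using \<phi> h p by (auto simp: tensor_field_11_def riemannian_metric_def)
        then show "((\<lambda>q. h q (X v q) (\<phi> q (X w q))) \<circ> cinv d) x = (\<psi> x * \<psi> x) * ?f x"
          using q cmap_cinv[OF x order_refl]
          by (simp add: X_def fundamental_form_def linear_scale bilinear_lmul bilinear_rmul)
      qed
      also have "fd (\<lambda>x. (\<psi> x * \<psi> x) * ?f x) x0 = fd ?f x0"
        using has_derivative_mult[OF has_derivative_mult[OF \<psi>d \<psi>d]
            smooth_on_works[OF smooth_on_fundamental_form[OF N \<phi> h dA] x0S], of v w] \<psi>(2)
        by (simp add: fd_eq)
      finally show ?thesis .
    qed
    ultimately show ?thesis by simp
  qed
  \<comment> \<open>The six terms of the cyclic sum cancel in pairs such as
    \<open>h y (A u v) (\<phi> y w)\<close> and \<open>h y (\<phi> y w) (A v u)\<close>, by the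
    symmetry of \<open>A\<close> and of the metric.\<close>
  show ?thesis
    unfolding x0_def[symmetric] D[OF \<eta>(2,3)] D[OF \<eta>(3,1)] D[OF \<eta>(1,2)]
    using Asym[of u v] Asym[of v w] Asym[of w u] sym[of "\<phi> y u"] sym[of "\<phi> y v"] sym[of "\<phi> y w"] by simp
qed

section \<open>The differential of a smooth map in charts\<close>

lemma smooth_map_point:
  "smooth_map M N f \<Longrightarrow> q \<in> points M \<Longrightarrow> f q \<in> points N"
  using continuous_map_funspace by (fastforce simp: smooth_map_def)

lemma open_smooth_map_domain:
  assumes M: "smooth_manifold M" and N: "smooth_manifold N" and f: "smooth_map M N f"
    and c: "c \<in> atlas M" and d: "d \<in> atlas N"
  shows "open (cmap c ` (cdom c \<inter> f -` cdom d))"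
proof -
  have "openin (mtop M) {q \<in> points M. f q \<in> cdom d}"
    using f is_chartD(1)[OF atlas_is_chart[OF N d]]
    by (intro openin_continuous_map_preimage) (auto simp: smooth_map_def)
  moreover have "cdom c \<inter> {q \<in> points M. f q \<in> cdom d} = cdom c \<inter> f -` cdom d"
    using atlas_points[OF M c] by blast
  ultimately show ?thesis using open_chart_image[OF atlas_is_chart[OF M c]] by metis
qed

lemma smooth_map_chart:
  assumes "smooth_map M N f" "c \<in> atlas M" "d \<in> atlas N"
  shows "smooth_on (cmap c ` (cdom c \<inter> f -` cdom d)) (cmap d \<circ> f \<circ> cinv c)"
  using assms by (simp add: smooth_map_def)

lemma smooth_map_chart_differentiable:
  assumes "smooth_map M N f" "c \<in> atlas M" "d \<in> atlas N" "q \<in> cdom c" "f q \<in> cdom d"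
  shows "(cmap d \<circ> f \<circ> cinv c) differentiable (at (cmap c q))"
  using smooth_on_differentiable[OF smooth_map_chart[OF assms(1-3)]] assms(4,5) by blast

lemma linear_mdiff:
  assumes "smooth_manifold M" "smooth_manifold N" "smooth_map M N f" "q \<in> points M"
  shows "linear (mdiff M N f q)"
  unfolding mdiff_def[abs_def]
  by (intro fd_linear smooth_map_chart_differentiable[OF assms(3)] chart_at_in[OF assms(1,4)]
      chart_at_in[OF assms(2) smooth_map_point[OF assms(3,4)]])

text \<open>\<open>mdiff\<close> is read in the preferred charts, which jump with the point. In
  fixed charts it becomes an ordinary derivative, which can be differentiated again.\<close>

lemma mdiff_tvec:
  assumes M: "smooth_manifold M" and N: "smooth_manifold N" and f: "smooth_map M N f"
    and c: "c \<in> atlas M" and d: "d \<in> atlas N" and q: "q \<in> cdom c" "f q \<in> cdom d"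
  shows "mdiff M N f q (tvec M c q a) = tvec N d (f q) (fd (cmap d \<circ> f \<circ> cinv c) (cmap c q) a)"
proof -
  have p: "q \<in> points M" "f q \<in> points N"
    using atlas_points[OF M c q(1)] atlas_points[OF N d q(2)] by auto
  define e where "e = chart_at N (f q)"
  define k where "k = chart_at M q"
  have e: "e \<in> atlas N" "f q \<in> cdom e" unfolding e_def by (rule chart_at_in[OF N p(2)])+
  have k: "k \<in> atlas M" "q \<in> cdom k" unfolding k_def by (rule chart_at_in[OF M p(1)])+
  let ?S = "cmap c ` (cdom c \<inter> f -` cdom d)" and ?F = "cmap d \<circ> f \<circ> cinv c"
  have "mdiff M N f q (tvec M c q a) = fd (cmap e \<circ> f \<circ> cinv k) (cmap k q) (fd (cmap k \<circ> cinv c) (cmap c q) a)"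
    by (simp add: mdiff_def tvec_def e_def k_def)
  also have "\<dots> = fd (cmap e \<circ> f \<circ> cinv c) (cmap c q) a"
    by (rule fd_change_chart[OF atlas_is_chart[OF M c] atlas_is_chart[OF M k(1)] atlas_transition[OF M c k(1)]
          q(1) k(2) smooth_map_chart_differentiable[OF f k(1) e(1) k(2) e(2)], symmetric])
  also have "\<dots> = fd (\<lambda>x. (cmap e \<circ> cinv d) (?F x)) (cmap c q) a"
  proof (rule arg_cong[where f = "\<lambda>D. D a"], rule fd_cong[OF open_smooth_map_domain[OF M N f c d]])
    show "cmap c q \<in> ?S" using q by blast
    fix x assume "x \<in> ?S"
    from cinv_in[OF atlas_is_chart[OF M c] this] have "f (cinv c x) \<in> cdom d" by simp
    then show "(cmap e \<circ> f \<circ> cinv c) x = (cmap e \<circ> cinv d) (?F x)"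
      using cinv_cmap[OF atlas_is_chart[OF N d]] by simp
  qed
  also have "\<dots> = fd (cmap e \<circ> cinv d) (?F (cmap c q)) (fd ?F (cmap c q) a)"
  proof (rule fd_compose[OF smooth_map_chart_differentiable[OF f c d q]])
    show "(cmap e \<circ> cinv d) differentiable (at (?F (cmap c q)))"
      using atlas_transition_differentiable[OF N d e(1) q(2) e(2)] cinv_cmap[OF atlas_is_chart[OF M c] q(1)] by simp
  qed
  also have "\<dots> = tvec N d (f q) (fd ?F (cmap c q) a)"
    using cinv_cmap[OF atlas_is_chart[OF M c] q(1)] by (simp add: tvec_def e_def)
  finally show ?thesis .
qed

section \<open>The fundamental form on the submanifold\<close>

text \<open>No chart of \<open>N\<close> enters, so the form is available on all of
  \<open>cdom c\<close> even if \<open>f\<close> does not map \<open>cdom c\<close> into a single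
  chart of \<open>N\<close>.\<close>

definition induced_form ::
  "('m, 'd::euclidean_space) mfd \<Rightarrow> ('n, 'e::euclidean_space) mfd \<Rightarrow> ('n \<Rightarrow> 'e \<Rightarrow> 'e) \<Rightarrow>
   ('n \<Rightarrow> 'e \<Rightarrow> 'e \<Rightarrow> real) \<Rightarrow> ('m \<Rightarrow> 'n) \<Rightarrow> ('m, 'd) chart \<Rightarrow> 'd \<Rightarrow> 'd \<Rightarrow> 'd \<Rightarrow> real" where
  "induced_form M N \<phi> h f c x a b =
     h (f (cinv c x)) (mdiff M N f (cinv c x) (tvec M c (cinv c x) a))
       (\<phi> (f (cinv c x)) (mdiff M N f (cinv c x) (tvec M c (cinv c x) b)))"

lemma induced_form_eq_pullback:
  assumes M: "smooth_manifold M" and N: "smooth_manifold N" and f: "smooth_map M N f"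
    and c: "c \<in> atlas M" and d: "d \<in> atlas N" and x: "x \<in> cmap c ` (cdom c \<inter> f -` cdom d)"
  shows "induced_form M N \<phi> h f c x a b = fundamental_form N \<phi> h d ((cmap d \<circ> f \<circ> cinv c) x)
    (fd (cmap d \<circ> f \<circ> cinv c) x a) (fd (cmap d \<circ> f \<circ> cinv c) x b)"
proof -
  obtain q where q: "x = cmap c q" "q \<in> cdom c" "f q \<in> cdom d" using x by blast
  then show ?thesis
    using cinv_cmap[OF atlas_is_chart[OF M c] q(2)] cinv_cmap[OF atlas_is_chart[OF N d] q(3)]
      mdiff_tvec[OF M N f c d q(2,3)]
    by (simp add: induced_form_def fundamental_form_def)
qed

text \<open>All conditions are local, so around each point the form is read as a pullback through a
  chart of \<open>N\<close>. For closedness at \<open>q\<close> this is the preferred chart at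
  \<open>f q\<close>, the one in which \<open>fundamental_form_closed\<close> holds.\<close>

lemma induced_form_closed:
  fixes M :: "('m, 'd::euclidean_space) mfd" and N :: "('n, 'e::euclidean_space) mfd"
  assumes gqs: "generalized_quasi_sasakian N \<phi> \<xi> \<eta> h nabla"
    and M: "smooth_manifold M" and f: "smooth_map M N f"
    and \<xi>: "\<And>p. p \<in> points M \<Longrightarrow> \<xi> (f p) \<in> normal_space M N h f p" and c: "c \<in> atlas M"
  shows "closed_two_form_on (cmap c ` cdom c) (induced_form M N \<phi> h f c)"
proof -
  have acm: "almost_contact_metric N \<phi> \<xi> \<eta> h"
    using gqs by (simp add: generalized_quasi_sasakian_def)
  have N: "smooth_manifold N" and \<phi>: "tensor_field_11 N \<phi>" and h: "riemannian_metric N h"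
    using acm by (auto simp: almost_contact_metric_def)
  let ?\<omega> = "induced_form M N \<phi> h f c" and ?S = "cmap c ` cdom c"
  note ic = atlas_is_chart[OF M c]
  have skewN: "h y u (\<phi> y v) = - h y v (\<phi> y u)" if "y \<in> points N" for y u v
  proof -
    have "h y (\<phi> y u) v + h y u (\<phi> y v) = 0" using acm that unfolding almost_contact_metric_def by blast
    moreover have "h y (\<phi> y u) v = h y v (\<phi> y u)" using h that unfolding riemannian_metric_def by blast
    ultimately show ?thesis by simp
  qed
  define F where "F = (\<lambda>d::('n, 'e) chart. cmap d \<circ> f \<circ> cinv c)"
  define U where "U = (\<lambda>d::('n, 'e) chart. cmap c ` (cdom c \<inter> f -` cdom d))"
  have oU: "open (U d)" and Fs: "smooth_on (U d) (F d)" and Fi: "F d ` U d \<subseteq> cmap d ` cdom d"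
    and \<omega>U: "x \<in> U d \<Longrightarrow> ?\<omega> x a b = fundamental_form N \<phi> h d (F d x) (fd (F d) x a) (fd (F d) x b)"
    if d: "d \<in> atlas N" for d x a b
  proof -
    show "open (U d)" unfolding U_def by (rule open_smooth_map_domain[OF M N f c d])
    show "smooth_on (U d) (F d)" unfolding U_def F_def by (rule smooth_map_chart[OF f c d])
    show "F d ` U d \<subseteq> cmap d ` cdom d" unfolding U_def F_def using cinv_cmap[OF ic] by auto
    show "?\<omega> x a b = fundamental_form N \<phi> h d (F d x) (fd (F d) x a) (fd (F d) x b)" if "x \<in> U d"
      using induced_form_eq_pullback[OF M N f c d] that unfolding U_def F_def by blast
  qed
  have at: "\<exists>q. x = cmap c q \<and> q \<in> cdom c \<and> q \<in> points M \<and> f q \<in> points N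
      \<and> chart_at N (f q) \<in> atlas N \<and> x \<in> U (chart_at N (f q))" if x: "x \<in> ?S" for x
  proof -
    obtain q where q: "x = cmap c q" "q \<in> cdom c" using x by blast
    have "q \<in> points M" by (rule atlas_points[OF M c q(2)])
    moreover have "f q \<in> points N" by (rule smooth_map_point[OF f \<open>q \<in> points M\<close>])
    ultimately show ?thesis using q chart_at_in[OF N \<open>f q \<in> points N\<close>] unfolding U_def by blast
  qed
  show ?thesis
    unfolding closed_two_form_on_def
  proof (intro conjI ballI allI)
    fix x assume x: "x \<in> ?S"
    obtain q where q: "x = cmap c q" "q \<in> cdom c" "q \<in> points M" "f q \<in> points N"
      "chart_at N (f q) \<in> atlas N" "x \<in> U (chart_at N (f q))" using at[OF x] by blast
    define d where "d = chart_at N (f q)"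
    note d = q(5)[folded d_def] and xU = q(6)[folded d_def]
    have cx: "cinv c x = q" using q cinv_cmap[OF ic] by simp
    have l: "linear (fd (F d) x)" by (rule fd_linear[OF smooth_on_differentiable[OF Fs[OF d] xU]])
    have bF: "bilinear (fundamental_form N \<phi> h d (F d x))"
      by (rule fundamental_form_bilinear[OF N \<phi> h d]) (use Fi[OF d] xU in blast)
    have "bilinear (\<lambda>a b. fundamental_form N \<phi> h d (F d x) (fd (F d) x a) (fd (F d) x b))"
      unfolding bilinear_def
      using linear_compose[OF l bilinear_linear(1)[OF bF]] linear_compose[OF l bilinear_linear(2)[OF bF]]
      by (simp add: o_def)
    then show "bilinear (?\<omega> x)" using \<omega>U[OF d xU] by presburger
    show "?\<omega> x a b = - ?\<omega> x b a" for a b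
      unfolding induced_form_def cx by (rule skewN[OF q(4)])
    fix a b e
    have Fx: "F d x = cmap d (f q)" using cx by (simp add: F_def)
    have fqd: "f q \<in> cdom d" using chart_at_in[OF N q(4)] by (simp add: d_def)
    \<comment> \<open>This is where orthogonality of \<xi> to the submanifold is used: image vectors
      of the differential are annihilated by \<eta>.\<close>
    have \<eta>0: "\<eta> (f q) (fd (F d) x a) = 0" for a
    proof -
      have "fd (F d) x a = mdiff M N f q (tvec M c q a)"
        using mdiff_tvec[OF M N f c d q(2) fqd, of a] tvec_chart_at[OF N q(4), folded d_def] q(1)
        by (simp add: F_def)
      moreover have "h (f q) (\<xi> (f q)) (mdiff M N f q v) = 0" for v
        using \<xi>[OF q(3)] by (simp add: normal_space_def)
      moreover have "\<eta> (f q) v = h (f q) (\<xi> (f q)) v" for v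
        using acm h q(4) unfolding almost_contact_metric_def riemannian_metric_def by metis
      ultimately show ?thesis by simp
    qed
    have \<omega>cong: "fd (\<lambda>y. ?\<omega> y v w) x = fd (\<lambda>y. fundamental_form N \<phi> h d (F d y) (fd (F d) y v) (fd (F d) y w)) x" for v w
      by (rule fd_cong[OF oU[OF d] xU]) (rule \<omega>U[OF d])
    show "fd (\<lambda>y. ?\<omega> y b e) x a + fd (\<lambda>y. ?\<omega> y e a) x b + fd (\<lambda>y. ?\<omega> y a b) x e = 0"
      unfolding \<omega>cong
    proof (rule pullback_closed[OF oU[OF d] is_chartD(3)[OF atlas_is_chart[OF N d]] Fs[OF d] Fi[OF d]
          fundamental_form_bilinear[OF N \<phi> h d] smooth_on_fundamental_form[OF N \<phi> h d] xU _ refl])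
      show "fundamental_form N \<phi> h d (F d x) u v = - fundamental_form N \<phi> h d (F d x) v u" for u v
        unfolding fundamental_form_def Fx cinv_cmap[OF atlas_is_chart[OF N d] fqd] by (rule skewN[OF q(4)])
      show "fd (\<lambda>y. fundamental_form N \<phi> h d y (fd (F d) x b) (fd (F d) x e)) (F d x) (fd (F d) x a)
        + fd (\<lambda>y. fundamental_form N \<phi> h d y (fd (F d) x e) (fd (F d) x a)) (F d x) (fd (F d) x b)
        + fd (\<lambda>y. fundamental_form N \<phi> h d y (fd (F d) x a) (fd (F d) x b)) (F d x) (fd (F d) x e) = 0"
        unfolding Fx by (rule fundamental_form_closed[OF gqs q(4) d_def \<eta>0 \<eta>0 \<eta>0])
    qed
  next
    show "smooth_on ?S (\<lambda>x. ?\<omega> x a b)" for a b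
    proof (rule smooth_on_local)
      fix x assume "x \<in> ?S"
      from at[OF this] obtain d where d: "d \<in> atlas N" "x \<in> U d" by blast
      have "smooth_on (U d) (\<lambda>x. fundamental_form N \<phi> h d (F d x) (fd (F d) x a) (fd (F d) x b))"
        by (rule smooth_on_bilinear_family[OF oU[OF d(1)] Fs[OF d(1)] Fi[OF d(1)]
            fundamental_form_bilinear[OF N \<phi> h d(1)] smooth_on_fundamental_form[OF N \<phi> h d(1)]])
          (assumption | rule smooth_on_fd[OF Fs[OF d(1)]])+
      then have "smooth_on (U d) (\<lambda>x. ?\<omega> x a b)"
        by (rule smooth_on_cong[OF oU[OF d(1)], rotated]) (rule \<omega>U[OF d(1), symmetric])
      then show "\<exists>T. open T \<and> x \<in> T \<and> smooth_on T (\<lambda>x. ?\<omega> x a b)" using oU[OF d(1)] d(2) by blast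
    qed
  qed
qed

text \<open>The form vanishes on \<open>D'\<close> because $\phi D'$ is normal, and it is nondegenerate on \<open>D\<close>
  because $\phi D = D$.\<close>

lemma anti_invariant_distribution_eq_kernel:
  assumes acm: "almost_contact_metric N \<phi> \<xi> \<eta> h"
    and si: "semi_invariant_xi_perp_submanifold M g f D D' N \<phi> \<xi> h" and q: "q \<in> points M"
  shows "v \<in> D' q \<longleftrightarrow> (\<forall>u. h (f q) (mdiff M N f q v) (\<phi> (f q) (mdiff M N f q u)) = 0)" (is "?l \<longleftrightarrow> ?r")
proof -
  have M: "smooth_manifold M" and g: "riemannian_metric M g" and iso: "isometric_immersion M g N h f"
    using si by (auto simp: semi_invariant_xi_perp_submanifold_def)
  have f: "smooth_map M N f" using iso by (simp add: isometric_immersion_def)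
  have N: "smooth_manifold N" and h: "riemannian_metric N h"
    using acm by (auto simp: almost_contact_metric_def)
  have y: "f q \<in> points N" by (rule smooth_map_point[OF f q])
  have skew: "h (f q) (\<phi> (f q) a) b + h (f q) a (\<phi> (f q) b) = 0" for a b
    using acm y unfolding almost_contact_metric_def by blast
  have l: "linear (mdiff M N f q)" by (rule linear_mdiff[OF M N f q])
  have bil: "bilinear (h (f q))" using h y by (simp add: riemannian_metric_def)
  have "\<forall>q\<in>points M. (\<forall>u\<in>D q. \<forall>v\<in>D' q. g q u v = 0) \<and> (\<forall>w. \<exists>u\<in>D q. \<exists>v\<in>D' q. w = u + v) \<and>
      \<phi> (f q) ` mdiff M N f q ` D q = mdiff M N f q ` D q \<and>
      \<phi> (f q) ` mdiff M N f q ` D' q \<subseteq> normal_space M N h f q"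
    using si unfolding semi_invariant_xi_perp_submanifold_def by (elim conjE) assumption
  note all = bspec[OF this q]
  have split: "\<exists>u\<in>D q. \<exists>v\<in>D' q. w = u + v" for w
    using conjunct1[OF conjunct2[OF all]] by (rule spec)
  have inv: "\<phi> (f q) ` mdiff M N f q ` D q = mdiff M N f q ` D q"
    and anti: "\<phi> (f q) ` mdiff M N f q ` D' q \<subseteq> normal_space M N h f q"
    using conjunct2[OF conjunct2[OF all]] by simp_all
  have ker: "h (f q) (mdiff M N f q v) (\<phi> (f q) (mdiff M N f q u)) = 0" if "v \<in> D' q" for v u
  proof -
    have "h (f q) (\<phi> (f q) (mdiff M N f q v)) (mdiff M N f q u) = 0"
      using anti that by (auto simp: normal_space_def)
    then show ?thesis using skew[of "mdiff M N f q v" "mdiff M N f q u"] by simp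
  qed
  show ?thesis
  proof
    assume r: ?r
    obtain a b where ab: "a \<in> D q" "b \<in> D' q" "v = a + b" using split by blast
    \<comment> \<open>Invariance of \<open>D\<close> provides \<open>e\<close> for which \<phi>
      sends the image of \<open>e\<close> to the image of the \<open>D\<close>-part
      \<open>a\<close>. Testing \<open>v\<close> against \<open>e\<close> then computes
      \<open>g q a a\<close>, since the \<open>D'\<close>-part contributes nothing.\<close>
    have "mdiff M N f q a \<in> \<phi> (f q) ` mdiff M N f q ` D q" using inv ab(1) by blast
    then obtain e where e: "mdiff M N f q a = \<phi> (f q) (mdiff M N f q e)" by blast
    have "h (f q) (mdiff M N f q v) (\<phi> (f q) (mdiff M N f q e)) = 0" using r by blast
    then have "h (f q) (mdiff M N f q a) (\<phi> (f q) (mdiff M N f q e)) = 0"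
      using ker[OF ab(2)] unfolding ab(3) linear_add[OF l] bilinear_ladd[OF bil] by simp
    then have "g q a a = 0"
      unfolding e[symmetric] using iso q unfolding isometric_immersion_def by metis
    then have "a = 0" using g q unfolding riemannian_metric_def by (metis less_irrefl)
    then show ?l using ab by simp
  qed (use ker in blast)
qed

section \<open>Restricting and composing charts\<close>

text \<open>Slice charts may come from the maximal atlas, so a chart followed by a diffeomorphism of
  open sets qualifies: its transition maps are those of \<open>c\<close> composed with \<psi> or
  \<theta>.\<close>

lemma admissible_chart_compose:
  fixes M :: "('m, 'd::euclidean_space) mfd" and W V :: "'d set"
  assumes M: "smooth_manifold M" and c: "c \<in> atlas M"
    and W: "open W" "W \<subseteq> cmap c ` cdom c" and V: "open V" "\<psi> ` W \<subseteq> V" "\<theta> ` V \<subseteq> W"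
    and inv: "\<And>x. x \<in> W \<Longrightarrow> \<theta> (\<psi> x) = x" "\<And>z. z \<in> V \<Longrightarrow> \<psi> (\<theta> z) = z"
    and sm: "smooth_on W \<psi>" "smooth_on V \<theta>"
  shows "admissible_chart M ({q \<in> cdom c. cmap c q \<in> W}, \<psi> \<circ> cmap c)"
proof -
  note ic = atlas_is_chart[OF M c]
  define A where "A = {q \<in> cdom c. cmap c q \<in> W}"
  define k where "k = (A, \<psi> \<circ> cmap c)"
  have kd: "cdom k = A" "cmap k = \<psi> \<circ> cmap c" by (simp_all add: k_def)
  have opA: "openin (mtop M) A" unfolding A_def by (rule openin_chart_preimage[OF ic W(1)])
  have Ac: "A \<subseteq> cdom c" by (auto simp: A_def)
  have cA: "cmap c ` A = W" using W(2) by (auto simp: A_def)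
  have \<psi>W: "\<psi> ` W = V" using V(2,3) inv(2) by (auto simp: image_iff) (metis image_subset_iff)
  have kV: "cmap k ` cdom k = V" using cA \<psi>W by (simp only: kd image_comp[symmetric])
  have hom: "homeomorphic_map (subtopology (mtop M) (cdom c)) (top_of_set (cmap c ` cdom c)) (cmap c)"
    using ic by (simp add: is_chart_def)
  have "homeomorphic_map (subtopology (subtopology (mtop M) (cdom c)) A)
      (subtopology (top_of_set (cmap c ` cdom c)) W) (cmap c)"
    using Ac is_chartD(2)[OF ic] W(2) cA
    by (intro homeomorphic_map_subtopologies[OF hom])
      (auto simp: topspace_subtopology A_def)
  then have 1: "homeomorphic_map (subtopology (mtop M) A) (top_of_set W) (cmap c)"
    using Ac W(2) by (simp add: subtopology_subtopology Int_absorb1)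
  have "homeomorphic_maps (top_of_set W) (top_of_set V) \<psi> \<theta>"
    using smooth_on_continuous[OF sm(1)] smooth_on_continuous[OF sm(2)] V(2,3) inv
    by (auto simp: homeomorphic_maps_def)
  then have 2: "homeomorphic_map (top_of_set W) (top_of_set V) \<psi>"
    by (rule homeomorphic_maps_imp_map)
  have ik: "is_chart (mtop M) k"
    unfolding is_chart_def kV using homeomorphic_map_compose[OF 1 2] opA V(1) by (simp add: kd)
  \<comment> \<open>\<open>cinv\<close> is a choice of preimage; injectivity of both charts on their
    domains identifies the two choices.\<close>
  have ck: "cinv k z = cinv c (\<theta> z)" if z: "z \<in> V" for z
  proof -
    have "\<theta> z \<in> W" using V(3) z by blast
    then obtain q where q: "q \<in> A" "cmap c q = \<theta> z" using cA by (metis imageE)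
    have "cmap k q = z" using q inv(2)[OF z] by (simp add: kd)
    then have "cinv k z = q" using cinv_cmap[OF ik] q kd by metis
    moreover have "cinv c (\<theta> z) = q" using cinv_cmap[OF ic, of q] q Ac by auto
    ultimately show ?thesis by simp
  qed
  have "smooth_compat k e" if e: "e \<in> atlas M" for e
    unfolding smooth_compat_def
  proof
    note ie = atlas_is_chart[OF M e]
    let ?Sk = "cmap k ` (cdom k \<inter> cdom e)" and ?Se = "cmap e ` (cdom k \<inter> cdom e)"
    have ok: "open ?Sk" by (rule open_chart_image[OF ik is_chartD(1)[OF ie]])
    have oe: "open ?Se" using open_chart_image[OF ie, of A] opA by (simp add: kd Int_commute)
    have SV: "?Sk \<subseteq> V" using kV by blast
    have "smooth_on ?Sk (\<lambda>z. (cmap e \<circ> cinv c) (\<theta> z))"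
    proof (rule smooth_on_compose[OF ok smooth_on_subset[OF sm(2) SV] atlas_transition[OF M c e]])
      show "\<theta> ` ?Sk \<subseteq> cmap c ` (cdom c \<inter> cdom e)"
        using inv(1) by (auto simp: kd A_def)
    qed
    then show "smooth_on ?Sk (cmap e \<circ> cinv k)"
      by (rule smooth_on_cong[OF ok, rotated]) (use ck SV in auto)
    have cAe: "cmap c (cinv e x) \<in> W" if "x \<in> ?Se" for x
      using that cinv_cmap[OF ie] by (auto simp: kd A_def)
    have "smooth_on ?Se (\<lambda>x. \<psi> ((cmap c \<circ> cinv e) x))"
      by (rule smooth_on_compose[OF oe smooth_on_subset[OF atlas_transition[OF M e c]] sm(1)])
        (use Ac cAe in \<open>auto simp: kd\<close>)
    then show "smooth_on ?Se (cmap k \<circ> cinv e)" by (simp add: kd o_def)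
  qed
  then show ?thesis using ik unfolding admissible_chart_def k_def A_def by blast
qed

lemma tcoord_compose_chart:
  assumes M: "smooth_manifold M" and c: "c \<in> atlas M" and q: "q \<in> cdom c"
    and \<psi>: "\<psi> differentiable (at (cmap c q))"
  shows "tcoord M (A, \<psi> \<circ> cmap c) q v = fd \<psi> (cmap c q) (tcoord M c q v)"
proof -
  have p: "q \<in> points M" by (rule atlas_points[OF M c q])
  note k = chart_at_in[OF M p]
  have e: "(cmap c \<circ> cinv (chart_at M q)) (cmap (chart_at M q) q) = cmap c q"
    using cinv_cmap[OF atlas_is_chart[OF M k(1)] k(2)] by simp
  have "fd (\<lambda>x. \<psi> ((cmap c \<circ> cinv (chart_at M q)) x)) (cmap (chart_at M q) q) v
     = fd \<psi> ((cmap c \<circ> cinv (chart_at M q)) (cmap (chart_at M q) q))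
        (fd (cmap c \<circ> cinv (chart_at M q)) (cmap (chart_at M q) q) v)"
    by (rule fd_compose[OF atlas_transition_differentiable[OF M k(1) c k(2) q]]) (subst e, rule \<psi>)
  then show ?thesis unfolding e by (simp add: tcoord_def o_def)
qed

theorem theorem1:
  fixes N :: "('n, 'e::euclidean_space) mfd"
    and \<phi> :: "'n \<Rightarrow> 'e \<Rightarrow> 'e" and \<xi> :: "'n \<Rightarrow> 'e" and \<eta> :: "'n \<Rightarrow> 'e \<Rightarrow> real"
    and h :: "'n \<Rightarrow> 'e \<Rightarrow> 'e \<Rightarrow> real"
    and nabla :: "('n \<Rightarrow> 'e) \<Rightarrow> ('n \<Rightarrow> 'e) \<Rightarrow> 'n \<Rightarrow> 'e"
    and M :: "('m, 'd::euclidean_space) mfd"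
    and g :: "'m \<Rightarrow> 'd \<Rightarrow> 'd \<Rightarrow> real"
    and f :: "'m \<Rightarrow> 'n"
    and D D_perp :: "'m \<Rightarrow> 'd set"
  assumes "generalized_quasi_sasakian N \<phi> \<xi> \<eta> h nabla"
    and "semi_invariant_xi_perp_submanifold M g f D D_perp N \<phi> \<xi> h"
  shows "integrable_distribution M D_perp"
  unfolding integrable_distribution_def
proof
  fix p assume p: "p \<in> points M"
  have acm: "almost_contact_metric N \<phi> \<xi> \<eta> h"
    using assms(1) by (simp add: generalized_quasi_sasakian_def)
  have M: "smooth_manifold M" and f: "smooth_map M N f"
    and \<xi>: "\<And>p. p \<in> points M \<Longrightarrow> \<xi> (f p) \<in> normal_space M N h f p"
    and dist: "smooth_distribution M D_perp"
    using assms(2) by (auto simp: semi_invariant_xi_perp_submanifold_def isometric_immersion_def)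
  define c where "c = chart_at M p"
  have c: "c \<in> atlas M" and pc: "p \<in> cdom c" unfolding c_def by (rule chart_at_in[OF M p])+
  note ic = atlas_is_chart[OF M c]
  let ?S = "cmap c ` cdom c" and ?\<omega> = "induced_form M N \<phi> h f c"
  \<comment> \<open>The kernel is tested with coordinate vectors; \<open>tvec M c q\<close> is onto,
    so this is the same as testing with all tangent vectors at \<open>q\<close>.\<close>
  have ker: "v \<in> D_perp q \<longleftrightarrow> tcoord M c q v \<in> form_kernel (?\<omega> (cmap c q))" if q: "q \<in> cdom c" for q v
  proof -
    have "(\<forall>u. h (f q) (mdiff M N f q v) (\<phi> (f q) (mdiff M N f q u)) = 0)
      \<longleftrightarrow> (\<forall>b. h (f q) (mdiff M N f q v) (\<phi> (f q) (mdiff M N f q (tvec M c q b))) = 0)"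
      using tvec_tcoord[OF M c q] by metis
    then show ?thesis
      using anti_invariant_distribution_eq_kernel[OF acm assms(2) atlas_points[OF M c q], of v]
      by (simp add: form_kernel_def induced_form_def cinv_cmap[OF ic q] tvec_tcoord[OF M c q])
  qed
  obtain k where k: "\<And>q. q \<in> points M \<Longrightarrow> dim (D_perp q) = k"
    using dist unfolding smooth_distribution_def by metis
  \<comment> \<open>The constant rank of the distribution passes to the kernel because
    \<open>tcoord M c q\<close> is an isomorphism carrying one to the other.\<close>
  have dimk: "dim (form_kernel (?\<omega> x)) = k" if x: "x \<in> ?S" for x
  proof -
    obtain q where q: "x = cmap c q" "q \<in> cdom c" using x by blast
    have "form_kernel (?\<omega> x) = tcoord M c q ` D_perp q"
    proof
      show "form_kernel (?\<omega> x) \<subseteq> tcoord M c q ` D_perp q"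
      proof
        fix a assume "a \<in> form_kernel (?\<omega> x)"
        then have "tvec M c q a \<in> D_perp q" using ker[OF q(2)] tcoord_tvec_same[OF M c q(2)] q(1) by simp
        then show "a \<in> tcoord M c q ` D_perp q" using tcoord_tvec_same[OF M c q(2), of a] by force
      qed
    qed (use ker[OF q(2)] q(1) in blast)
    moreover have "inj (tcoord M c q)" using tvec_tcoord[OF M c q(2)] by (metis injI)
    ultimately show ?thesis
      using dim_image_eq[OF linear_tcoord[OF M c q(2)]] k[OF atlas_points[OF M c q(2)]]
      by (metis inj_on_subset subset_UNIV)
  qed
  have x0: "cmap c p \<in> ?S" using pc by blast
  obtain W V E :: "'d set" and \<psi> \<theta> :: "'d \<Rightarrow> 'd" where W: "open W" "cmap c p \<in> W" "W \<subseteq> ?S"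
    and V: "open V" "\<psi> ` W \<subseteq> V" "\<theta> ` V \<subseteq> W"
    and inv: "\<And>x. x \<in> W \<Longrightarrow> \<theta> (\<psi> x) = x" "\<And>z. z \<in> V \<Longrightarrow> \<psi> (\<theta> z) = z"
    and sm: "smooth_on W \<psi>" "smooth_on V \<theta>" and E: "subspace E"
    and flat: "\<And>x. x \<in> W \<Longrightarrow> \<psi> x - \<psi> (cmap c p) \<in> E \<Longrightarrow> form_kernel (?\<omega> x) = {v. fd \<psi> x v \<in> E}"
    by (rule flat_coordinates_form_kernel[OF is_chartD(3)[OF ic] x0 induced_form_closed[OF assms(1) M f \<xi> c] dimk])
      (assumption | rule that)+
  define A where "A = {q \<in> cdom c. cmap c q \<in> W}"
  define e where "e = (A, \<psi> \<circ> cmap c)"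
  have adm: "admissible_chart M e"
    unfolding e_def A_def by (rule admissible_chart_compose[OF M c W(1,3) V inv sm])
  define S where "S = {q \<in> A. cmap e q - cmap e p \<in> E}"
  have Spts: "S \<subseteq> points M" using atlas_points[OF M c] by (auto simp: S_def A_def)
  have "integral_manifold M D_perp S"
    unfolding integral_manifold_def
  proof (intro conjI Spts ballI exI)
    fix q assume q: "q \<in> S"
    have qc: "q \<in> cdom c" "cmap c q \<in> W" and qE: "cmap e q - cmap e p \<in> E" and qA: "q \<in> A"
      using q by (auto simp: S_def A_def)
    \<comment> \<open>\<open>S\<close> is defined as the slice through \<open>p\<close>, while a
      slice chart at \<open>q\<close> is based at \<open>q\<close>. The two descriptions agree
      because \<open>E\<close> is a subspace containing the difference of the base points.\<close>
    have "cmap e r - cmap e p \<in> E \<longleftrightarrow> cmap e r - cmap e q \<in> E" for r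
      using subspace_diff[OF E _ qE, of "cmap e r - cmap e p"] subspace_add[OF E _ qE, of "cmap e r - cmap e q"]
      by auto
    then show "slice_chart M S q e E"
      using adm E qA unfolding slice_chart_def by (auto simp: S_def e_def)
    have "tcoord M e q v = fd \<psi> (cmap c q) (tcoord M c q v)" for v
      unfolding e_def by (rule tcoord_compose_chart[OF M c qc(1) smooth_on_differentiable[OF sm(1) qc(2)]])
    moreover have "form_kernel (?\<omega> (cmap c q)) = {v. fd \<psi> (cmap c q) v \<in> E}"
      using flat[OF qc(2)] qE by (simp add: e_def)
    ultimately show "D_perp q = {v. tcoord M e q v \<in> E}" using ker[OF qc(1)] by auto
  qed
  moreover have "p \<in> S" using pc W(2) subspace_0[OF E] by (simp add: S_def A_def)
  ultimately show "\<exists>S. p \<in> S \<and> integral_manifold M D_perp S" by blast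
qed

end
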